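(* Let $\mathfrak{g}$ be a complex simple Lie algebra and $\mathfrak{q}=\mathfrak{m}+\mathfrak{n}\neq\mathfrak{g}$ a proper standard parabolic subalgebra with standard Levi factor $\mathfrak{m}$ and nilradical $\mathfrak{n}$. Let $\mathfrak{t}=\mathrm{cent}\,\mathfrak{m}$, and let $\beta_1,\ldots,\beta_{\ell(\mathfrak{t})}$, $\mathfrak{n}(k)$ and $k(\mathrm{cent})$ be as defined in the context. Let $i$ be any integer with $2\le i\le k(\mathrm{cent})$ and let $\nu\in R$ be such that $\mathfrak{g}_\nu\subset\mathfrak{n}(i)$. Then there exist $j\in\{1,\ldots,\ell(\mathfrak{t})\}$ and $\mu\in R$ with $\mathfrak{g}_\mu\subset\mathfrak{n}(i-1)$ such that $$[\mathfrak{g}_{\beta_j},\mathfrak{g}_\mu]=\mathfrak{g}_\nu,$$ so that $$[\mathfrak{n}(1),\mathfrak{n}(i-1)]=\mathfrak{n}(i).$$ In particular the lower central series $\mathfrak{n}^i$ of $\mathfrak{n}$ is given by $$\mathfrak{n}^i=\sum_{j=i}^{k(\mathrm{cent})}\mathfrak{n}(j),$$ so that $k(\mathrm{cent})$ is the length of the lower central series of $\mathfrak{n}$ (as well as of the upper central series). The lower and upper central series of $\mathfrak{n}$ are therefore, except for indexing, the same: $$\mathfrak{n}^i=\mathfrak{n}_{k(\mathrm{cent})-i+1}\qquad\text{for } i=1,\ldots,k(\mathrm{cent}).$$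
   Context: Fix a Cartan subalgebra $\mathfrak{h}$ of $\mathfrak{g}$, with roots $\Delta$, positive roots $\Delta_+$, simple roots $\Pi$, highest root $\psi$, and corresponding Borel subalgebra $\mathfrak{b}$. A standard parabolic subalgebra is a Lie subalgebra $\mathfrak{q}\supset\mathfrak{b}$; $\mathfrak{m}$ is its unique Levi factor containing $\mathfrak{h}$. For $\varphi\in\Delta$ write $\varphi=\sum_{\alpha\in\Pi}n_\alpha(\varphi)\alpha$. For $\nu\in\mathfrak{t}^*$ put $\mathfrak{g}_\nu=\{z\in\mathfrak{g}\mid [x,z]=\nu(x)z\ \text{for all }x\in\mathfrak{t}\}$; a $\mathfrak{t}$-root is a nonzero $\nu\in\mathfrak{t}^*$ with $\mathfrak{g}_\nu\neq0$, and $R$ is the set of $\mathfrak{t}$-roots. Let $\ell(\mathfrak{t})=\dim\mathfrak{t}$, let $\alpha_1,\ldots,\alpha_{\ell(\mathfrak{t})}$ be the simple roots of $\mathfrak{g}$ that are not roots of $\mathfrak{m}$, and let $\beta_j=\alpha_j|_{\mathfrak{t}}\in R$. For $\nu\in R$ put $n_j(\nu)=n_{\alpha_j}(\varphi)$, where $\varphi\in\Delta$ is any root with $\varphi|_{\mathfrak{t}}=\nu$ (independent of the choice of $\varphi$), and $o(\nu)=\sum_{j=1}^{\ell(\mathfrak{t})}n_j(\nu)$. For a nonnegative integer $k$ put $\mathfrak{n}(k)=\sum_{\nu\in R,\ o(\nu)=k}\mathfrak{g}_\nu$. Put $k(\mathrm{cent})=\sum_{i=1}^{\ell(\mathfrak{t})}n_{\alpha_i}(\psi)$.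 The upper central series of $\mathfrak{n}$ is the sequence of distinct ideals $\mathfrak{n}_1\subset\mathfrak{n}_2\subset\cdots\subset\mathfrak{n}_d=\mathfrak{n}$ with $\mathfrak{n}_1=\mathrm{cent}\,\mathfrak{n}$ the center and $\mathfrak{n}_i/\mathfrak{n}_{i-1}=\mathrm{cent}(\mathfrak{n}/\mathfrak{n}_{i-1})$ for $i\ge2$; $d$ is its length. The lower central series is $\mathfrak{n}^1=\mathfrak{n}$, $\mathfrak{n}^i=[\mathfrak{n},\mathfrak{n}^{i-1}]$ for $i>1$; its length is the maximal $k$ with $\mathfrak{n}^k\neq0$. *)

theory Defs
  imports Complex_Main "HOL-Library.Function_Algebras"
begin

class complex_lie_algebra = ab_group_add +
  fixes scaleC :: "complex \<Rightarrow> 'a \<Rightarrow> 'a"  (infixr \<open>*\<^sub>C\<close> 75)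
    and bracket :: "'a \<Rightarrow> 'a \<Rightarrow> 'a"
  assumes scaleC_add_right: "c *\<^sub>C (x + y) = c *\<^sub>C x + c *\<^sub>C y"
    and scaleC_add_left: "(c + d) *\<^sub>C x = c *\<^sub>C x + d *\<^sub>C x"
    and scaleC_scaleC: "c *\<^sub>C d *\<^sub>C x = (c * d) *\<^sub>C x"
    and scaleC_one: "1 *\<^sub>C x = x"
    and bracket_add_left: "bracket (x + y) z = bracket x z + bracket y z"
    and bracket_add_right: "bracket x (y + z) = bracket x y + bracket x z"
    and bracket_scaleC_left: "bracket (c *\<^sub>C x) y = c *\<^sub>C bracket x y"
    and bracket_scaleC_right: "bracket x (c *\<^sub>C y) = c *\<^sub>C bracket x y"
    and bracket_self: "bracket x x = 0"
    and jacobi: "bracket x (bracket y z) + bracket y (bracket z x) + bracket z (bracket x y) = 0"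

interpretation cvec: vector_space "scaleC :: complex \<Rightarrow> 'a \<Rightarrow> 'a::complex_lie_algebra"
  by unfold_locales
    (simp_all add: scaleC_add_right scaleC_add_left scaleC_scaleC scaleC_one)

interpretation cfun: vector_space "\<lambda>(c::complex) (f :: 'a \<Rightarrow> complex) x. c * f x"
  by unfold_locales (simp_all add: fun_eq_iff algebra_simps)

text \<open>The ambient Lie algebra is the whole type; its subalgebras, ideals and subspaces
  are sets.\<close>

definition finite_dimensional :: "'a::complex_lie_algebra set \<Rightarrow> bool" where
  "finite_dimensional L \<longleftrightarrow> (\<exists>B. finite B \<and> cvec.span B = L)"

definition lie_prod :: "'a::complex_lie_algebra set \<Rightarrow> 'a set \<Rightarrow> 'a set" where
  "lie_prod A B = cvec.span {bracket x y | x y. x \<in> A \<and> y \<in> B}"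

definition lie_subalgebra :: "'a::complex_lie_algebra set \<Rightarrow> bool" where
  "lie_subalgebra L \<longleftrightarrow> cvec.subspace L \<and> (\<forall>x\<in>L. \<forall>y\<in>L. bracket x y \<in> L)"

definition lie_ideal :: "'a::complex_lie_algebra set \<Rightarrow> 'a set \<Rightarrow> bool" where
  "lie_ideal L I \<longleftrightarrow> cvec.subspace I \<and> I \<subseteq> L \<and> (\<forall>x\<in>L. \<forall>y\<in>I. bracket x y \<in> I)"

definition lie_center :: "'a::complex_lie_algebra set \<Rightarrow> 'a set" where
  "lie_center L = {x \<in> L. \<forall>y\<in>L. bracket x y = 0}"

definition simple_lie_algebra :: "'a::complex_lie_algebra set \<Rightarrow> bool" where
  "simple_lie_algebra L \<longleftrightarrow> lie_subalgebra L \<and> finite_dimensional L \<and>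
     lie_prod L L \<noteq> {0} \<and> (\<forall>I. lie_ideal L I \<longrightarrow> I = {0} \<or> I = L)"

text \<open>The lower central series is indexed from 1: the first term is \<open>L\<close> itself.
  Index 0 gives \<open>L\<close> again.\<close>

definition lower_central :: "'a::complex_lie_algebra set \<Rightarrow> nat \<Rightarrow> 'a set" where
  "lower_central L i = (lie_prod L ^^ (i - 1)) L"

definition lower_central_length :: "'a::complex_lie_algebra set \<Rightarrow> nat \<Rightarrow> bool" where
  "lower_central_length L k \<longleftrightarrow> 1 \<le> k \<and> lower_central L k \<noteq> {0} \<and>
     (\<forall>j. lower_central L j \<noteq> {0} \<longrightarrow> j \<le> k)"

text \<open>The \<open>Suc\<close> clause is the preimage in \<open>L\<close> of the center of the quotient of \<open>L\<close>
  by the previous term.  Starting from \<open>{0}\<close> at index 0, the term with index 1 is the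
  center of \<open>L\<close>.\<close>

primrec upper_central :: "'a::complex_lie_algebra set \<Rightarrow> nat \<Rightarrow> 'a set" where
  "upper_central L 0 = {0}"
| "upper_central L (Suc i) = {x \<in> L. \<forall>y\<in>L. bracket x y \<in> upper_central L i}"

definition upper_central_length :: "'a::complex_lie_algebra set \<Rightarrow> nat \<Rightarrow> bool" where
  "upper_central_length L d \<longleftrightarrow> 1 \<le> d \<and> upper_central L d = L \<and>
     (\<forall>i\<in>{1..<d}. upper_central L i \<subset> upper_central L (Suc i))"

definition nilpotent :: "'a::complex_lie_algebra set \<Rightarrow> bool" where
  "nilpotent L \<longleftrightarrow> (\<exists>k. lower_central L k = {0})"

definition solvable :: "'a::complex_lie_algebra set \<Rightarrow> bool" where
  "solvable L \<longleftrightarrow> (\<exists>k. ((\<lambda>A. lie_prod A A) ^^ k) L = {0})"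

text \<open>Reductive: the radical is the center.\<close>

definition reductive :: "'a::complex_lie_algebra set \<Rightarrow> bool" where
  "reductive L \<longleftrightarrow> lie_subalgebra L \<and>
     (\<forall>I. lie_ideal L I \<and> solvable I \<longrightarrow> I \<subseteq> lie_center L)"

definition is_nilradical :: "'a::complex_lie_algebra set \<Rightarrow> 'a set \<Rightarrow> bool" where
  "is_nilradical L N \<longleftrightarrow> lie_ideal L N \<and> nilpotent N \<and>
     (\<forall>I. lie_ideal L I \<and> nilpotent I \<longrightarrow> I \<subseteq> N)"

text \<open>A Levi factor of a parabolic subalgebra \<open>Q\<close> with nilradical \<open>N\<close>: a reductive
  complement of \<open>N\<close> (as opposed to a semisimple complement of the solvable radical).\<close>

definition levi_factor :: "'a::complex_lie_algebra set \<Rightarrow> 'a set \<Rightarrow> 'a set \<Rightarrow> bool" where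
  "levi_factor Q N M \<longleftrightarrow> reductive M \<and> M \<inter> N = {0} \<and> Q = {x + y | x y. x \<in> M \<and> y \<in> N}"

definition cartan_subalgebra :: "'a::complex_lie_algebra set \<Rightarrow> bool" where
  "cartan_subalgebra H \<longleftrightarrow> lie_subalgebra H \<and> nilpotent H \<and>
     {x. \<forall>y\<in>H. bracket x y \<in> H} = H"

text \<open>An element of the dual of a subspace \<open>S\<close> is represented by the function that agrees
  with it on \<open>S\<close> and vanishes outside \<open>S\<close>, so that equality of functionals is equality of
  functions.\<close>

definition dual :: "'a::complex_lie_algebra set \<Rightarrow> ('a \<Rightarrow> complex) set" where
  "dual S = {f. (\<forall>x\<in>S. \<forall>y\<in>S. f (x + y) = f x + f y) \<and>
                (\<forall>c. \<forall>x\<in>S. f (c *\<^sub>C x) = c * f x) \<and>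
                (\<forall>x. x \<notin> S \<longrightarrow> f x = 0)}"

definition restr :: "'a set \<Rightarrow> ('a \<Rightarrow> complex) \<Rightarrow> 'a \<Rightarrow> complex" where
  "restr S f = (\<lambda>x. if x \<in> S then f x else 0)"

definition weight_space :: "'a::complex_lie_algebra set \<Rightarrow> ('a \<Rightarrow> complex) \<Rightarrow> 'a set" where
  "weight_space S \<nu> = {z. \<forall>x\<in>S. bracket x z = \<nu> x *\<^sub>C z}"

text \<open>For a Cartan subalgebra \<open>S\<close> these are the roots, for \<open>S = cent \<mm>\<close> the
  \<open>\<tt>\<close>-roots.\<close>

definition roots :: "'a::complex_lie_algebra set \<Rightarrow> ('a \<Rightarrow> complex) set" where
  "roots S = {\<nu> \<in> dual S. \<nu> \<noteq> 0 \<and> weight_space S \<nu> \<noteq> {0}}"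

definition int_combination ::
  "('a \<Rightarrow> complex) set \<Rightarrow> (('a \<Rightarrow> complex) \<Rightarrow> int) \<Rightarrow> ('a \<Rightarrow> complex) \<Rightarrow> bool" where
  "int_combination P n \<phi> \<longleftrightarrow>
     (\<forall>x. \<phi> x = (\<Sum>\<alpha>\<in>P. of_int (n \<alpha>) * \<alpha> x)) \<and> (\<forall>\<alpha>. \<alpha> \<notin> P \<longrightarrow> n \<alpha> = 0)"

text \<open>A choice of simple roots, i.e. a base of the root system; it determines the
  positive roots.\<close>

definition simple_roots :: "'a::complex_lie_algebra set \<Rightarrow> ('a \<Rightarrow> complex) set \<Rightarrow> bool" where
  "simple_roots H P \<longleftrightarrow> P \<subseteq> roots H \<and> finite P \<and> cfun.independent P \<and>
     (\<forall>\<phi>\<in>roots H. \<exists>n. int_combination P n \<phi> \<and> ((\<forall>\<alpha>\<in>P. n \<alpha> \<ge> 0) \<or> (\<forall>\<alpha>\<in>P. n \<alpha> \<le> 0)))"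

definition root_coeff :: "('a \<Rightarrow> complex) set \<Rightarrow> ('a \<Rightarrow> complex) \<Rightarrow> ('a \<Rightarrow> complex) \<Rightarrow> int" where
  "root_coeff P \<alpha> \<phi> = (THE n. int_combination P n \<phi>) \<alpha>"

definition positive_roots ::
  "'a::complex_lie_algebra set \<Rightarrow> ('a \<Rightarrow> complex) set \<Rightarrow> ('a \<Rightarrow> complex) set" where
  "positive_roots H P = {\<phi> \<in> roots H. \<forall>\<alpha>\<in>P. root_coeff P \<alpha> \<phi> \<ge> 0}"

definition highest_root ::
  "'a::complex_lie_algebra set \<Rightarrow> ('a \<Rightarrow> complex) set \<Rightarrow> ('a \<Rightarrow> complex) \<Rightarrow> bool" where
  "highest_root H P \<psi> \<longleftrightarrow> \<psi> \<in> roots H \<and>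
     (\<forall>\<phi>\<in>roots H. \<forall>\<alpha>\<in>P. root_coeff P \<alpha> \<phi> \<le> root_coeff P \<alpha> \<psi>)"

definition borel :: "'a::complex_lie_algebra set \<Rightarrow> ('a \<Rightarrow> complex) set \<Rightarrow> 'a set" where
  "borel H P = cvec.span (H \<union> (\<Union>\<phi>\<in>positive_roots H P. weight_space H \<phi>))"

definition standard_parabolic ::
  "'a::complex_lie_algebra set \<Rightarrow> ('a \<Rightarrow> complex) set \<Rightarrow> 'a set \<Rightarrow> bool" where
  "standard_parabolic H P Q \<longleftrightarrow> lie_subalgebra Q \<and> borel H P \<subseteq> Q"

definition roots_of_subalgebra ::
  "'a::complex_lie_algebra set \<Rightarrow> 'a set \<Rightarrow> ('a \<Rightarrow> complex) set" where
  "roots_of_subalgebra H M = {\<phi> \<in> roots H. weight_space H \<phi> \<subseteq> M}"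

text \<open>Below, \<open>a 1, \<dots>, a (dim T)\<close> enumerates the simple roots that are not roots of
  \<open>\<mm>\<close>.  The choice of the root \<open>\<phi>\<close> restricting to \<open>\<nu>\<close> does not affect the
  coefficients at these simple roots.\<close>

definition t_root_coeff ::
  "'a::complex_lie_algebra set \<Rightarrow> ('a \<Rightarrow> complex) set \<Rightarrow> 'a set \<Rightarrow> (nat \<Rightarrow> 'a \<Rightarrow> complex) \<Rightarrow>
   nat \<Rightarrow> ('a \<Rightarrow> complex) \<Rightarrow> int" where
  "t_root_coeff H P T a j \<nu> = root_coeff P (a j) (SOME \<phi>. \<phi> \<in> roots H \<and> restr T \<phi> = \<nu>)"

definition t_root_order ::
  "'a::complex_lie_algebra set \<Rightarrow> ('a \<Rightarrow> complex) set \<Rightarrow> 'a set \<Rightarrow> (nat \<Rightarrow> 'a \<Rightarrow> complex) \<Rightarrow>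
   ('a \<Rightarrow> complex) \<Rightarrow> int" where
  "t_root_order H P T a \<nu> = (\<Sum>j = 1..cvec.dim T. t_root_coeff H P T a j \<nu>)"

definition graded_part ::
  "'a::complex_lie_algebra set \<Rightarrow> ('a \<Rightarrow> complex) set \<Rightarrow> 'a set \<Rightarrow> (nat \<Rightarrow> 'a \<Rightarrow> complex) \<Rightarrow>
   nat \<Rightarrow> 'a set" where
  "graded_part H P T a k =
     cvec.span (\<Union>\<nu>\<in>{\<nu> \<in> roots T. t_root_order H P T a \<nu> = int k}. weight_space T \<nu>)"

text \<open>For the highest root \<open>\<psi>\<close> the sum is nonnegative, so \<open>nat\<close> does not truncate.\<close>

definition k_cent ::
  "('a \<Rightarrow> complex) set \<Rightarrow> ('a \<Rightarrow> complex) \<Rightarrow> 'a::complex_lie_algebra set \<Rightarrow>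
   (nat \<Rightarrow> 'a \<Rightarrow> complex) \<Rightarrow> nat" where
  "k_cent P \<psi> T a = nat (\<Sum>j = 1..cvec.dim T. root_coeff P (a j) \<psi>)"

end

theory Submission
  imports Defs "HOL-Computational_Algebra.Fundamental_Theorem_Algebra"
begin

text \<open>Everything about the root system is derived from the generalized weight spaces of the Cartan
  subalgebra. Traces over root strings show that the roots take real multiples of \<open>\<alpha>(h)\<close> on
  \<open>h \<in> [g\<^sub>\<alpha>, g\<^sub>-\<^sub>\<alpha>]\<close>; hence the Killing form is nondegenerate, the Cartan subalgebra is abelian
  and acts diagonalizably, and the induced form on the real span of the roots is positive definite.
  An argument with \<open>sl\<^sub>2\<close> then gives one-dimensional root spaces,
  \<open>[g\<^sub>\<phi>, g\<^sub>\<psi>] = g\<^sub>\<phi>\<^sub>+\<^sub>\<psi>\<close>, and the fact that \<open>\<phi> - \<alpha>\<close> is a root when \<open>(\<phi>, \<alpha>) > 0\<close>.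

  For the theorem, a root \<open>\<phi>\<close> of minimal height above a \<open>t\<close>-root \<open>\<nu>\<close> of order at least 2 satisfies
  \<open>(\<phi>, \<alpha>) > 0\<close> for some simple \<open>\<alpha>\<close>, which by minimality is not a root of the Levi factor, so
  \<open>g\<^sub>\<phi> = [g\<^sub>\<alpha>, g\<^sub>\<phi>\<^sub>-\<^sub>\<alpha>]\<close>. This spreads over \<open>g\<^sub>\<nu>\<close> because any two roots above \<open>\<nu>\<close> are joined
  by steps along simple roots of the Levi factor. Dually, if no root of order 1 can be added to \<open>\<phi>\<close>,
  the same holds for a root of maximal height above the same \<open>t\<close>-root, which must then be the highest root;
  this determines the upper central series.\<close>

section \<open>Traces and generalized eigenspaces\<close>

text \<open>A Cartan subalgebra is given only as a nilpotent self-normalizing subalgebra, and the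
  nilradical and the Levi factor only by abstract properties. Commutativity and diagonalizability of
  \<open>H\<close> therefore have to be earned, which is why traces over generalized weight spaces
  come before any root, and \<open>N\<close>, \<open>M\<close> and the center of \<open>M\<close>
  have to be computed from their characterizations. The computation rests on the order
  \<open>ord\<close> of a root, its total coefficient at the simple roots outside the Levi factor:
  order 0 gives the root spaces of the Levi factor, order at least 1 those of the nilradical. Both
  central series then become statements about the filtration \<open>F\<close> by order. From below,
  bracketing \<open>F i\<close> with \<open>F 1\<close> yields \<open>F (i + 1)\<close>; from above,
  the elements of \<open>F 1\<close> that bracket \<open>F 1\<close> into \<open>F (i + 1)\<close>
  form \<open>F i\<close>, up to the order of the highest root.\<close>

locale linear_algebra = vector_space scale for scale :: "'a::field \<Rightarrow> 'b::ab_group_add \<Rightarrow> 'b" (infixr \<open>*s\<close> 75)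
begin

abbreviation endo :: "('b \<Rightarrow> 'b) \<Rightarrow> bool" where
  "endo \<equiv> Vector_Spaces.linear scale scale"

text \<open>For \<open>f\<close> stabilizing \<open>span B\<close> this is the trace of the
  restriction, so one map on the whole type has a trace on each invariant subspace.\<close>

definition trace_on :: "'b set \<Rightarrow> ('b \<Rightarrow> 'b) \<Rightarrow> 'a" where
  "trace_on B f = (\<Sum>b\<in>B. representation B (f b) b)"

lemma linear_sum_scale:
  assumes "endo f"
  shows "f (\<Sum>b\<in>B. c b *s b) = (\<Sum>b\<in>B. c b *s f b)"
proof -
  interpret f: Vector_Spaces.linear scale scale f by fact
  show ?thesis by (simp add: f.sum f.scale)
qed

text \<open>Both traces expand to the same double sum of products of matrix entries between the two
  bases. Keeping \<open>B\<close> and \<open>C\<close> apart lets one computation yield cyclicity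
  (\<open>C = B\<close>) and independence of the basis (\<open>g\<close> the identity).\<close>

lemma trace_on_comp_commute_bases:
  assumes B: "finite B" "independent B" and C: "finite C" "independent C" and BC: "span B = span C"
    and f: "endo f" "f ` span B \<subseteq> span B"
    and g: "endo g" "g ` span B \<subseteq> span B"
  shows "trace_on B (\<lambda>x. g (f x)) = trace_on C (\<lambda>x. f (g x))"
proof -
  have *: "representation B' (g' (f' b)) b
    = (\<Sum>c\<in>C'. representation C' (f' b) c * representation B' (g' c) b)"
    if "finite C'" "independent C'" "independent B'" "span B' = span C'" "endo g'"
      "g' ` span B' \<subseteq> span B'" "f' ` span B' \<subseteq> span B'" "b \<in> B'" for B' C' f' g' b
  proof -
    have "f' b \<in> span C'" using that span_base by blast
    then have "(\<Sum>c\<in>C'. representation C' (f' b) c *s c) = f' b"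
      using that by (intro sum_representation_eq) auto
    then have "g' (f' b) = (\<Sum>c\<in>C'. representation C' (f' b) c *s g' c)"
      using linear_sum_scale[OF that(5)] by metis
    moreover have "g' c \<in> span B'" if "c \<in> C'" for c
      using that \<open>g' ` span B' \<subseteq> span B'\<close> \<open>span B' = span C'\<close> span_base by blast
    ultimately show ?thesis
      using that by (simp add: representation_sum representation_scale span_scale)
  qed
  have "trace_on B (\<lambda>x. g (f x)) = (\<Sum>b\<in>B. \<Sum>c\<in>C. representation C (f b) c * representation B (g c) b)"
    unfolding trace_on_def using assms by (intro sum.cong refl *) auto
  also have "\<dots> = (\<Sum>c\<in>C. \<Sum>b\<in>B. representation B (g c) b * representation C (f b) c)"
    by (subst sum.swap) (simp add: mult.commute)
  also have "\<dots> = trace_on C (\<lambda>x. f (g x))"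
    unfolding trace_on_def using assms by (intro sum.cong refl *[symmetric]) auto
  finally show ?thesis .
qed

lemma trace_on_comp_commute:
  assumes "finite B" "independent B" "endo f" "f ` span B \<subseteq> span B"
    and "endo g" "g ` span B \<subseteq> span B"
  shows "trace_on B (\<lambda>x. g (f x)) = trace_on B (\<lambda>x. f (g x))"
  using trace_on_comp_commute_bases[of B B f g] assms by simp

lemma trace_on_basis_indep:
  assumes "finite B" "independent B" "finite C" "independent C" "span B = span C"
    and "endo f" "f ` span B \<subseteq> span B"
  shows "trace_on B f = trace_on C f"
  using trace_on_comp_commute_bases[of B C f "\<lambda>x. x"] assms linear_id
  by (simp add: id_def)

lemma trace_on_add:
  assumes "independent B" "f ` B \<subseteq> span B" "g ` B \<subseteq> span B"
  shows "trace_on B (\<lambda>x. f x + g x) = trace_on B f + trace_on B g"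
  unfolding trace_on_def using assms by (simp add: representation_add image_subset_iff sum.distrib)

lemma trace_on_diff:
  assumes "independent B" "f ` B \<subseteq> span B" "g ` B \<subseteq> span B"
  shows "trace_on B (\<lambda>x. f x - g x) = trace_on B f - trace_on B g"
  unfolding trace_on_def using assms by (simp add: representation_diff image_subset_iff sum_subtractf)

lemma trace_on_scale:
  assumes "independent B" "f ` B \<subseteq> span B"
  shows "trace_on B (\<lambda>x. c *s f x) = c * trace_on B f"
  unfolding trace_on_def using assms by (simp add: representation_scale image_subset_iff sum_distrib_left)

lemma trace_on_scalar:
  assumes "independent B"
  shows "trace_on B (\<lambda>x. c *s x) = of_nat (card B) * c"
  unfolding trace_on_def using assms by (simp add: representation_scale span_base representation_basis)

lemma trace_on_cong: "(\<And>x. x \<in> B \<Longrightarrow> f x = g x) \<Longrightarrow> trace_on B f = trace_on B g"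
  unfolding trace_on_def by (auto intro!: sum.cong)

lemma linear_funpow: "endo f \<Longrightarrow> endo (f ^^ n)"
  by (induction n) (simp_all add: linear_id id_def[symmetric] Vector_Spaces.linear_compose)

text \<open>Induction on the dimension: the image of \<open>f\<close> is a proper stable subspace,
  and it carries the whole trace, since a basis vector outside the image contributes no diagonal
  entry.\<close>

lemma trace_on_nilpotent:
  assumes "finite B" "independent B" "endo f" "f ` span B \<subseteq> span B"
    and "\<And>v. v \<in> span B \<Longrightarrow> \<exists>n. (f ^^ n) v = 0"
  shows "trace_on B f = 0"
  using assms
proof (induction "card B" arbitrary: B rule: less_induct)
  case less
  interpret f: Vector_Spaces.linear scale scale f by fact
  show ?case
  proof (cases "B = {}")
    case True then show ?thesis by (simp add: trace_on_def)
  next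
    case False
    define W where "W = f ` span B"
    have sW: "subspace W" unfolding W_def by (intro f.subspace_image subspace_span)
    have WB: "W \<subseteq> span B" using less.prems unfolding W_def by auto
    obtain C where C: "C \<subseteq> W" "independent C" "span C = W"
      using maximal_independent_subset[of W] sW by (metis span_eq_iff span_mono subset_antisym)
    obtain D where D: "C \<subseteq> D" "D \<subseteq> span B" "independent D" "span B \<subseteq> span D"
      using maximal_independent_subset_extend[of C "span B"] C WB by blast
    have spD: "span D = span B" using D by (metis span_minimal subspace_span subset_antisym)
    have fD: "finite D" "card D \<le> card B" 
      using independent_span_bound[OF less.prems(1) D(3)] D(2) by auto
    have fC: "finite C" using D(1) fD(1) finite_subset by blast
    \<comment> \<open>Otherwise every power of \<open>f\<close> would map \<open>span B\<close> onto
      itself, while the power with the largest exponent needed on the basis kills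
      \<open>span B\<close>.\<close>
    have "W \<noteq> span B"
    proof
      assume WB: "W = span B"
      have pow: "(f ^^ n) ` span B = span B" for n
        by (induction n) (simp_all only: funpow.simps image_comp[symmetric] WB[unfolded W_def] id_apply
          image_id image_ident)
      obtain N where N: "\<And>b. b \<in> B \<Longrightarrow> (f ^^ (N b)) b = 0"
        using less.prems(5) span_base by metis
      define n where "n = Max (N ` B)"
      have f0: "(f ^^ k) 0 = 0" for k by (induction k) (simp_all add: f.zero)
      have "(f ^^ n) b = 0" if "b \<in> B" for b
      proof -
        have "N b \<le> n" using that less.prems(1) by (simp add: n_def)
        then have "(f ^^ n) b = (f ^^ (n - N b)) ((f ^^ N b) b)"
          by (metis comp_apply funpow_add le_add_diff_inverse2)
        then show ?thesis using N that f0 by simp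
      qed
      moreover have "endo (f ^^ n)" by (rule linear_funpow[OF less.prems(3)])
      ultimately have "(f ^^ n) v = 0" if "v \<in> span B" for v
        using that module_hom.eq_0_on_span[of scale scale "f ^^ n" B v] by (metis linear_iff_module_hom)
      then have "span B \<subseteq> {0}" using pow[of n] by auto
      then have "B \<subseteq> {0}" using span_superset by blast
      then show False using False less.prems(2) dependent_zero by auto
    qed
    then have "C \<noteq> D" using C spD by auto
    then have card: "card C < card B" using D fD by (metis psubsetI psubset_card_mono less_le_trans)
    \<comment> \<open>\<open>f d\<close> lies in \<open>span C\<close>, so only basis vectors from
      \<open>C\<close> occur in its expansion.\<close>
    have rep: "representation D (f d) d = (if d \<in> C then representation C (f d) d else 0)" if "d \<in> D" for d
    proof -
      have "f d \<in> span C" using that D(2) C W_def by auto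
      then have "representation D (f d) = representation C (f d)"
        using representation_extend[OF D(3) _ D(1)] by blast
      then show ?thesis using representation_ne_zero[of C "f d" d] by auto
    qed
    have "trace_on B f = trace_on D f"
      using less.prems D fD spD by (intro trace_on_basis_indep) auto
    also have "\<dots> = (\<Sum>d\<in>D. if d \<in> C then representation C (f d) d else 0)"
      unfolding trace_on_def using rep by (intro sum.cong) auto
    also have "\<dots> = trace_on C f" unfolding trace_on_def
      using D fD by (simp add: sum.If_cases Int_absorb1)
    also have "\<dots> = 0"
    proof (rule less.hyps[OF card fC C(2) less.prems(3)])
      show "f ` span C \<subseteq> span C" using C(3) WB W_def by blast
      show "\<exists>n. (f ^^ n) v = 0" if "v \<in> span C" for v using less.prems(5) that C(3) WB by blast
    qed
    finally show ?thesis .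
  qed
qed

lemma trace_on_sub_basis:
  assumes "independent B" "C \<subseteq> B" "f ` C \<subseteq> span C"
  shows "trace_on C f = (\<Sum>b\<in>C. representation B (f b) b)"
  unfolding trace_on_def using assms representation_extend[OF assms(1) _ assms(2)]
  by (intro sum.cong) auto

section \<open>Shifted operators and unions of independent sets\<close>

definition shifted :: "('b \<Rightarrow> 'b) \<Rightarrow> 'a \<Rightarrow> 'b \<Rightarrow> 'b" where
  "shifted f c v = f v - c *s v"

lemma linear_shifted: "endo f \<Longrightarrow> endo (shifted f c)"
  unfolding shifted_def Vector_Spaces.linear_iff
  by (simp add: scale_right_distrib scale_right_diff_distrib scale_left_commute)

lemma funpow_zero:
  assumes "endo f" shows "(f ^^ n) 0 = 0"
proof -
  interpret f: Vector_Spaces.linear scale scale f by fact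
  show ?thesis by (induction n) (simp_all add: f.zero)
qed

lemma funpow_zero_mono:
  assumes "endo f" "(f ^^ m) v = 0" "m \<le> n" shows "(f ^^ n) v = 0"
proof -
  have "(f ^^ n) v = (f ^^ (n - m)) ((f ^^ m) v)"
    using assms(3) by (metis comp_apply funpow_add le_add_diff_inverse2)
  then show ?thesis using assms funpow_zero by simp
qed

text \<open>Coprimality of \<open>(X - c)^m\<close> and \<open>(X - d)^n\<close> in elementary form.
  The shifts commute, so by induction on \<open>m + n\<close> both shifted images of
  \<open>v\<close> lie in \<open>V\<close>, and their difference is a nonzero multiple of
  \<open>v\<close>.\<close>

lemma mem_subspace_if_shifted_powers:
  assumes f: "endo f" and V: "subspace V" "f ` V \<subseteq> V" and "c \<noteq> d"
    and "((shifted f c) ^^ m) v \<in> V" "((shifted f d) ^^ n) v \<in> V"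
  shows "v \<in> V"
  using assms(5,6)
proof (induction "m + n" arbitrary: m n v)
  case 0 then show ?case by simp
next
  case (Suc k)
  show ?case
  proof (cases "m = 0 \<or> n = 0")
    case True then show ?thesis using Suc.prems by auto
  next
    case False
    then obtain m' n' where mn: "m = Suc m'" "n = Suc n'" by (metis not0_implies_Suc)
    have st: "shifted f a x \<in> V" if "x \<in> V" for a x
      using V that by (auto simp: shifted_def intro!: subspace_diff subspace_scale)
    have comm: "((shifted f a) ^^ i) (shifted f b x) = shifted f b (((shifted f a) ^^ i) x)" for a b i x
    proof (induction i)
      case (Suc i)
      interpret f: Vector_Spaces.linear scale scale f by fact
      have "shifted f a (shifted f b y) = shifted f b (shifted f a y)" for y
        by (simp add: shifted_def f.diff f.scale scale_right_diff_distrib algebra_simps)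
      then show ?case using Suc by simp
    qed simp
    have c: "shifted f c v \<in> V"
    proof (rule Suc.hyps(1)[of m' n])
      show "((shifted f c) ^^ m') (shifted f c v) \<in> V" using Suc.prems mn by (simp add: funpow_swap1)
      show "((shifted f d) ^^ n) (shifted f c v) \<in> V" using Suc.prems st comm by simp
    qed (use Suc mn in auto)
    have d: "shifted f d v \<in> V"
    proof (rule Suc.hyps(1)[of m n'])
      show "((shifted f d) ^^ n') (shifted f d v) \<in> V" using Suc.prems mn by (simp add: funpow_swap1)
      show "((shifted f c) ^^ m) (shifted f d v) \<in> V" using Suc.prems st comm by simp
    qed (use Suc mn in auto)
    have "shifted f c v - shifted f d v = (d - c) *s v" by (simp add: shifted_def scale_left_diff_distrib)
    then have "(d - c) *s v \<in> V" using V c d subspace_diff by metis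
    then have "(1 / (d - c)) *s (d - c) *s v \<in> V" using V subspace_scale by blast
    then show ?thesis using \<open>c \<noteq> d\<close> by simp
  qed
qed

text \<open>The hypothesis \<open>dir\<close> is directness of the sum of the spans. A linear
  relation is grouped by blocks; each block sum vanishes, and independence within the block
  finishes.\<close>

lemma independent_UN_of_direct:
  assumes ind: "\<And>i. i \<in> I \<Longrightarrow> independent (B i)"
    and dir: "\<And>J z. finite J \<Longrightarrow> J \<subseteq> I \<Longrightarrow> (\<And>i. i \<in> J \<Longrightarrow> z i \<in> span (B i)) \<Longrightarrow> (\<Sum>i\<in>J. z i) = 0 \<Longrightarrow>
        (\<And>i. i \<in> J \<Longrightarrow> z i = 0)"
  shows "independent (\<Union>i\<in>I. B i)" and "\<And>i j. i \<in> I \<Longrightarrow> j \<in> I \<Longrightarrow> i \<noteq> j \<Longrightarrow> B i \<inter> B j = {}"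
proof -
  show disj: "B i \<inter> B j = {}" if "i \<in> I" "j \<in> I" "i \<noteq> j" for i j
  proof (rule ccontr)
    assume "B i \<inter> B j \<noteq> {}"
    then obtain b where b: "b \<in> B i" "b \<in> B j" by auto
    \<comment> \<open>A vector common to both blocks gives the relation b + (- b) = 0 between
      them.\<close>
    have "(if i = i then b else - b) = 0"
      by (rule dir[of "{i, j}" "\<lambda>k. if k = i then b else - b" i])
         (use that b in \<open>auto intro: span_base span_neg\<close>)
    then show False using b ind[OF that(1)] dependent_zero by auto
  qed
  show "independent (\<Union>i\<in>I. B i)"
    unfolding independent_explicit_module
  proof (intro allI impI)
    fix S u v assume S: "finite S" "S \<subseteq> (\<Union>i\<in>I. B i)" "(\<Sum>v\<in>S. u v *s v) = 0" "v \<in> S"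
    obtain h where h: "\<And>v. v \<in> S \<Longrightarrow> h v \<in> I \<and> v \<in> B (h v)" using S(2) by (metis UN_E subsetD)
    have hS: "h w = i" if "w \<in> S" "i \<in> I" "w \<in> B i" for w i using disj h that by blast
    define z where "z i = (\<Sum>v\<in>{v\<in>S. h v = i}. u v *s v)" for i
    have "(\<Sum>i\<in>h ` S. z i) = (\<Sum>v\<in>S. u v *s v)"
      unfolding z_def using S(1) by (rule sum.image_gen[symmetric])
    then have "z (h v) = 0"
    proof (intro dir[of "h ` S" z "h v"])
      show "z i \<in> span (B i)" if "i \<in> h ` S" for i
        unfolding z_def using h by (auto intro!: span_sum span_scale intro: span_base)
    qed (use S h in auto)
    then have "(\<Sum>w\<in>{w\<in>S. h w = h v}. u w *s w) = 0" by (simp add: z_def)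
    then show "u v = 0"
      using independentD[OF ind[of "h v"], of "{w\<in>S. h w = h v}" u v] S h by fastforce
  qed
qed

end

interpretation cvec: linear_algebra "scaleC :: complex \<Rightarrow> 'a \<Rightarrow> 'a::complex_lie_algebra"
  by unfold_locales

section \<open>Generalized eigenspaces and primary decomposition\<close>

definition gen_eigenspace :: "('a \<Rightarrow> 'a) \<Rightarrow> complex \<Rightarrow> 'a::complex_lie_algebra set" where
  "gen_eigenspace f c = {v. \<exists>n. ((cvec.shifted f c) ^^ n) v = 0}"

lemma gen_eigenspaceI: "((cvec.shifted f c) ^^ n) v = 0 \<Longrightarrow> v \<in> gen_eigenspace f c"
  unfolding gen_eigenspace_def by blast

lemma subspace_gen_eigenspace:
  assumes f: "cvec.endo f"
  shows "cvec.subspace (gen_eigenspace f c)"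
proof (rule cvec.subspaceI)
  have lin: "cvec.endo (cvec.shifted f c ^^ n)" for n
    using f by (intro cvec.linear_funpow cvec.linear_shifted)
  show "0 \<in> gen_eigenspace f c" by (rule gen_eigenspaceI[of 0]) simp
  show "x + y \<in> gen_eigenspace f c" if "x \<in> gen_eigenspace f c" "y \<in> gen_eigenspace f c" for x y
  proof -
    obtain m n where mn: "(cvec.shifted f c ^^ m) x = 0" "(cvec.shifted f c ^^ n) y = 0"
      using \<open>x \<in> gen_eigenspace f c\<close> \<open>y \<in> gen_eigenspace f c\<close> by (auto simp: gen_eigenspace_def)
    interpret Vector_Spaces.linear scaleC scaleC "cvec.shifted f c ^^ max m n" by (rule lin)
    have "(cvec.shifted f c ^^ max m n) (x + y) = 0"
      using cvec.funpow_zero_mono[OF cvec.linear_shifted[OF f] mn(1), of "max m n"]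
        cvec.funpow_zero_mono[OF cvec.linear_shifted[OF f] mn(2), of "max m n"] by (simp add: add)
    then show ?thesis by (rule gen_eigenspaceI)
  qed
  show "d *\<^sub>C x \<in> gen_eigenspace f c" if "x \<in> gen_eigenspace f c" for d x
  proof -
    obtain m where m: "(cvec.shifted f c ^^ m) x = 0" using \<open>x \<in> gen_eigenspace f c\<close>
      by (auto simp: gen_eigenspace_def)
    interpret Vector_Spaces.linear scaleC scaleC "cvec.shifted f c ^^ m" by (rule lin)
    show ?thesis using m by (intro gen_eigenspaceI[of m]) (simp add: scale)
  qed
qed

text \<open>On the generalized eigenspace for \<open>d\<close>, the operator f - c is the nonzero
  scalar d - c plus a locally nilpotent operator. Induction on the nilpotency exponent of
  \<open>v\<close> builds the inverse image from one of (f - d) v.\<close>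

lemma shifted_surj_on_gen_eigenspace:
  assumes f: "cvec.endo f" and V: "cvec.subspace V" "f ` V \<subseteq> V"
    and "c \<noteq> d" and v: "v \<in> V" "v \<in> gen_eigenspace f d"
  shows "\<exists>u \<in> V \<inter> gen_eigenspace f d. cvec.shifted f c u = v"
proof -
  interpret f: Vector_Spaces.linear scaleC scaleC f by fact
  let ?s = "cvec.shifted f d"
  have "\<exists>u \<in> V \<inter> gen_eigenspace f d. cvec.shifted f c u = v" if "v \<in> V" "(?s ^^ n) v = 0" for n v
    using that
  proof (induction n arbitrary: v)
    case 0 then show ?case
      by (intro bexI[of _ 0]) (auto simp: cvec.shifted_def f.zero cvec.subspace_0 subspace_gen_eigenspace f
        V)
  next
    case (Suc n)
    have sv: "?s v \<in> V" using V Suc.prems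
      by (auto simp: cvec.shifted_def intro!: cvec.subspace_diff cvec.subspace_scale)
    moreover have "(?s ^^ n) (?s v) = 0" using Suc.prems by (simp add: funpow_swap1)
    ultimately obtain u where u: "u \<in> V" "u \<in> gen_eigenspace f d" "cvec.shifted f c u = ?s v"
      using Suc.IH by blast
    let ?w = "(1 / (d - c)) *\<^sub>C (v - u)"
    have dc: "d - c \<noteq> 0" using \<open>c \<noteq> d\<close> by simp
    have "cvec.shifted f c ?w = (1 / (d - c)) *\<^sub>C (cvec.shifted f c v - ?s v)"
      unfolding u(3)[symmetric] by (simp add: cvec.shifted_def f.diff f.scale cvec.scale_right_diff_distrib
        cvec.scale_left_commute)
    also have "cvec.shifted f c v - ?s v = (d - c) *\<^sub>C v"
      by (simp add: cvec.shifted_def cvec.scale_left_diff_distrib)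
    also have "(1 / (d - c)) *\<^sub>C (d - c) *\<^sub>C v = v" using dc by simp
    finally have "cvec.shifted f c ?w = v" .
    moreover have "v \<in> gen_eigenspace f d" using Suc.prems gen_eigenspaceI by blast
    then have "?w \<in> V \<inter> gen_eigenspace f d"
      using u V Suc.prems subspace_gen_eigenspace[OF f]
      by (auto intro!: cvec.subspace_scale cvec.subspace_diff)
    ultimately show ?case by blast
  qed
  then show ?thesis using v by (auto simp: gen_eigenspace_def)
qed

text \<open>The components of (f - c) v for eigenvalues other than \<open>c\<close> are hit by f - c
  within the span. Subtracting such a preimage \<open>u\<close> leaves \<open>v - u\<close> in the
  generalized eigenspace for \<open>c\<close>.\<close>

lemma in_span_gen_eigenspaces_if_shifted:
  assumes f: "cvec.endo f" and V: "cvec.subspace V" "f ` V \<subseteq> V" and "v \<in> V"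
    and "cvec.shifted f c v \<in> cvec.span (\<Union>d. V \<inter> gen_eigenspace f d)"
  shows "v \<in> cvec.span (\<Union>d. V \<inter> gen_eigenspace f d)"
proof -
  let ?S = "cvec.span (\<Union>d. V \<inter> gen_eigenspace f d)"
  interpret sh: Vector_Spaces.linear scaleC scaleC "cvec.shifted f c" by (rule cvec.linear_shifted[OF f])
  have "\<exists>u \<in> ?S. u \<in> V \<and> w - cvec.shifted f c u \<in> V \<inter> gen_eigenspace f c" if "w \<in> ?S" for w
    using that
  proof (induction rule: cvec.span_induct_alt)
    case base then show ?case
      by (intro bexI[of _ 0]) (auto simp: sh.zero cvec.subspace_0 subspace_gen_eigenspace f V
        cvec.span_zero)
  next
    case (step a x y)
    obtain u where u: "u \<in> ?S" "u \<in> V" "y - cvec.shifted f c u \<in> V \<inter> gen_eigenspace f c" using step by blast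
    obtain d where d: "x \<in> V" "x \<in> gen_eigenspace f d" using step by auto
    show ?case
    proof (cases "d = c")
      case True
      have "a *\<^sub>C x + (y - cvec.shifted f c u) \<in> V \<inter> gen_eigenspace f c"
        using u d True V subspace_gen_eigenspace[OF f]
          by (auto intro!: cvec.subspace_scale cvec.subspace_add)
      then show ?thesis using u by (intro bexI[of _ u]) (auto simp: algebra_simps)
    next
      case False
      then obtain x' where x': "x' \<in> V" "x' \<in> gen_eigenspace f d" "cvec.shifted f c x' = x"
        using shifted_surj_on_gen_eigenspace[OF f V _ d, of c] by auto
      have "a *\<^sub>C x' + u \<in> ?S" using x' u
        by (auto intro!: cvec.span_add cvec.span_scale intro: cvec.span_base)
      moreover have "a *\<^sub>C x' + u \<in> V" using x' u V by (auto intro!: cvec.subspace_scale cvec.subspace_add)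
      moreover have "a *\<^sub>C x + y - cvec.shifted f c (a *\<^sub>C x' + u) = y - cvec.shifted f c u"
        by (simp add: sh.add sh.scale x')
      ultimately show ?thesis using u(3) by metis
    qed
  qed
  then obtain u where u: "u \<in> ?S" "u \<in> V" "cvec.shifted f c v - cvec.shifted f c u \<in> gen_eigenspace f c"
    using assms(5) by blast
  then have "cvec.shifted f c (v - u) \<in> gen_eigenspace f c" by (simp add: sh.diff)
  then obtain n where "(cvec.shifted f c ^^ n) (cvec.shifted f c (v - u)) = 0"
    by (auto simp: gen_eigenspace_def)
  then have "(cvec.shifted f c ^^ Suc n) (v - u) = 0" by (simp add: funpow_swap1)
  then have "v - u \<in> V \<inter> gen_eigenspace f c" using gen_eigenspaceI u V \<open>v \<in> V\<close> cvec.subspace_diff by blast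
  then have "v - u \<in> ?S" by (auto intro: cvec.span_base)
  then show ?thesis using u(1) cvec.span_add by fastforce
qed

text \<open>A complex root \<open>c\<close> of the annihilating polynomial is split off; the
  quotient annihilates (f - c) v, and the previous lemma leads back to \<open>v\<close>.\<close>

lemma in_span_gen_eigenspaces_if_annihilated:
  assumes f: "cvec.endo f" and V: "cvec.subspace V" "f ` V \<subseteq> V"
    and "v \<in> V" "degree p \<le> n" "p \<noteq> 0" "(\<Sum>i\<le>n. coeff p i *\<^sub>C (f ^^ i) v) = 0"
  shows "v \<in> cvec.span (\<Union>d. V \<inter> gen_eigenspace f d)"
  using assms(4-)
proof (induction n arbitrary: p v)
  case 0
  then have "coeff p 0 \<noteq> 0" by (metis le_zero_eq leading_coeff_0_iff)
  then show ?case using 0 by (simp add: cvec.span_zero)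
next
  case (Suc n)
  interpret f: Vector_Spaces.linear scaleC scaleC f by (rule f)
  show ?case
  proof (cases "degree p = 0")
    case True
    then have c: "coeff p i = 0" if "i > 0" for i using that coeff_eq_0 by metis
    have "coeff p 0 \<noteq> 0" using True Suc.prems by (metis leading_coeff_0_iff)
    moreover have "(\<Sum>i\<le>Suc n. coeff p i *\<^sub>C (f ^^ i) v) = coeff p 0 *\<^sub>C v"
      by (subst sum.remove[of _ 0]) (auto simp: c)
    ultimately show ?thesis using Suc.prems by (simp add: cvec.span_zero)
  next
    case False
    then obtain c where "poly p c = 0" using fundamental_theorem_of_algebra[of p] constant_degree by metis
    then obtain q where q: "p = [:- c, 1:] * q" by (metis dvdE poly_eq_0_iff_dvd)
    then have q0: "q \<noteq> 0" using Suc.prems by auto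
    have dq: "degree q \<le> n" using Suc.prems(2) q0 degree_mult_eq[of "[:- c, 1:]" q] unfolding q by simp
    \<comment> \<open>The factorization is written as X q - c q so that the sum over coefficients
      splits into \<open>q\<close> applied to \<open>f v\<close> and to
      \<open>c *\<^sub>C v\<close>.\<close>
    have pq: "p = pCons 0 q - smult c q" using q by simp
    have q': "coeff q (Suc n) = 0" using dq coeff_eq_0[of q "Suc n"] by simp
    have "(\<Sum>i\<le>Suc n. coeff p i *\<^sub>C (f ^^ i) v) =
       (\<Sum>i\<le>Suc n. coeff (pCons 0 q) i *\<^sub>C (f ^^ i) v) - (\<Sum>i\<le>Suc n. (c * coeff q i) *\<^sub>C (f ^^ i) v)"
      unfolding pq by (simp add: cvec.scale_left_diff_distrib sum_subtractf algebra_simps)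
    also have "(\<Sum>i\<le>Suc n. coeff (pCons 0 q) i *\<^sub>C (f ^^ i) v) = (\<Sum>i\<le>n. coeff q i *\<^sub>C (f ^^ i) (f v))"
      by (subst sum.atMost_Suc_shift) (simp add: funpow_swap1)
    also have "(\<Sum>i\<le>Suc n. (c * coeff q i) *\<^sub>C (f ^^ i) v) = (\<Sum>i\<le>n. coeff q i *\<^sub>C (f ^^ i) (c *\<^sub>C v))"
    proof -
      have "(f ^^ i) (c *\<^sub>C v) = c *\<^sub>C (f ^^ i) v" for i by (induction i) (simp_all add: f.scale)
      then show ?thesis using q' by (simp add: mult.commute)
    qed
    also have "(\<Sum>i\<le>n. coeff q i *\<^sub>C (f ^^ i) (f v)) - (\<Sum>i\<le>n. coeff q i *\<^sub>C (f ^^ i) (c *\<^sub>C v)) =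
       (\<Sum>i\<le>n. coeff q i *\<^sub>C (f ^^ i) (cvec.shifted f c v))"
    proof -
      have "(f ^^ i) (x - y) = (f ^^ i) x - (f ^^ i) y" for i x y by (induction i) (simp_all add: f.diff)
      then show ?thesis by (simp add: cvec.shifted_def sum_subtractf cvec.scale_right_diff_distrib)
    qed
    finally have "(\<Sum>i\<le>n. coeff q i *\<^sub>C (f ^^ i) (cvec.shifted f c v)) = 0" using Suc.prems by simp
    moreover have "cvec.shifted f c v \<in> V"
      using V Suc.prems by (auto simp: cvec.shifted_def intro!: cvec.subspace_diff cvec.subspace_scale)
    ultimately have "cvec.shifted f c v \<in> cvec.span (\<Union>d. V \<inter> gen_eigenspace f d)" using Suc.IH q0 dq
      by blast
    then show ?thesis using in_span_gen_eigenspaces_if_shifted f V Suc.prems by blast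
  qed
qed

text \<open>In finite dimension some iterate of \<open>v\<close> depends linearly on the earlier
  ones, and this dependence is a monic polynomial annihilating \<open>v\<close>.\<close>

lemma subspace_eq_span_gen_eigenspaces:
  assumes f: "cvec.endo f" and V: "cvec.subspace V" "f ` V \<subseteq> V"
    and "finite A" "V \<subseteq> cvec.span A" and "v \<in> V"
  shows "v \<in> cvec.span (\<Union>d. V \<inter> gen_eigenspace f d)"
proof -
  interpret f: Vector_Spaces.linear scaleC scaleC f by (rule f)
  have inV: "(f ^^ i) v \<in> V" for i by (induction i) (use V \<open>v \<in> V\<close> in auto)
  have "\<exists>n. (f ^^ n) v \<in> cvec.span ((\<lambda>i. (f ^^ i) v) ` {..<n})"
  proof (rule ccontr)
    assume "\<not> ?thesis"
    then have no: "(f ^^ n) v \<notin> cvec.span ((\<lambda>i. (f ^^ i) v) ` {..<n})" for n by blast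
    have "cvec.independent ((\<lambda>i. (f ^^ i) v) ` {..<n}) \<and> card ((\<lambda>i. (f ^^ i) v) ` {..<n}) = n" for n
    proof (induction n)
      case 0 then show ?case by (simp add: cvec.independent_empty)
    next
      case (Suc n)
      have "(f ^^ n) v \<notin> (\<lambda>i. (f ^^ i) v) ` {..<n}" using no[of n] cvec.span_superset by (metis subsetD)
      then show ?case using Suc no[of n] by (simp add: lessThan_Suc cvec.independent_insertI)
    qed
    then have "Suc (card A) \<le> card A"
      using cvec.independent_span_bound[OF \<open>finite A\<close>, of "(\<lambda>i. (f ^^ i) v) ` {..<Suc (card A)}"]
        inV assms(5) by (metis (no_types, lifting) image_subset_iff subset_iff)
    then show False by simp
  qed
  then obtain n where n: "(f ^^ n) v \<in> cvec.span ((\<lambda>i. (f ^^ i) v) ` {..<n})" by blast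
  have "\<exists>c. x = (\<Sum>i<n. c i *\<^sub>C (f ^^ i) v)" if "x \<in> cvec.span ((\<lambda>i. (f ^^ i) v) ` {..<n})" for x
    using that
  proof (induction rule: cvec.span_induct_alt)
    case base then show ?case by (intro exI[of _ "\<lambda>_. 0"]) simp
  next
    case (step a x y)
    then obtain c j where c: "y = (\<Sum>i<n. c i *\<^sub>C (f ^^ i) v)" "j < n" "x = (f ^^ j) v" by blast
    have "a *\<^sub>C x = (\<Sum>i<n. (if i = j then a else 0) *\<^sub>C (f ^^ i) v)"
      using c by (simp add: if_distrib[of "\<lambda>a. a *\<^sub>C _"] sum.delta cong: if_cong)
    then show ?case using c
      by (intro exI[of _ "\<lambda>i. (if i
        = j then a else 0) + c i"]) (simp add: cvec.scale_left_distrib sum.distrib)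
  qed
  then obtain c where c: "(f ^^ n) v = (\<Sum>i<n. c i *\<^sub>C (f ^^ i) v)" using n by blast
  define p where "p = monom 1 n - (\<Sum>i<n. monom (c i) i)"
  have co: "coeff p j = (if j = n then 1 else if j < n then - c j else 0)" for j
    unfolding p_def by (simp add: coeff_sum coeff_monom)
  have "degree p \<le> n" by (rule degree_le) (simp add: co)
  moreover have "p \<noteq> 0" using co[of n] by auto
  moreover have "(\<Sum>i\<le>n. coeff p i *\<^sub>C (f ^^ i) v) = 0"
  proof -
    have "(\<Sum>i\<le>n. coeff p i *\<^sub>C (f ^^ i) v) = (f ^^ n) v - (\<Sum>i<n. c i *\<^sub>C (f ^^ i) v)"
      by (simp add: lessThan_Suc_atMost[symmetric] co cvec.scale_minus_left sum_negf)
    then show ?thesis using c by simp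
  qed
  ultimately show ?thesis using in_span_gen_eigenspaces_if_annihilated f V \<open>v \<in> V\<close> by blast
qed

section \<open>Weight spaces of a Cartan subalgebra\<close>

lemma linear_bracket: "cvec.endo (bracket x)"
  by (simp add: Vector_Spaces.linear_iff cvec.vector_space_axioms bracket_add_right bracket_scaleC_right)

interpretation bracket_right: Vector_Spaces.linear scaleC scaleC "bracket (x :: 'a::complex_lie_algebra)"
  for x by (rule linear_bracket)

interpretation bracket_left: Vector_Spaces.linear scaleC scaleC "\<lambda>x :: 'a::complex_lie_algebra. bracket x y"
  for y by (simp add: Vector_Spaces.linear_iff cvec.vector_space_axioms bracket_add_left
    bracket_scaleC_left)

lemma bracket_antisym: "bracket x y = - bracket y x"
proof -
  have "bracket x y + bracket y x = bracket (x + y) (x + y)"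
    unfolding bracket_add_left bracket_add_right by (simp add: bracket_self)
  then show ?thesis by (simp add: bracket_self eq_neg_iff_add_eq_0)
qed

lemma bracket_derivation: "bracket x (bracket y z) = bracket (bracket x y) z + bracket y (bracket x z)"
  using jacobi[of x y z] bracket_antisym[of z x] bracket_antisym[of z "bracket x y"]
  by (simp add: bracket_right.neg eq_neg_iff_add_eq_0 algebra_simps)

lemma bracket_bracket: "bracket (bracket x y) z = bracket x (bracket y z) - bracket y (bracket x z)"
  by (simp add: bracket_derivation[of x y z])

text \<open>Leibniz rule: ad x - (a + b) applied to [u, v] gives [(ad x - a) u, v] +
  [u, (ad x - b) v], and each summand lowers one of the two exponents.\<close>

lemma bracket_gen_eigenspace:
  assumes "u \<in> gen_eigenspace (bracket x) a" "v \<in> gen_eigenspace (bracket x) b"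
  shows "bracket u v \<in> gen_eigenspace (bracket x) (a + b)"
proof -
  let ?s = "\<lambda>c. cvec.shifted (bracket x) c"
  interpret sh: Vector_Spaces.linear scaleC scaleC "?s c" for c
    by (intro cvec.linear_shifted linear_bracket)
  interpret shn: Vector_Spaces.linear scaleC scaleC "?s c ^^ n" for c n
    by (intro cvec.linear_funpow cvec.linear_shifted linear_bracket)
  have "(?s (a + b) ^^ k) (bracket u v) = 0"
    if "(?s a ^^ m) u = 0" "(?s b ^^ n) v = 0" "k = m + n" for m n k
    using that
  proof (induction k arbitrary: m n u v)
    case 0 then show ?case by (simp add: bracket_left.zero)
  next
    case (Suc k)
    have "?s (a + b) (bracket u v) = bracket (?s a u) v + bracket u (?s b v)"
      by (simp add: cvec.shifted_def bracket_derivation[of x u v] bracket_left.diff bracket_right.diff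
          bracket_scaleC_left bracket_scaleC_right cvec.scale_left_distrib)
    moreover have "(?s (a + b) ^^ k) (bracket (?s a u) v) = 0"
    proof (cases m)
      case 0
      then have "u = 0" using Suc.prems by simp
      then show ?thesis by (simp add: sh.zero bracket_left.zero shn.zero)
    next
      case (Suc m')
      then show ?thesis using Suc.prems Suc.IH[of m' "?s a u" n v] by (simp add: funpow_swap1)
    qed
    moreover have "(?s (a + b) ^^ k) (bracket u (?s b v)) = 0"
    proof (cases n)
      case 0
      then have "v = 0" using Suc.prems by simp
      then show ?thesis by (simp add: sh.zero bracket_right.zero shn.zero)
    next
      case (Suc n')
      then show ?thesis using Suc.prems Suc.IH[of m u n' "?s b v"] by (simp add: funpow_swap1)
    qed
    ultimately show ?case by (simp add: funpow_swap1 shn.add)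
  qed
  then show ?thesis using assms unfolding gen_eigenspace_def by blast
qed

definition gen_weight_space :: "'a::complex_lie_algebra set \<Rightarrow> ('a \<Rightarrow> complex) \<Rightarrow> 'a set" where
  "gen_weight_space H \<phi> = {z. \<forall>x\<in>H. z \<in> gen_eigenspace (bracket x) (\<phi> x)}"

lemma subspace_gen_weight_space: "cvec.subspace (gen_weight_space H \<phi>)"
proof -
  have "cvec.subspace (\<Inter>x\<in>H. gen_eigenspace (bracket x) (\<phi> x))"
    by (intro cvec.subspace_Int subspace_gen_eigenspace linear_bracket)
  moreover have "gen_weight_space H \<phi> = (\<Inter>x\<in>H. gen_eigenspace (bracket x) (\<phi> x))"
    by (auto simp: gen_weight_space_def)
  ultimately show ?thesis by simp
qed

lemma bracket_gen_weight_space: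
  assumes "u \<in> gen_weight_space H \<phi>" "v \<in> gen_weight_space H \<psi>"
  shows "bracket u v \<in> gen_weight_space H (\<phi> + \<psi>)"
  using assms by (simp add: gen_weight_space_def bracket_gen_eigenspace)

text \<open>A generalized weight space sees only the values on \<open>H\<close>; vanishing elsewhere
  makes a weight unique as a function. Linearity is not part of the condition but is proved for
  weights from traces.\<close>

definition supported_on :: "'a set \<Rightarrow> ('a \<Rightarrow> complex) set" where
  "supported_on H = {\<phi>. \<forall>x. x \<notin> H \<longrightarrow> \<phi> x = 0}"

locale simple_cartan =
  fixes H :: "'g::complex_lie_algebra set"
  assumes simple: "simple_lie_algebra (UNIV :: 'g set)"
    and cartan: "cartan_subalgebra H"
begin

abbreviation GW :: "('g \<Rightarrow> complex) \<Rightarrow> 'g set" where "GW \<equiv> gen_weight_space H"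

abbreviation W :: "('g \<Rightarrow> complex) \<Rightarrow> 'g set" where "W \<equiv> weight_space H"

abbreviation root_span :: "('g \<Rightarrow> complex) set \<Rightarrow> 'g set" where
  "root_span A \<equiv> cvec.span (\<Union>\<phi>\<in>A. W \<phi>)"

lemma subspace_H: "cvec.subspace H"
  and bracket_H: "x \<in> H \<Longrightarrow> y \<in> H \<Longrightarrow> bracket x y \<in> H"
  and self_normalizing: "(\<And>y. y \<in> H \<Longrightarrow> bracket x y \<in> H) \<Longrightarrow> x \<in> H"
  using cartan unfolding cartan_subalgebra_def lie_subalgebra_def by auto

lemma ideal_trivial: "lie_ideal UNIV I \<Longrightarrow> I = {0} \<or> I = (UNIV :: 'g set)"
  using simple unfolding simple_lie_algebra_def by blast

lemma finite_dimensional_basis: "\<exists>B :: 'g set. finite_dimensional_vector_space scaleC B"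
proof -
  obtain A :: "'g set" where A: "finite A" "cvec.span A = UNIV"
    using simple unfolding simple_lie_algebra_def finite_dimensional_def by blast
  obtain B where B: "B \<subseteq> A" "cvec.independent B" "A \<subseteq> cvec.span B"
    using cvec.maximal_independent_subset[of A] by blast
  have "cvec.span B = UNIV" using A B by (metis cvec.span_minimal cvec.subspace_span top.extremum_uniqueI)
  then have "finite_dimensional_vector_space scaleC B"
    using A B finite_subset by unfold_locales auto
  then show ?thesis by blast
qed

definition Bas :: "'g set" where "Bas = (SOME B. finite_dimensional_vector_space scaleC B)"

sublocale fd: finite_dimensional_vector_space scaleC Bas
  unfolding Bas_def using someI_ex[OF finite_dimensional_basis] .

definition lcH :: "nat \<Rightarrow> 'g set" where "lcH i = (lie_prod H ^^ i) H"

lemma lcH_0: "lcH 0 = H" and bracket_lcH: "x \<in> H \<Longrightarrow> y \<in> lcH i \<Longrightarrow> bracket x y \<in> lcH (Suc i)"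
  by (auto simp: lcH_def lie_prod_def intro!: cvec.span_base)

lemma lcH_subset: "lcH i \<subseteq> H"
proof (induction i)
  case (Suc i)
  have "{bracket x y |x y. x \<in> H \<and> y \<in> lcH i} \<subseteq> H" using Suc bracket_H by blast
  then show ?case using cvec.span_minimal[OF _ subspace_H] by (simp add: lcH_def lie_prod_def)
qed (simp add: lcH_0)

lemma lcH_zero: "\<exists>k. lcH k = {0}"
  using cartan unfolding cartan_subalgebra_def nilpotent_def lower_central_def lcH_def by blast

lemma shifted_0: "cvec.shifted f 0 = f"
  by (auto simp: cvec.shifted_def)

lemma H_subset_gen_weight_space: "H \<subseteq> GW 0"
proof
  fix y assume y: "y \<in> H"
  obtain k where k: "lcH k = {0}" using lcH_zero by blast
  have "(bracket x ^^ n) y \<in> lcH n" if "x \<in> H" for x n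
    by (induction n) (use that y bracket_lcH in \<open>auto simp: lcH_0\<close>)
  then have "(bracket x ^^ k) y = 0" if "x \<in> H" for x using k that by blast
  then show "y \<in> GW 0"
    by (auto simp: gen_weight_space_def shifted_0 intro!: gen_eigenspaceI[of k])
qed

lemma bracket_H_gen_weight_space:
  assumes "x \<in> H" "z \<in> GW \<phi>" shows "bracket x z \<in> GW \<phi>"
  using bracket_gen_weight_space[of x H 0 z \<phi>] assms H_subset_gen_weight_space by auto

lemma shifted_stable:
  assumes "cvec.subspace V" "\<And>z. z \<in> V \<Longrightarrow> bracket x z \<in> V" "z \<in> V"
  shows "(cvec.shifted (bracket x) c ^^ n) z \<in> V"
  by (induction n) (use assms in \<open>auto simp: cvec.shifted_def intro!: cvec.subspace_diff
    cvec.subspace_scale\<close>)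

text \<open>Induction on the number of components: a power of ad x - \<psi>(x) removes the component
  at \<psi>, so some such image of the component at \<phi> lies in \<open>V\<close>. A power of ad x
  - \<phi>(x) kills that component, and coprimality puts it in \<open>V\<close>. The element
  \<open>x\<close> separating \<phi> and \<psi> lies in \<open>H\<close> because both vanish
  elsewhere.\<close>

lemma component_in_stable_subspace:
  assumes V: "cvec.subspace V" "\<And>x z. x \<in> H \<Longrightarrow> z \<in> V \<Longrightarrow> bracket x z \<in> V"
    and "finite F" "F \<subseteq> supported_on H" "\<And>\<phi>. \<phi> \<in> F \<Longrightarrow> z \<phi> \<in> GW \<phi>"
    and "(\<Sum>\<phi>\<in>F. z \<phi>) \<in> V" and "\<phi> \<in> F"
  shows "z \<phi> \<in> V"
  using assms(3-)
proof (induction "card F" arbitrary: F z rule: less_induct)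
  case less
  show ?case
  proof (cases "F = {\<phi>}")
    case True then show ?thesis using less.prems by simp
  next
    case False
    then obtain \<psi> where \<psi>: "\<psi> \<in> F" "\<psi> \<noteq> \<phi>" using less.prems by blast
    then obtain x where x: "\<psi> x \<noteq> \<phi> x" by blast
    have "\<psi> \<in> supported_on H" "\<phi> \<in> supported_on H" using less.prems \<psi> by auto
    then have xH: "x \<in> H" using x unfolding supported_on_def by (metis (mono_tags, lifting) mem_Collect_eq)
    obtain n where n: "(cvec.shifted (bracket x) (\<psi> x) ^^ n) (z \<psi>) = 0"
      using less.prems(3)[OF \<psi>(1)] xH unfolding gen_weight_space_def gen_eigenspace_def by blast
    let ?D = "cvec.shifted (bracket x) (\<psi> x) ^^ n"
    interpret D: Vector_Spaces.linear scaleC scaleC ?D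
      by (intro cvec.linear_funpow cvec.linear_shifted linear_bracket)
    have "?D (\<Sum>\<phi>\<in>F. z \<phi>) = (\<Sum>\<phi>\<in>F - {\<psi>}. ?D (z \<phi>))"
      using \<psi> less.prems(1) n by (simp add: D.sum D.add sum.remove)
    moreover have "?D (\<Sum>\<phi>\<in>F. z \<phi>) \<in> V"
      using shifted_stable[OF V(1)] V(2) xH less.prems(4) by blast
    moreover have "?D (z \<phi>') \<in> GW \<phi>'" if "\<phi>' \<in> F" for \<phi>'
      using shifted_stable[OF subspace_gen_weight_space] bracket_H_gen_weight_space[OF xH] less.prems(3)[OF
        that]
      by blast
    moreover have "card (F - {\<psi>}) < card F" using less.prems(1) \<psi>(1) by (rule card_Diff1_less)
    ultimately have "?D (z \<phi>) \<in> V"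
      using less.prems \<psi> by (intro less.hyps[of "F - {\<psi>}" "\<lambda>\<phi>. ?D (z \<phi>)"]) auto
    moreover obtain m where "(cvec.shifted (bracket x) (\<phi> x) ^^ m) (z \<phi>) = 0"
      using less.prems(3)[OF less.prems(5)] xH unfolding gen_weight_space_def gen_eigenspace_def by blast
    then have "(cvec.shifted (bracket x) (\<phi> x) ^^ m) (z \<phi>) \<in> V" using V cvec.subspace_0 by simp
    ultimately show ?thesis
      using cvec.mem_subspace_if_shifted_powers[OF linear_bracket V(1) _ x] V(2) xH by blast
  qed
qed

lemma gen_weight_spaces_direct:
  assumes "finite F" "F \<subseteq> supported_on H" "\<And>\<phi>. \<phi> \<in> F \<Longrightarrow> z \<phi> \<in> GW \<phi>"
    and "(\<Sum>\<phi>\<in>F. z \<phi>) = 0" "\<phi> \<in> F"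
  shows "z \<phi> = 0"
  using component_in_stable_subspace[of "{0}" F z \<phi>] assms by (simp add: bracket_right.zero)

text \<open>Induction on dimension: if every \<open>x\<close> in \<open>H\<close> has a single
  generalized eigenvalue on \<open>V\<close>, these eigenvalues form a weight; otherwise some
  \<open>x\<close> splits \<open>V\<close> into smaller pieces that are again stable.\<close>

lemma stable_subspace_spanned:
  assumes "cvec.subspace V" "\<And>x z. x \<in> H \<Longrightarrow> z \<in> V \<Longrightarrow> bracket x z \<in> V"
  shows "V \<subseteq> cvec.span (\<Union>\<phi>\<in>supported_on H. GW \<phi>)"
  using assms
proof (induction "cvec.dim V" arbitrary: V rule: less_induct)
  case less
  show ?case
  proof (cases "\<forall>x\<in>H. \<exists>c. V \<subseteq> gen_eigenspace (bracket x) c")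
    case True
    then obtain c where c: "\<And>x. x \<in> H \<Longrightarrow> V \<subseteq> gen_eigenspace (bracket x) (c x)" by metis
    define \<phi> where "\<phi> x = (if x \<in> H then c x else 0)" for x
    have "V \<subseteq> GW \<phi>" using c by (auto simp: gen_weight_space_def \<phi>_def)
    moreover have "\<phi> \<in> supported_on H" by (simp add: supported_on_def \<phi>_def)
    ultimately have "V \<subseteq> (\<Union>\<phi>\<in>supported_on H. GW \<phi>)" by blast
    then show ?thesis using cvec.span_superset by (rule order_trans)
  next
    case False
    then obtain x where x: "x \<in> H" "\<And>c. \<not> V \<subseteq> gen_eigenspace (bracket x) c" by blast
    have "V \<subseteq> cvec.span (\<Union>d. V \<inter> gen_eigenspace (bracket x) d)"
      using subspace_eq_span_gen_eigenspaces[OF linear_bracket less.prems(1), of x Bas] less.prems x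
        fd.finite_Basis fd.span_Basis by blast
    moreover {have "V \<inter> gen_eigenspace (bracket x) d \<subseteq> cvec.span (\<Union>\<phi>\<in>supported_on H. GW \<phi>)" for d
    proof (rule less.hyps)
      let ?V = "V \<inter> gen_eigenspace (bracket x) d"
      show sV: "cvec.subspace ?V"
        by (intro cvec.subspace_inter less.prems subspace_gen_eigenspace linear_bracket)
      show "bracket y z \<in> ?V" if "y \<in> H" "z \<in> ?V" for y z
      proof -
        \<comment> \<open>\<open>H\<close> need not be abelian yet; nilpotency puts \<open>y\<close>
          in the generalized 0-eigenspace of ad x, which suffices for \<open>y\<close> to preserve
          the other generalized eigenspaces.\<close>
        have "y \<in> gen_eigenspace (bracket x) 0"
          using that H_subset_gen_weight_space x by (auto simp: gen_weight_space_def)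
        then show ?thesis using bracket_gen_eigenspace[of y x 0 z d] that less.prems by auto
      qed
      have "?V \<subset> V" using x by blast
      then show "cvec.dim ?V < cvec.dim V"
        using sV less.prems by (intro fd.dim_psubset) (metis cvec.span_eq_iff)
    qed
    then have "cvec.span (\<Union>d. V \<inter> gen_eigenspace (bracket x) d) \<subseteq>
        cvec.span (\<Union>\<phi>\<in>supported_on H. GW \<phi>)"
      by (intro cvec.span_minimal cvec.subspace_span) blast}
    ultimately show ?thesis by (rule order_trans)
  qed
qed

lemma gen_weight_spaces_span: "cvec.span (\<Union>\<phi>\<in>supported_on H. GW \<phi>) = UNIV"
  using stable_subspace_spanned[of UNIV] by auto

text \<open>Engel's theorem for the quotient by \<^term>\<open>H\<close>: a minimal stable subspace strictly between would be
  normalized by every element of \<^term>\<open>H\<close>, by induction along the lower central series.\<close>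

lemma gen_weight_space_zero: "GW 0 = H"
proof (rule ccontr)
  assume ne: "GW 0 \<noteq> H"
  define P where "P U \<longleftrightarrow> cvec.subspace U \<and> H \<subset> U \<and> U \<subseteq> GW 0 \<and>
    (\<forall>x\<in>H. \<forall>z\<in>U. bracket x z \<in> U)" for U
  have "P (GW 0)"
    using ne H_subset_gen_weight_space subspace_gen_weight_space bracket_H_gen_weight_space
      by (auto simp: P_def)
  then obtain U where U: "P U" "\<And>U'. P U' \<Longrightarrow> cvec.dim U \<le> cvec.dim U'"
    using ex_has_least_nat[of P _ cvec.dim] by blast
  define C where "C = {y \<in> H. \<forall>u\<in>U. bracket y u \<in> H}"
  \<comment> \<open>\<open>C\<close> consists of the elements of \<open>H\<close> acting as zero on
    \<open>U\<close> modulo \<open>H\<close>. If it is all of \<open>H\<close>, then every element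
    of \<open>U\<close> normalizes \<open>H\<close>.\<close>
  have "C = H"
  proof (rule ccontr)
    assume "C \<noteq> H"
    then have 0: "\<not> lcH 0 \<subseteq> C" by (auto simp: lcH_0 C_def)
    obtain k where "lcH k = {0}" using lcH_zero by blast
    then have k: "lcH k \<subseteq> C" by (simp add: C_def bracket_left.zero cvec.subspace_0[OF subspace_H])
    \<comment> \<open>The series starts outside \<open>C\<close> and ends inside it. An element
      \<open>y\<close> taken just before the entry into \<open>C\<close> satisfies [H, y]
      \<subseteq> C.\<close>
    obtain i where i: "\<not> lcH i \<subseteq> C" "lcH (Suc i) \<subseteq> C"
    proof (rule ccontr)
      assume "\<not> thesis"
      then have "\<not> lcH j \<subseteq> C" for j by (induction j) (use 0 that in blast)+
      then show False using k by blast
    qed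
    then obtain y where y: "y \<in> lcH i" "y \<notin> C" by blast
    have yH: "y \<in> H" using y lcH_subset by blast
    have yC: "bracket x y \<in> C" if "x \<in> H" for x using bracket_lcH[OF that y(1)] i by blast
    \<comment> \<open>The kernel of \<open>y\<close> on \<open>U\<close> modulo \<open>H\<close>. It
      is larger than \<open>H\<close> since \<open>y\<close> acts nilpotently there, and stable
      since [x, y] lies in \<open>C\<close>; minimality of \<open>U\<close> then forces
      \<open>y\<close> into \<open>C\<close>.\<close>
    define U' where "U' = {u \<in> U. bracket y u \<in> H}"
    have "P U'"
      unfolding P_def
    proof (intro conjI ballI)
      show "cvec.subspace U'"
        using U(1) subspace_H unfolding P_def U'_def cvec.subspace_def
        by (auto simp: bracket_right.zero bracket_add_right bracket_scaleC_right)
      show "U' \<subseteq> GW 0" using U(1) by (auto simp: P_def U'_def)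
      have "H \<subseteq> U'" using U(1) yH bracket_H by (auto simp: P_def U'_def)
      moreover have "H \<noteq> U'"
      proof -
        obtain u where u: "u \<in> U" "u \<notin> H" using U(1) by (auto simp: P_def)
        then have "u \<in> gen_eigenspace (bracket y) 0" using U(1) yH
          by (auto simp: P_def gen_weight_space_def)
        then obtain n where "(bracket y ^^ n) u = 0" by (auto simp: gen_eigenspace_def shifted_0)
        then have yn: "(bracket y ^^ n) u \<in> H" using cvec.subspace_0[OF subspace_H] by simp
        obtain m where m: "(bracket y ^^ m) u \<notin> H" "(bracket y ^^ Suc m) u \<in> H"
        proof (rule ccontr)
          assume "\<not> thesis"
          then have "(bracket y ^^ j) u \<notin> H" for j by (induction j) (use u(2) that in auto)
          then show False using yn by blast
        qed
        moreover have "(bracket y ^^ m) u \<in> U"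
          by (induction m) (use u U(1) yH in \<open>auto simp: P_def\<close>)
        ultimately have "(bracket y ^^ m) u \<in> U'" by (simp add: U'_def)
        then show ?thesis using m by blast
      qed
      ultimately show "H \<subset> U'" by blast
      show "bracket x z \<in> U'" if "x \<in> H" "z \<in> U'" for x z
      proof -
        have "bracket (bracket x y) z \<in> H" using yC[OF that(1)] that(2) by (auto simp: C_def U'_def)
        moreover have "bracket x (bracket y z) \<in> H" using that bracket_H by (auto simp: U'_def)
        moreover have "bracket y (bracket x z) = bracket x (bracket y z) - bracket (bracket x y) z"
          by (simp add: bracket_bracket)
        ultimately have "bracket y (bracket x z) \<in> H" using cvec.subspace_diff[OF subspace_H] by simp
        then show ?thesis using that U(1) by (auto simp: U'_def P_def)
      qed
    qed
    then have "U' = U"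
      using U fd.subspace_dim_equal[of U' U] by (auto simp: P_def U'_def)
    then have "y \<in> C" using yH by (auto simp: C_def U'_def)
    then show False using y by blast
  qed
  obtain u where u: "u \<in> U" "u \<notin> H" using U(1) by (auto simp: P_def)
  have "bracket u y \<in> H" if "y \<in> H" for y
  proof -
    have "bracket y u \<in> H" using that u \<open>C = H\<close> by (auto simp: C_def)
    then show ?thesis using bracket_antisym[of u y] cvec.subspace_neg[OF subspace_H] by simp
  qed
  then show False using self_normalizing u by blast
qed

section \<open>Weights, adapted bases and traces over them\<close>

definition weights :: "('g \<Rightarrow> complex) set" where
  "weights = {\<phi> \<in> supported_on H. GW \<phi> \<noteq> {0}}"

definition wbasis :: "('g \<Rightarrow> complex) \<Rightarrow> 'g set" where
  "wbasis \<phi> = (SOME B. B \<subseteq> GW \<phi> \<and> cvec.independent B \<and> cvec.span B = GW \<phi>)"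

definition basis_on :: "('g \<Rightarrow> complex) set \<Rightarrow> 'g set" where
  "basis_on F = (\<Union>\<phi>\<in>F. wbasis \<phi>)"

definition dimw :: "('g \<Rightarrow> complex) \<Rightarrow> nat" where
  "dimw \<phi> = card (wbasis \<phi>)"

lemma weights_supported: "weights \<subseteq> supported_on H"
  by (auto simp: weights_def)

lemma supported_on_add: "\<phi> \<in> supported_on H \<Longrightarrow> \<psi> \<in> supported_on H \<Longrightarrow> \<phi> + \<psi> \<in> supported_on H"
  by (simp add: supported_on_def)

lemma supported_on_minus: "\<phi> \<in> supported_on H \<Longrightarrow> - \<phi> \<in> supported_on H"
  by (simp add: supported_on_def)

lemma wbasis: "wbasis \<phi> \<subseteq> GW \<phi>" "cvec.independent (wbasis \<phi>)"
    "cvec.span (wbasis \<phi>) = GW \<phi>" "finite (wbasis \<phi>)"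
proof -
  obtain B where "B \<subseteq> GW \<phi>" "cvec.independent B" "GW \<phi> \<subseteq> cvec.span B"
    using cvec.maximal_independent_subset by blast
  then have "B \<subseteq> GW \<phi> \<and> cvec.independent B \<and> cvec.span B = GW \<phi>"
    using cvec.span_minimal[OF _ subspace_gen_weight_space] by blast
  from someI[of "\<lambda>B. B \<subseteq> GW \<phi> \<and> cvec.independent B \<and> cvec.span B = GW \<phi>", OF this]
  show *: "wbasis \<phi> \<subseteq> GW \<phi>" "cvec.independent (wbasis \<phi>)"
    "cvec.span (wbasis \<phi>) = GW \<phi>" by (auto simp: wbasis_def)
  show "finite (wbasis \<phi>)" using *(2) by (rule fd.finiteI_independent)
qed

lemma dimw_pos: "\<phi> \<in> weights \<Longrightarrow> dimw \<phi> > 0"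
  unfolding dimw_def weights_def using wbasis[of \<phi>] by (auto simp: card_gt_0_iff)

lemma basis_on_props:
  assumes "F \<subseteq> supported_on H"
  shows independent_basis_on: "cvec.independent (basis_on F)"
    and wbasis_disjoint: "\<phi> \<in> F \<Longrightarrow> \<psi> \<in> F \<Longrightarrow> \<phi> \<noteq> \<psi> \<Longrightarrow> wbasis \<phi> \<inter> wbasis \<psi> = {}"
proof -
  have dir: "z i = 0" if "finite J" "J \<subseteq> F" "\<And>i. i \<in> J \<Longrightarrow> z i \<in> cvec.span (wbasis i)" "sum z J = 0"
    "i \<in> J" for J z i
    using gen_weight_spaces_direct[of J z i] that assms by (simp add: wbasis(3) subset_trans)
  show "cvec.independent (basis_on F)" unfolding basis_on_def
    by (rule cvec.independent_UN_of_direct(1)) (use wbasis(2) dir in blast)+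
  show "wbasis \<phi> \<inter> wbasis \<psi> = {}" if "\<phi> \<in> F" "\<psi> \<in> F" "\<phi> \<noteq> \<psi>"
    by (rule cvec.independent_UN_of_direct(2)[where I = F]) (use wbasis(2) dir that in blast)+
qed

lemma finite_basis_on: "F \<subseteq> supported_on H \<Longrightarrow> finite (basis_on F)"
  using independent_basis_on by (rule fd.finiteI_independent)

lemma finite_weights: "finite weights"
proof -
  have "\<forall>\<phi>\<in>weights. \<exists>b. b \<in> wbasis \<phi>" using dimw_pos unfolding dimw_def
    by (metis card.empty ex_in_conv less_numeral_extra(3))
  then obtain b where b: "\<And>\<phi>. \<phi> \<in> weights \<Longrightarrow> b \<phi> \<in> wbasis \<phi>" by metis
  have "inj_on b weights"
    using b wbasis_disjoint[OF weights_supported] by (fastforce intro!: inj_onI)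
  moreover have "b ` weights \<subseteq> basis_on weights" using b by (auto simp: basis_on_def)
  ultimately show ?thesis using finite_basis_on[OF weights_supported] by (metis finite_imageD finite_subset)
qed

lemma gen_weight_space_subset_span_basis_on:
  "\<phi> \<in> F \<Longrightarrow> GW \<phi> \<subseteq> cvec.span (basis_on F)"
  unfolding basis_on_def wbasis(3)[symmetric] by (intro cvec.span_mono) blast

lemma span_basis_on_subset:
  assumes "\<And>\<phi>. \<phi> \<in> F \<Longrightarrow> GW \<phi> \<subseteq> V" "cvec.subspace V"
  shows "cvec.span (basis_on F) \<subseteq> V"
  using assms wbasis(1) unfolding basis_on_def by (intro cvec.span_minimal) blast+

lemma span_basis_on_weights: "cvec.span (basis_on weights) = UNIV"
proof -
  have "GW \<phi> \<subseteq> cvec.span (basis_on weights)" if "\<phi> \<in> supported_on H" for \<phi>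
  proof (cases "\<phi> \<in> weights")
    case True then show ?thesis by (rule gen_weight_space_subset_span_basis_on)
  next
    case False
    then have "GW \<phi> = {0}" using that by (simp add: weights_def)
    then show ?thesis by (simp add: cvec.span_zero)
  qed
  then have "cvec.span (\<Union>\<phi>\<in>supported_on H. GW \<phi>) \<subseteq> cvec.span (basis_on weights)"
    by (intro cvec.span_minimal) auto
  then show ?thesis using gen_weight_spaces_span by blast
qed

lemma trace_on_blocks:
  assumes F: "F \<subseteq> weights" and f: "\<And>\<phi>. \<phi> \<in> F \<Longrightarrow> f ` GW \<phi> \<subseteq> GW \<phi>"
  shows "cvec.trace_on (basis_on F) f = (\<Sum>\<phi>\<in>F. cvec.trace_on (wbasis \<phi>) f)"
proof -
  have FS: "F \<subseteq> supported_on H" using F weights_supported by blast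
  have "finite F" using F finite_weights finite_subset by blast
  then have "cvec.trace_on (basis_on F) f = (\<Sum>\<phi>\<in>F. \<Sum>b\<in>wbasis \<phi>. cvec.representation (basis_on F) (f b) b)"
    unfolding cvec.trace_on_def using wbasis_disjoint[OF FS] wbasis(4)
    by (subst basis_on_def) (rule sum.UNION_disjoint, auto)
  also have "\<dots> = (\<Sum>\<phi>\<in>F. cvec.trace_on (wbasis \<phi>) f)"
  proof (rule sum.cong)
    fix \<phi> assume "\<phi> \<in> F"
    then have "wbasis \<phi> \<subseteq> basis_on F" "f ` wbasis \<phi> \<subseteq> cvec.span (wbasis \<phi>)"
      using f[of \<phi>] wbasis(1,3)[of \<phi>] by (auto simp: basis_on_def)
    then show "(\<Sum>b\<in>wbasis \<phi>. cvec.representation (basis_on F) (f b) b) = cvec.trace_on (wbasis \<phi>) f"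
      by (intro cvec.trace_on_sub_basis[symmetric] independent_basis_on[OF FS])
  qed simp
  finally show ?thesis .
qed

text \<open>In a basis adapted to the weights, a map that moves every weight space into a different
  one has zero diagonal.\<close>

lemma trace_on_shift_eq_0:
  assumes f: "\<And>\<phi> z. \<phi> \<in> weights \<Longrightarrow> z \<in> GW \<phi> \<Longrightarrow> f z \<in> GW (\<phi> + \<alpha>)"
    and \<alpha>: "\<alpha> \<in> supported_on H" "\<alpha> \<noteq> 0"
  shows "cvec.trace_on (basis_on weights) f = 0"
  unfolding cvec.trace_on_def
proof (rule sum.neutral, rule ballI)
  fix b assume "b \<in> basis_on weights"
  then obtain \<phi> where \<phi>: "\<phi> \<in> weights" "b \<in> wbasis \<phi>" by (auto simp: basis_on_def)
  have fb: "f b \<in> GW (\<phi> + \<alpha>)" using f \<phi> wbasis(1) by blast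
  show "cvec.representation (basis_on weights) (f b) b = 0"
  proof (cases "\<phi> + \<alpha> \<in> weights")
    case False
    then have "f b = 0" using fb \<phi> \<alpha> weights_supported supported_on_add by (auto simp: weights_def)
    then show ?thesis by (simp add: cvec.representation_zero)
  next
    case True
    have "cvec.representation (basis_on weights) (f b) = cvec.representation (wbasis (\<phi> + \<alpha>)) (f b)"
      using fb True wbasis(3) by (intro cvec.representation_extend independent_basis_on weights_supported)
        (auto simp: basis_on_def)
    moreover have "b \<notin> wbasis (\<phi> + \<alpha>)"
      using wbasis_disjoint[OF weights_supported \<phi>(1) True] \<phi> \<alpha> by auto
    ultimately show ?thesis using cvec.representation_ne_zero by metis
  qed
qed

text \<open>On the weight space, ad x differs from the scalar \<phi>(x) by a locally nilpotent map,
  which has trace 0.\<close>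

lemma trace_on_wbasis_bracket:
  assumes "x \<in> H"
  shows "cvec.trace_on (wbasis \<phi>) (bracket x) = of_nat (dimw \<phi>) * \<phi> x"
proof -
  have st: "bracket x ` GW \<phi> \<subseteq> GW \<phi>" using bracket_H_gen_weight_space assms by blast
  have "cvec.trace_on (wbasis \<phi>) (cvec.shifted (bracket x) (\<phi> x)) = 0"
  proof (rule cvec.trace_on_nilpotent)
    show "cvec.shifted (bracket x) (\<phi> x) ` cvec.span (wbasis \<phi>) \<subseteq> cvec.span (wbasis \<phi>)"
      using shifted_stable[OF subspace_gen_weight_space[of H \<phi>], where x = x and c = "\<phi> x" and n = 1] st
      by (auto simp: wbasis(3))
    show "\<exists>n. (cvec.shifted (bracket x) (\<phi> x) ^^ n) v = 0" if "v \<in> cvec.span (wbasis \<phi>)" for v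
      using that assms by (auto simp: wbasis(3) gen_weight_space_def gen_eigenspace_def)
  qed (simp_all add: wbasis cvec.linear_shifted linear_bracket)
  moreover have "cvec.trace_on (wbasis \<phi>) (cvec.shifted (bracket x) (\<phi> x)) =
      cvec.trace_on (wbasis \<phi>) (bracket x) - cvec.trace_on (wbasis \<phi>) (\<lambda>v. \<phi> x *\<^sub>C v)"
  proof -
    have "bracket x ` wbasis \<phi> \<subseteq> cvec.span (wbasis \<phi>)" using st wbasis(1)[of \<phi>] by (auto simp: wbasis(3))
    moreover have "(\<lambda>v. \<phi> x *\<^sub>C v) ` wbasis \<phi> \<subseteq> cvec.span (wbasis \<phi>)"
      by (auto intro!: cvec.span_scale intro: cvec.span_base)
    moreover have "cvec.shifted (bracket x) (\<phi> x) = (\<lambda>v. bracket x v - \<phi> x *\<^sub>C v)"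
      by (simp add: fun_eq_iff cvec.shifted_def)
    ultimately show ?thesis using cvec.trace_on_diff[OF wbasis(2)] by simp
  qed
  ultimately show ?thesis by (simp add: cvec.trace_on_scalar wbasis dimw_def)
qed

lemma trace_on_bracket_bracket:
  assumes "finite B" "cvec.independent B" "bracket x ` cvec.span B \<subseteq> cvec.span B" "bracket y ` cvec.span B
    \<subseteq> cvec.span B"
  shows "cvec.trace_on B (bracket (bracket x y)) = 0"
proof -
  have "cvec.trace_on B (bracket (bracket x y)) =
      cvec.trace_on B (\<lambda>z. bracket x (bracket y z)) - cvec.trace_on B (\<lambda>z. bracket y (bracket x z))"
  proof -
    have "bracket (bracket x y) = (\<lambda>z. bracket x (bracket y z) - bracket y (bracket x z))"
      by (simp add: fun_eq_iff bracket_bracket)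
    moreover have "(\<lambda>z. bracket x (bracket y z)) ` B \<subseteq> cvec.span B" "(\<lambda>z. bracket y (bracket x z)) ` B
      \<subseteq> cvec.span B"
      using assms(3,4) cvec.span_superset[of B] by blast+
    ultimately show ?thesis using cvec.trace_on_diff[OF assms(2)] by simp
  qed
  also have "\<dots> = 0"
    using cvec.trace_on_comp_commute[OF assms(1,2) linear_bracket assms(4) linear_bracket assms(3)] by simp
  finally show ?thesis .
qed

text \<open>A weight is the trace of ad x on its weight space divided by the dimension. It inherits
  linearity from the trace and vanishes on brackets because commutators have trace 0.\<close>

lemma weight_add: "\<phi> \<in> weights \<Longrightarrow> x \<in> H \<Longrightarrow> y \<in> H \<Longrightarrow> \<phi> (x + y) = \<phi> x + \<phi> y"
  and weight_scale: "\<phi> \<in> weights \<Longrightarrow> x \<in> H \<Longrightarrow> \<phi> (c *\<^sub>C x) = c * \<phi> x"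
  and weight_bracket: "\<phi> \<in> weights \<Longrightarrow> x \<in> H \<Longrightarrow> y \<in> H \<Longrightarrow> \<phi> (bracket x y) = 0"
proof -
  assume \<phi>: "\<phi> \<in> weights" and x: "x \<in> H"
  note pos = dimw_pos[OF \<phi>]
  have st: "bracket x ` cvec.span (wbasis \<phi>) \<subseteq> cvec.span (wbasis \<phi>)" if "x \<in> H" for x
    using bracket_H_gen_weight_space that by (auto simp: wbasis(3))
  then have st': "bracket x ` wbasis \<phi> \<subseteq> cvec.span (wbasis \<phi>)" if "x \<in> H" for x
    using cvec.span_superset[of "wbasis \<phi>"] that by blast
  have "(\<lambda>z. bracket (c *\<^sub>C x) z) = (\<lambda>z. c *\<^sub>C bracket x z)" by (simp add: bracket_scaleC_left)
  then have "cvec.trace_on (wbasis \<phi>) (bracket (c *\<^sub>C x)) = c * cvec.trace_on (wbasis \<phi>) (bracket x)"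
    using cvec.trace_on_scale[OF wbasis(2) st'[OF x]] by simp
  then show "\<phi> (c *\<^sub>C x) = c * \<phi> x"
    using pos x cvec.subspace_scale[OF subspace_H x] by (simp add: trace_on_wbasis_bracket)
  assume y: "y \<in> H"
  have "(\<lambda>z. bracket (x + y) z) = (\<lambda>z. bracket x z + bracket y z)" by (simp add: bracket_add_left)
  then have "cvec.trace_on (wbasis \<phi>) (bracket (x + y)) =
      cvec.trace_on (wbasis \<phi>) (bracket x) + cvec.trace_on (wbasis \<phi>) (bracket y)"
    using cvec.trace_on_add[OF wbasis(2) st'[OF x] st'[OF y]] by simp
  then have "of_nat (dimw \<phi>) * \<phi> (x + y) = of_nat (dimw \<phi>) * (\<phi> x + \<phi> y)"
    using x y cvec.subspace_add[OF subspace_H x y] by (simp add: trace_on_wbasis_bracket ring_distribs)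
  then show "\<phi> (x + y) = \<phi> x + \<phi> y" using pos by simp
  have "cvec.trace_on (wbasis \<phi>) (bracket (bracket x y)) = 0"
    by (intro trace_on_bracket_bracket wbasis st x y)
  then show "\<phi> (bracket x y) = 0" using pos bracket_H[OF x y] by (simp add: trace_on_wbasis_bracket)
qed

text \<open>The trace of \<open>ad [e,f]\<close> over the \<open>\<alpha>\<close>-string through \<open>\<psi>\<close> vanishes.\<close>

lemma weight_on_bracket_real:
  assumes \<alpha>: "\<alpha> \<in> supported_on H" "\<alpha> \<noteq> 0"
    and e: "e \<in> GW \<alpha>" and f: "f \<in> GW (- \<alpha>)"
    and \<psi>: "\<psi> \<in> weights"
  shows "\<exists>r :: real. \<psi> (bracket e f) = of_real r * \<alpha> (bracket e f)"
proof -
  define h where "h = bracket e f"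
  have hH: "h \<in> H"
    using bracket_gen_weight_space[OF e f] gen_weight_space_zero by (simp add: h_def)
  define S where "S n = (\<lambda>x. \<psi> x + of_int n * \<alpha> x)" for n :: int
  obtain x where x: "\<alpha> x \<noteq> 0" using \<alpha>(2) by (auto simp: fun_eq_iff)
  have S0: "S 0 = \<psi>" by (simp add: S_def)
  define F where "F = weights \<inter> range S"
  \<comment> \<open>\<open>F\<close> collects the weights on the string; string members outside
    \<open>F\<close> have zero weight space, so \<open>span (basis_on F)\<close> is stable under
    \<open>e\<close> and \<open>f\<close>.\<close>
  have F: "F \<subseteq> weights" "finite F" "\<psi> \<in> F"
    using finite_weights \<psi> S0 by (auto simp: F_def intro: rev_image_eqI)
  have Ssup: "S n \<in> supported_on H" for n
    using \<alpha>(1) \<psi> weights_supported by (auto simp: S_def supported_on_def)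
  have "\<forall>\<phi>\<in>F. \<exists>n. \<phi> = S n" by (auto simp: F_def)
  from bchoice[OF this] obtain N where N: "\<And>\<phi>. \<phi> \<in> F \<Longrightarrow> \<phi> = S (N \<phi>)" by blast
  have GS: "GW (S n) \<subseteq> cvec.span (basis_on F)" for n
  proof (cases "S n \<in> weights")
    case True then show ?thesis by (intro gen_weight_space_subset_span_basis_on) (simp add: F_def)
  next
    case False then show ?thesis using Ssup by (auto simp: weights_def cvec.span_zero)
  qed
  have st: "bracket u ` cvec.span (basis_on F) \<subseteq> cvec.span (basis_on F)"
    if u: "\<And>n z. z \<in> GW (S n) \<Longrightarrow> \<exists>m. bracket u z \<in> GW (S m)" for u
  proof -
    have "cvec.span (basis_on F) \<subseteq> {z. bracket u z \<in> cvec.span (basis_on F)}"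
    proof (rule span_basis_on_subset)
      show "cvec.subspace {z. bracket u z \<in> cvec.span (basis_on F)}"
        by (rule bracket_right.subspace_linear_preimage) simp
      show "GW \<phi> \<subseteq> {z. bracket u z \<in> cvec.span (basis_on F)}" if "\<phi> \<in> F" for \<phi>
      proof
        fix z assume "z \<in> GW \<phi>"
        then have "z \<in> GW (S (N \<phi>))" using N[OF that] by simp
        then obtain m where "bracket u z \<in> GW (S m)"
          using u by blast
        then show "z \<in> {z. bracket u z \<in> cvec.span (basis_on F)}" using GS[of m] by blast
      qed
    qed
    then show ?thesis by blast
  qed
  have "\<alpha> + S n = S (n + 1)" "- \<alpha> + S n = S (n - 1)" for n
    by (auto simp: S_def algebra_simps)
  then have "bracket e z \<in> GW (S (n + 1))" "bracket f z \<in> GW (S (n - 1))"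
    if "z \<in> GW (S n)" for n z
    using bracket_gen_weight_space[OF e that] bracket_gen_weight_space[OF f that] by simp_all
  then have "bracket e ` cvec.span (basis_on F) \<subseteq> cvec.span (basis_on F)"
    "bracket f ` cvec.span (basis_on F) \<subseteq> cvec.span (basis_on F)" by (intro st; blast)+
  moreover have "F \<subseteq> supported_on H" using F weights_supported by blast
  ultimately have "cvec.trace_on (basis_on F) (bracket h) = 0" unfolding h_def
    by (intro trace_on_bracket_bracket finite_basis_on independent_basis_on)
  moreover have "cvec.trace_on (basis_on F) (bracket h) = (\<Sum>\<phi>\<in>F. of_nat (dimw \<phi>) * \<phi> h)"
    using trace_on_blocks[OF F(1), of "bracket h"] hH bracket_H_gen_weight_space
    by (simp add: image_subset_iff trace_on_wbasis_bracket)
  moreover have "\<dots> = (\<Sum>\<phi>\<in>F. of_nat (dimw \<phi>) * (\<psi> h + of_int (N \<phi>) * \<alpha> h))"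
    using N by (intro sum.cong refl) (metis S_def)
  moreover have "\<dots> = (\<Sum>\<phi>\<in>F. of_nat (dimw \<phi>)) * \<psi> h + (\<Sum>\<phi>\<in>F. of_nat (dimw \<phi>) * of_int (N \<phi>)) * \<alpha> h"
    by (simp add: sum_distrib_right sum_distrib_left sum.distrib algebra_simps)
  \<comment> \<open>The vanishing trace, sorted by \<psi>(h) and \<alpha>(h). The total dimension in
    front of \<psi>(h) is positive because \<psi> lies on its own string.\<close>
  ultimately have eq: "of_nat (\<Sum>\<phi>\<in>F. dimw \<phi>) * \<psi> h = - (of_int (\<Sum>\<phi>\<in>F. int (dimw \<phi>) * N \<phi>) * \<alpha> h)"
    by (simp add: eq_neg_iff_add_eq_0)
  have "(\<Sum>\<phi>\<in>F. dimw \<phi>) > 0" using F dimw_pos by (intro sum_pos) auto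
  then have "\<psi> h = of_real (- real_of_int (\<Sum>\<phi>\<in>F. int (dimw \<phi>) * N \<phi>) / real (\<Sum>\<phi>\<in>F. dimw \<phi>)) * \<alpha> h"
    using eq by (simp add: field_simps del: of_nat_sum of_int_sum)
  then show ?thesis unfolding h_def by blast
qed

end

section \<open>The Killing form\<close>

context simple_cartan
begin

lemma weight_zero: "\<phi> \<in> weights \<Longrightarrow> \<phi> 0 = 0"
  using weight_scale[of \<phi> 0 0] cvec.subspace_0[OF subspace_H] by simp

text \<open>The weight spaces span the algebra, so a linear condition needs checking only on weight
  vectors; bilinear identities are obtained by applying this in each argument.\<close>

lemma weight_space_induct [consumes 1, case_names weight_space]:
  assumes "cvec.subspace V" "\<And>\<phi> z. \<phi> \<in> weights \<Longrightarrow> z \<in> GW \<phi> \<Longrightarrow> z \<in> V"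
  shows "z \<in> V"
  using span_basis_on_subset[of weights V] assms span_basis_on_weights by blast

section \<open>Projections onto weight spaces and the trace form\<close>

abbreviation wB :: "'g set" where "wB \<equiv> basis_on weights"

lemma wB: "cvec.independent wB" "finite wB" "cvec.span wB = UNIV"
  using independent_basis_on finite_basis_on weights_supported span_basis_on_weights by auto

text \<open>For \<phi> supported on \<open>H\<close>, this is the projection onto
  \<open>GW \<phi>\<close> along the other weight spaces, written in coordinates of the adapted
  basis so that linearity is immediate.\<close>

definition comp :: "('g \<Rightarrow> complex) \<Rightarrow> 'g \<Rightarrow> 'g" where
  "comp \<phi> z = (\<Sum>b\<in>wbasis \<phi>. cvec.representation wB z b *\<^sub>C b)"

lemma linear_comp: "cvec.endo (comp \<phi>)"
  by (simp add: Vector_Spaces.linear_iff cvec.vector_space_axioms comp_def wB cvec.representation_add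
      cvec.representation_scale cvec.scale_left_distrib sum.distrib cvec.scale_sum_right)

sublocale comp: Vector_Spaces.linear scaleC scaleC "comp \<phi>" for \<phi>
  by (rule linear_comp)

lemma comp_in: "comp \<phi> z \<in> GW \<phi>"
  unfolding comp_def wbasis(3)[symmetric] by (intro cvec.span_sum cvec.span_scale cvec.span_base)

lemma comp_gen_weight_space:
  assumes "\<psi> \<in> supported_on H" "z \<in> GW \<psi>"
  shows comp_same: "comp \<psi> z = z" and comp_other: "\<phi> \<in> supported_on H \<Longrightarrow> \<phi> \<noteq> \<psi> \<Longrightarrow> comp \<phi> z = 0"
proof -
  have "comp \<psi> z = z \<and> (\<phi> \<in> supported_on H \<longrightarrow> \<phi> \<noteq> \<psi> \<longrightarrow> comp \<phi> z = 0)" for \<phi>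
  proof (cases "\<psi> \<in> weights")
    case False
    then have "z = 0" using assms by (auto simp: weights_def)
    then show ?thesis by (simp add: comp.zero)
  next
    case True
    have rep: "cvec.representation wB z = cvec.representation (wbasis \<psi>) z"
      using assms True by (intro cvec.representation_extend wB) (auto simp: wbasis basis_on_def)
    have "comp \<psi> z = z"
      unfolding comp_def rep using assms by (intro cvec.sum_representation_eq wbasis) (auto simp: wbasis)
    moreover have "comp \<phi> z = 0" if "\<phi> \<in> supported_on H" "\<phi> \<noteq> \<psi>"
    proof -
      have "wbasis \<phi> \<inter> wbasis \<psi> = {}"
        using that assms by (intro wbasis_disjoint[of "supported_on H"]) auto
      then have "cvec.representation wB z b = 0" if "b \<in> wbasis \<phi>" for b
        unfolding rep using cvec.representation_ne_zero[of "wbasis \<psi>" z b] that by blast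
      then show ?thesis by (simp add: comp_def)
    qed
    ultimately show ?thesis by blast
  qed
  then show "comp \<psi> z = z" "\<phi> \<in> supported_on H \<Longrightarrow> \<phi> \<noteq> \<psi> \<Longrightarrow> comp \<phi> z = 0" by auto
qed

lemma sum_comp: "(\<Sum>\<phi>\<in>weights. comp \<phi> z) = z"
proof -
  have "(\<Sum>\<phi>\<in>weights. comp \<phi> z) = (\<Sum>b\<in>wB. cvec.representation wB z b *\<^sub>C b)"
    unfolding comp_def basis_on_def[of weights]
      using wbasis_disjoint[OF weights_supported] wbasis(4) finite_weights
    by (intro sum.UNION_disjoint[symmetric]) auto
  also have "\<dots> = z" using wB by (intro cvec.sum_representation_eq) auto
  finally show ?thesis .
qed

definition killing :: "'g \<Rightarrow> 'g \<Rightarrow> complex" where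
  "killing x y = cvec.trace_on wB (\<lambda>z. bracket x (bracket y z))"

lemma trace_wB_add: "cvec.trace_on wB (\<lambda>z. f z + g z) = cvec.trace_on wB f + cvec.trace_on wB g"
  and trace_wB_diff: "cvec.trace_on wB (\<lambda>z. f z - g z) = cvec.trace_on wB f - cvec.trace_on wB g"
  and trace_wB_scale: "cvec.trace_on wB (\<lambda>z. c *\<^sub>C f z) = c * cvec.trace_on wB f"
  using wB by (auto intro!: cvec.trace_on_add cvec.trace_on_diff cvec.trace_on_scale)

lemma trace_wB_commute:
  "cvec.endo f \<Longrightarrow> cvec.endo g \<Longrightarrow> cvec.trace_on wB (\<lambda>z. f (g z)) = cvec.trace_on wB (\<lambda>z. g (f z))"
  using wB by (intro cvec.trace_on_comp_commute) auto

lemma linear_bracket_comp: "cvec.endo f \<Longrightarrow> cvec.endo (\<lambda>z. bracket y (f z))"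
  using Vector_Spaces.linear_compose[OF _ linear_bracket, of scaleC f y] by (simp add: comp_def o_def)

lemma killing_add_left: "killing (x + y) z = killing x z + killing y z"
  and killing_add_right: "killing z (x + y) = killing z x + killing z y"
  and killing_scale_left: "killing (c *\<^sub>C x) z = c * killing x z"
  and killing_scale_right: "killing z (c *\<^sub>C x) = c * killing z x"
  by (simp_all add: killing_def bracket_add_left bracket_add_right bracket_scaleC_left bracket_scaleC_right
      trace_wB_add trace_wB_scale)

lemma killing_zero_left: "killing 0 z = 0" and killing_zero_right: "killing z 0 = 0"
  using killing_scale_left[of 0 0 z] killing_scale_right[of z 0 0] by simp_all

lemma killing_sym: "killing x y = killing y x"
  unfolding killing_def by (intro trace_wB_commute linear_bracket)

lemma killing_invariant: "killing (bracket x y) z = killing x (bracket y z)"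
proof -
  have "cvec.trace_on wB (\<lambda>w. bracket y (bracket x (bracket z w))) =
        cvec.trace_on wB (\<lambda>w. bracket x (bracket z (bracket y w)))"
    using trace_wB_commute[OF linear_bracket[of y] linear_bracket_comp[OF linear_bracket], of x z] by simp
  then show ?thesis
    by (simp add: killing_def bracket_bracket bracket_right.diff trace_wB_diff)
qed

lemma subspace_killing: "cvec.subspace {y. killing x y = 0}"
  by (auto simp: cvec.subspace_def killing_add_right killing_scale_right killing_zero_right)

text \<open>For commuting maps the n-th power of the product is the product of the n-th powers, so
  one nilpotent factor makes the product nilpotent.\<close>

lemma trace_commuting_nilpotent:
  assumes f: "cvec.endo f" "f ` GW \<phi> \<subseteq> GW \<phi>"
    and g: "cvec.endo g" "g ` GW \<phi> \<subseteq> GW \<phi>"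
    and comm: "\<And>z. z \<in> GW \<phi> \<Longrightarrow> f (g z) = g (f z)"
    and nil: "\<And>z. z \<in> GW \<phi> \<Longrightarrow> \<exists>n. (f ^^ n) z = 0"
  shows "cvec.trace_on (wbasis \<phi>) (\<lambda>z. f (g z)) = 0"
proof (rule cvec.trace_on_nilpotent)
  interpret f: Vector_Spaces.linear scaleC scaleC f by fact
  interpret g: Vector_Spaces.linear scaleC scaleC g by fact
  show "cvec.endo (\<lambda>z. f (g z))"
    by (simp add: Vector_Spaces.linear_iff cvec.vector_space_axioms f.add f.scale g.add g.scale)
  show "(\<lambda>z. f (g z)) ` cvec.span (wbasis \<phi>) \<subseteq> cvec.span (wbasis \<phi>)"
    using f(2) g(2) by (auto simp: wbasis(3))
  have 1: "(f ^^ n) (g z) = g ((f ^^ n) z) \<and> (f ^^ n) z \<in> GW \<phi>" if "z \<in> GW \<phi>" for n z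
    by (induction n) (use that comm f(2) in auto)
  have 2: "((\<lambda>z. f (g z)) ^^ n) z = (g ^^ n) ((f ^^ n) z)" if "z \<in> GW \<phi>" for n z
    using that
  proof (induction n arbitrary: z)
    case (Suc n)
    have "f (g z) \<in> GW \<phi>" using Suc.prems f(2) g(2) by blast
    then have "((\<lambda>z. f (g z)) ^^ Suc n) z = (g ^^ n) ((f ^^ n) (f (g z)))"
      using Suc.IH by (simp only: funpow_Suc_right o_apply)
    also have "(f ^^ n) (f (g z)) = (f ^^ Suc n) (g z)" by (simp add: funpow_swap1)
    also have "\<dots> = g ((f ^^ Suc n) z)" using 1[OF Suc.prems] by blast
    finally show ?case by (simp add: funpow_swap1)
  qed simp
  show "\<exists>n. ((\<lambda>z. f (g z)) ^^ n) v = 0" if "v \<in> cvec.span (wbasis \<phi>)" for v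
  proof -
    have v: "v \<in> GW \<phi>" using that by (simp add: wbasis(3))
    then obtain n where "(f ^^ n) v = 0" using nil by blast
    then show ?thesis using 2[OF v, of n] cvec.funpow_zero[OF g(1)] by (intro exI[of _ n]) simp
  qed
qed (simp_all add: wbasis)

lemma shifted_gen_weight_space:
  assumes "x \<in> H"
  shows "cvec.shifted (bracket x) (\<phi> x) ` GW \<phi> \<subseteq> GW \<phi>"
    and "z \<in> GW \<phi> \<Longrightarrow> \<exists>n. (cvec.shifted (bracket x) (\<phi> x) ^^ n) z = 0"
proof -
  show "cvec.shifted (bracket x) (\<phi> x) ` GW \<phi> \<subseteq> GW \<phi>"
    using shifted_stable[OF subspace_gen_weight_space[of H \<phi>], where x = x and c = "\<phi> x" and n = 1]
      bracket_H_gen_weight_space[OF assms] by auto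
  show "z \<in> GW \<phi> \<Longrightarrow> \<exists>n. (cvec.shifted (bracket x) (\<phi> x) ^^ n) z = 0"
    using assms by (auto simp: gen_weight_space_def gen_eigenspace_def)
qed

text \<open>On \<open>GW \<phi>\<close>, (ad x)^2 equals (ad x - \<phi>(x)) (ad x + \<phi>(x)) plus
  the scalar \<phi>(x)^2, and the product is traceless as a nilpotent map times one commuting with
  it. Polarization gives the bilinear formula.\<close>

lemma killing_self: 
  assumes x: "x \<in> H" shows "killing x x = (\<Sum>\<phi>\<in>weights. of_nat (dimw \<phi>) * \<phi> x * \<phi> x)"
proof -
  have "killing x x = (\<Sum>\<phi>\<in>weights. cvec.trace_on (wbasis \<phi>) (\<lambda>z. bracket x (bracket x z)))"
    unfolding killing_def using bracket_H_gen_weight_space[OF x] by (intro trace_on_blocks) auto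
  also have "\<dots> = (\<Sum>\<phi>\<in>weights. of_nat (dimw \<phi>) * \<phi> x * \<phi> x)"
  proof (rule sum.cong)
    fix \<phi>
    let ?s = "cvec.shifted (bracket x) (\<phi> x)"
    have st: "?s z \<in> GW \<phi>" if "z \<in> GW \<phi>" for z
      using shifted_gen_weight_space(1)[OF x, of \<phi>] that by blast
    have sB: "z \<in> GW \<phi>" if "z \<in> wbasis \<phi>" for z using that wbasis(1) by blast
    let ?g = "\<lambda>z. bracket x z + \<phi> x *\<^sub>C z"
    have g: "?g z \<in> GW \<phi>" if "z \<in> GW \<phi>" for z
      using bracket_H_gen_weight_space[OF x that] that
      by (auto intro!: cvec.subspace_add cvec.subspace_scale subspace_gen_weight_space)
    have "cvec.trace_on (wbasis \<phi>) (\<lambda>z. bracket x (bracket x z)) =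
       cvec.trace_on (wbasis \<phi>) (\<lambda>z. ?s (?g z) + (\<phi> x * \<phi> x) *\<^sub>C z)"
      by (rule cvec.trace_on_cong)
        (simp add: cvec.shifted_def bracket_right.add bracket_right.scale cvec.scale_right_distrib)
    also have "\<dots> = cvec.trace_on (wbasis \<phi>) (\<lambda>z. ?s (?g z)) + cvec.trace_on (wbasis \<phi>) (\<lambda>z. (\<phi> x * \<phi> x) *\<^sub>C
      z)"
      using st[OF g] sB by (intro cvec.trace_on_add wbasis)
        (auto simp: wbasis(3) intro!: cvec.subspace_scale subspace_gen_weight_space)
    also have "cvec.trace_on (wbasis \<phi>) (\<lambda>z. ?s (?g z)) = 0"
    proof (rule trace_commuting_nilpotent[where f = ?s and g = ?g])
      show "cvec.endo ?g"
        by (simp add: Vector_Spaces.linear_iff cvec.vector_space_axioms bracket_add_right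
          bracket_scaleC_right
            cvec.scale_right_distrib cvec.scale_left_commute)
      show "?s (?g z) = ?g (?s z)" if "z \<in> GW \<phi>" for z
        by (simp add: cvec.shifted_def bracket_right.add bracket_right.diff bracket_right.scale
          cvec.scale_right_distrib
            cvec.scale_right_diff_distrib)
    qed (use g shifted_gen_weight_space[OF x,
      where \<phi> = \<phi>] in \<open>auto intro!: cvec.linear_shifted linear_bracket\<close>)
    finally show "cvec.trace_on (wbasis \<phi>) (\<lambda>z. bracket x (bracket x z)) = of_nat (dimw \<phi>) * \<phi> x * \<phi> x"
      by (simp add: cvec.trace_on_scalar wbasis dimw_def)
  qed simp
  finally show ?thesis .
qed

lemma killing_on_H:
  assumes x: "x \<in> H" and y: "y \<in> H"
  shows "killing x y = (\<Sum>\<phi>\<in>weights. of_nat (dimw \<phi>) * \<phi> x * \<phi> y)"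
proof -
  have "killing (x + y) (x + y) = killing x x + 2 * killing x y + killing y y"
    using killing_sym[of x y] by (simp add: killing_add_left killing_add_right)
  moreover have "killing (x + y) (x + y) = (\<Sum>\<phi>\<in>weights. of_nat (dimw \<phi>) * (\<phi> x + \<phi> y) * (\<phi> x + \<phi> y))"
    using killing_self[OF cvec.subspace_add[OF subspace_H x y]] x y by (simp add: weight_add)
  ultimately have "2 * killing x y = 2 * (\<Sum>\<phi>\<in>weights. of_nat (dimw \<phi>) * \<phi> x * \<phi> y)"
    unfolding killing_self[OF x] killing_self[OF y]
    by (simp add: ring_distribs sum.distrib sum_distrib_left mult.commute mult.left_commute)
  then show ?thesis by simp
qed

lemma killing_orthogonal:
  assumes "u \<in> GW \<phi>" "v \<in> GW \<psi>"
    and "\<phi> \<in> supported_on H" "\<psi> \<in> supported_on H" "\<phi> + \<psi> \<noteq> 0"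
  shows "killing u v = 0"
  unfolding killing_def
proof (rule trace_on_shift_eq_0)
  show "bracket u (bracket v z) \<in> GW (\<chi> + (\<phi> + \<psi>))" if "z \<in> GW \<chi>" for z \<chi>
    using bracket_gen_weight_space[OF assms(1) bracket_gen_weight_space[OF assms(2) that]]
    by (simp add: algebra_simps)
qed (use assms supported_on_add in auto)

text \<open>For a nonzero weight \<phi> and y = [u, v], every weight takes a real multiple r of
  \<phi>(y) at y. So the Killing form at (y, y) is \<phi>(y)^2 times a sum of dimensions times r^2,
  in which \<phi> itself contributes a positive term.\<close>

lemma weight_bracket_eq_0_if_K_eq_0:
  assumes K0: "\<And>x y. killing x y = 0" and \<psi>: "\<psi> \<in> weights" and \<phi>: "\<phi> \<in> supported_on H"
    and u: "u \<in> GW \<phi>" and v: "v \<in> GW (- \<phi>)"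
  shows "\<psi> (bracket u v) = 0"
proof (cases "\<phi> = 0")
  case True
  then show ?thesis using u v gen_weight_space_zero weight_bracket[OF \<psi>] by simp
next
  case False
  let ?y = "bracket u v"
  have y: "?y \<in> H" using bracket_gen_weight_space[OF u v] gen_weight_space_zero by simp
  show ?thesis
  proof (cases "\<phi> \<in> weights")
    case False
    then have "u = 0" using u \<phi> by (auto simp: weights_def)
    then show ?thesis using weight_zero[OF \<psi>] by (simp add: bracket_left.zero)
  next
    case True
    have "\<forall>\<chi>\<in>weights. \<exists>r :: real. \<chi> ?y = of_real r * \<phi> ?y"
      using weight_on_bracket_real[OF \<phi> \<open>\<phi> \<noteq> 0\<close> u v] by blast
    from bchoice[OF this] obtain r :: "_ \<Rightarrow> real" where r: "\<And>\<chi>. \<chi> \<in> weights \<Longrightarrow> \<chi> ?y = of_real (r \<chi>) * \<phi> ?y"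
      by blast
    have "\<phi> ?y = 0"
    proof (rule ccontr)
      assume ne: "\<phi> ?y \<noteq> 0"
      then have r1: "r \<phi> = 1" using r[OF True] by simp
      have "0 = (\<Sum>\<chi>\<in>weights. of_nat (dimw \<chi>) * \<chi> ?y * \<chi> ?y)" using K0 killing_self[OF y] by simp
      also have "\<dots> = (\<Sum>\<chi>\<in>weights. of_real (real (dimw \<chi>) * (r \<chi>)\<^sup>2) * (\<phi> ?y)\<^sup>2)"
        by (intro sum.cong refl) (simp add: r power2_eq_square)
      also have "\<dots> = of_real (\<Sum>\<chi>\<in>weights. real (dimw \<chi>) * (r \<chi>)\<^sup>2) * (\<phi> ?y)\<^sup>2"
        by (simp add: sum_distrib_right)
      finally have "(\<Sum>\<chi>\<in>weights. real (dimw \<chi>) * (r \<chi>)\<^sup>2) = 0" using ne by (simp del: of_real_sum)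
      moreover have "(\<Sum>\<chi>\<in>weights. real (dimw \<chi>) * (r \<chi>)\<^sup>2) > 0"
        using finite_weights True dimw_pos[OF True] r1 by (intro sum_pos2[of _ \<phi>]) auto
      ultimately show False by simp
    qed
    then show ?thesis using r[OF \<psi>] by simp
  qed
qed

lemma derived_UNIV: "lie_prod UNIV UNIV = (UNIV :: 'g set)"
proof -
  have "lie_ideal UNIV (lie_prod UNIV UNIV :: 'g set)"
    unfolding lie_ideal_def lie_prod_def by (auto intro!: cvec.span_base)
  then show ?thesis using ideal_trivial simple unfolding simple_lie_algebra_def by blast
qed

lemma H_neq_UNIV: "H \<noteq> UNIV"
proof
  assume H: "H = UNIV"
  have "lcH k = UNIV" for k unfolding lcH_def by (induction k) (simp_all add: H derived_UNIV)
  then have "UNIV = {0 :: 'g}" using lcH_zero by blast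
  then have "lie_prod UNIV UNIV = {0 :: 'g}" using derived_UNIV by simp
  then show False using simple unfolding simple_lie_algebra_def by blast
qed

lemma zero_supported: "0 \<in> supported_on H" by (simp add: supported_on_def)

text \<open>Cartan's criterion: if the Killing form vanished, all weights would vanish on \<open>H = [g,g] \<inter> H\<close>.\<close>

lemma killing_nondegenerate: assumes "\<And>y. killing x y = 0" shows "x = 0"
proof -
  let ?I = "{x. \<forall>y. killing x y = 0}"
  have "lie_ideal UNIV ?I"
    unfolding lie_ideal_def cvec.subspace_def
  proof (intro conjI ballI)
    fix x y :: 'g assume "y \<in> ?I"
    then have "killing (bracket y x) z = 0" for z by (simp add: killing_invariant)
    then show "bracket x y \<in> ?I"
      unfolding bracket_antisym[of x y] using killing_scale_left[of "- 1" "bracket y x"] by simp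
  qed (auto simp: killing_zero_left killing_add_left killing_scale_left)
  moreover have "?I \<noteq> UNIV"
  proof
    assume "?I = UNIV"
    then have K0: "killing x y = 0" for x y by blast
    have van: "\<psi> h = 0" if \<psi>: "\<psi> \<in> weights" and h: "h \<in> H" for \<psi> h
    proof -
      have c0: "comp 0 z \<in> H" for z using comp_in[of 0 z] gen_weight_space_zero by simp
      have sub: "cvec.subspace {z. \<psi> (comp 0 (f z)) = 0}" if "cvec.endo f" for f
      proof -
        interpret f: Vector_Spaces.linear scaleC scaleC f by fact
        show ?thesis using c0 \<psi>
          by (auto simp: cvec.subspace_def comp.zero comp.add comp.scale f.zero f.add f.scale weight_zero
            weight_add weight_scale)
      qed
      \<comment> \<open>Projecting brackets to \<open>H\<close> by \<open>comp 0\<close> replaces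
        the intersection of [g, g] with \<open>H\<close>; only brackets of opposite weight vectors
        can have a component there.\<close>
      have *: "\<psi> (comp 0 (bracket u v)) = 0"
        if "u \<in> GW \<phi>" "v \<in> GW \<chi>" "\<phi> \<in> weights" "\<chi> \<in> weights" for u v \<phi> \<chi>
      proof -
        have sup: "\<phi> \<in> supported_on H" "\<chi> \<in> supported_on H" using that weights_supported by auto
        have uv: "bracket u v \<in> GW (\<phi> + \<chi>)" using bracket_gen_weight_space that by blast
        show ?thesis
        proof (cases "\<phi> + \<chi> = 0")
          case True
          then have "\<chi> = - \<phi>" by (simp add: eq_neg_iff_add_eq_0 add.commute)
          then have "\<psi> (bracket u v) = 0" using weight_bracket_eq_0_if_K_eq_0[OF K0 \<psi> sup(1)] that by blast
          then show ?thesis using comp_same[OF zero_supported] uv True by simp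
        next
          case False
          then have "comp 0 (bracket u v) = 0"
            using comp_other[OF supported_on_add[OF sup] uv zero_supported] by auto
          then show ?thesis using weight_zero[OF \<psi>] by simp
        qed
      qed
      have **: "\<psi> (comp 0 (bracket u v)) = 0" if v: "v \<in> GW \<chi>" "\<chi> \<in> weights" for u v \<chi>
      proof -
        have "u \<in> {u. \<psi> (comp 0 (bracket u v)) = 0}"
          by (rule weight_space_induct[OF sub[OF bracket_left.linear_axioms]]) (simp add: *[OF _ v(1) _
            v(2)])
        then show ?thesis by simp
      qed
      have "v \<in> {v. \<psi> (comp 0 (bracket u v)) = 0}" for u v
        by (rule weight_space_induct[OF sub[OF linear_bracket]]) (simp add: **)
      then have "{bracket x y |x y. x \<in> UNIV \<and> y \<in> UNIV} \<subseteq> {z. \<psi> (comp 0 z) = 0}" by blast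
      then have "lie_prod UNIV UNIV \<subseteq> {z. \<psi> (comp 0 z) = 0}"
        unfolding lie_prod_def using sub[OF cvec.linear_id] by (intro cvec.span_minimal) (auto simp: id_def)
      then have "\<psi> (comp 0 h) = 0" using derived_UNIV by auto
      then show ?thesis using comp_same[OF zero_supported] h gen_weight_space_zero by simp
    qed
    have "\<psi> = 0" if "\<psi> \<in> weights" for \<psi>
      using van[OF that] that weights_supported by (auto simp: supported_on_def fun_eq_iff)
    \<comment> \<open>With 0 as the only weight, the whole algebra would be its own Cartan
      subalgebra, hence nilpotent, although it equals its derived algebra.\<close>
    then have "z \<in> H" if "\<psi> \<in> weights" "z \<in> GW \<psi>" for \<psi> z
      using that gen_weight_space_zero by blast
    then have "z \<in> H" for z by (rule weight_space_induct[OF subspace_H])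
    then show False using H_neq_UNIV by blast
  qed
  ultimately have "?I = {0}" using ideal_trivial by blast
  then show ?thesis using assms by blast
qed

text \<open>The Killing form can pair \<open>GW \<phi>\<close> nontrivially only with
  \<open>GW (- \<phi>)\<close>, so nondegeneracy passes to each such pair; \<phi> = 0 gives
  nondegeneracy on \<open>H\<close>.\<close>

lemma killing_nondegenerate_weight:
  assumes "x \<in> GW \<phi>" "\<phi> \<in> supported_on H" "x \<noteq> 0"
  shows "\<exists>y \<in> GW (- \<phi>). killing x y \<noteq> 0"
proof (rule ccontr)
  assume no: "\<not> ?thesis"
  have "killing x y = 0" for y
  proof -
    have "y \<in> {y. killing x y = 0}"
    proof (rule weight_space_induct[OF subspace_killing])
      fix \<psi> z assume z: "\<psi> \<in> weights" "z \<in> GW \<psi>"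
      show "z \<in> {y. killing x y = 0}"
      proof (cases "\<phi> + \<psi> = 0")
        case True
        then have "\<psi> = - \<phi>" by (simp add: eq_neg_iff_add_eq_0 add.commute)
        then show ?thesis using no z by blast
      next
        case False
        then show ?thesis using killing_orthogonal[OF assms(1) z(2) assms(2)] z weights_supported by auto
      qed
    qed
    then show ?thesis by simp
  qed
  then show False using killing_nondegenerate assms(3) by blast
qed

lemma killing_nondegenerate_H:
  assumes "x \<in> H" "\<And>y. y \<in> H \<Longrightarrow> killing x y = 0" shows "x = 0"
  using killing_nondegenerate_weight[of x 0] assms zero_supported gen_weight_space_zero by auto

text \<open>Weights vanish on [x, y], so the formula for the Killing form on \<open>H\<close> makes
  [x, y] orthogonal to \<open>H\<close>.\<close>

lemma H_abelian: assumes "x \<in> H" "y \<in> H" shows "bracket x y = 0"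
  using assms bracket_H[OF assms]
    by (intro killing_nondegenerate_H) (simp_all add: killing_on_H weight_bracket)

text \<open>The nilpotent part of \<open>ad x\<close> is a derivation that is trace-orthogonal to all of \<open>ad g\<close>, and such
  a derivation maps into the radical of the Killing form.\<close>

lemma bracket_H_diagonal:
  assumes x: "x \<in> H" and \<phi>: "\<phi> \<in> supported_on H" and z: "z \<in> GW \<phi>"
  shows "bracket x z = \<phi> x *\<^sub>C z"
proof -
  \<comment> \<open>\<open>s\<close> is the semisimple part of ad x, acting on each weight space by
    its weight, and \<open>N\<close> is the nilpotent part.\<close>
  define s where "s w = (\<Sum>\<psi>\<in>weights. \<psi> x *\<^sub>C comp \<psi> w)" for w
  define N where "N w = bracket x w - s w" for w
  interpret s: Vector_Spaces.linear scaleC scaleC s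
    by (simp add: Vector_Spaces.linear_iff cvec.vector_space_axioms s_def comp.add comp.scale
        cvec.scale_right_distrib sum.distrib cvec.scale_sum_right mult.commute)
  interpret N: Vector_Spaces.linear scaleC scaleC N
    by (simp add: Vector_Spaces.linear_iff cvec.vector_space_axioms N_def s.add s.scale
        bracket_add_right bracket_scaleC_right cvec.scale_right_diff_distrib)
  have s_on: "s w = \<psi> x *\<^sub>C w" if "\<psi> \<in> supported_on H" "w \<in> GW \<psi>" for \<psi> w
  proof (cases "\<psi> \<in> weights")
    case False
    then have "w = 0" using that by (auto simp: weights_def)
    then show ?thesis by (simp add: s.zero)
  next
    case True
    have "s w = (\<Sum>\<chi>\<in>weights. if \<chi> = \<psi> then \<psi> x *\<^sub>C w else 0)" unfolding s_def
    proof (rule sum.cong)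
      fix \<chi> assume "\<chi> \<in> weights"
      then show "\<chi> x *\<^sub>C comp \<chi> w = (if \<chi> = \<psi> then \<psi> x *\<^sub>C w else 0)"
        using comp_same[OF that] comp_other[OF that] weights_supported by auto
    qed simp
    then show ?thesis using finite_weights True by simp
  qed
  have N_on: "N w = cvec.shifted (bracket x) (\<psi> x) w" if "\<psi> \<in> supported_on H" "w \<in> GW \<psi>" for \<psi> w
    using s_on[OF that] by (simp add: N_def cvec.shifted_def)
  have N_st: "N w \<in> GW \<psi>" if "\<psi> \<in> supported_on H" "w \<in> GW \<psi>" for \<psi> w
    using N_on[OF that] shifted_gen_weight_space(1)[OF x, of \<psi>] that by auto
  have N_pow: "(N ^^ n) w = (cvec.shifted (bracket x) (\<psi> x) ^^ n) w \<and> (N ^^ n) w \<in> GW \<psi>"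
    if "\<psi> \<in> supported_on H" "w \<in> GW \<psi>" for \<psi> w n
    by (induction n) (use that N_on N_st in auto)
  \<comment> \<open>Weights add under the bracket, which makes \<open>s\<close>, and with it
    \<open>N\<close>, a derivation.\<close>
  have s_der: "s (bracket u v) = bracket (s u) v + bracket u (s v)" for u v
  proof -
    have *: "s (bracket u v) = bracket (s u) v + bracket u (s v)"
      if "u \<in> GW \<psi>" "v \<in> GW \<chi>" "\<psi> \<in> weights" "\<chi> \<in> weights" for u v \<psi> \<chi>
    proof -
      have sup: "\<psi> \<in> supported_on H" "\<chi> \<in> supported_on H" using that weights_supported by auto
      have "s (bracket u v) = (\<psi> + \<chi>) x *\<^sub>C bracket u v"
        using sup that by (intro s_on supported_on_add bracket_gen_weight_space)
      then show ?thesis using s_on[OF sup(1) that(1)] s_on[OF sup(2) that(2)]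
        by (simp add: cvec.scale_left_distrib bracket_scaleC_left bracket_scaleC_right)
    qed
    have sub1: "cvec.subspace {u. s (bracket u v) = bracket (s u) v + bracket u (s v)}" for v
      by (auto simp: cvec.subspace_def bracket_left.zero s.zero bracket_add_left s.add bracket_scaleC_left
        s.scale
          cvec.scale_right_distrib)
    have sub2: "cvec.subspace {v. s (bracket u v) = bracket (s u) v + bracket u (s v)}" for u
      by (auto simp: cvec.subspace_def bracket_right.zero s.zero bracket_add_right s.add
        bracket_scaleC_right s.scale
          cvec.scale_right_distrib)
    have **: "s (bracket u v) = bracket (s u) v + bracket u (s v)" if v: "v \<in> GW \<chi>" "\<chi> \<in> weights" for u v \<chi>
    proof -
      have "u \<in> {u. s (bracket u v) = bracket (s u) v + bracket u (s v)}"
        by (rule weight_space_induct[OF sub1]) (simp add: *[OF _ v(1) _ v(2)])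
      then show ?thesis by simp
    qed
    have "v \<in> {v. s (bracket u v) = bracket (s u) v + bracket u (s v)}"
      by (rule weight_space_induct[OF sub2]) (simp add: **)
    then show ?thesis by simp
  qed
  have N_der: "N (bracket u v) = bracket (N u) v + bracket u (N v)" for u v
    by (simp add: N_def s_der bracket_derivation[of x u v] bracket_left.diff bracket_right.diff)
  \<comment> \<open>For \<open>y\<close> of nonzero weight the composite shifts weights; for
    \<open>y\<close> in \<open>H\<close> it is \<open>N\<close> times a map commuting with it, as
    \<open>H\<close> is abelian.\<close>
  have trN: "cvec.trace_on wB (\<lambda>w. N (bracket y w)) = 0" for y
  proof -
    have "y \<in> {y. cvec.trace_on wB (\<lambda>w. N (bracket y w)) = 0}"
    proof (rule weight_space_induct)
      show "cvec.subspace {y. cvec.trace_on wB (\<lambda>w. N (bracket y w)) = 0}"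
        using trace_wB_scale[of 0 "\<lambda>_. 0"]
        by (auto simp: cvec.subspace_def bracket_left.zero N.zero bracket_add_left N.add bracket_scaleC_left
          N.scale
            trace_wB_add trace_wB_scale)
      fix \<chi> y assume \<chi>: "\<chi> \<in> weights" "y \<in> GW \<chi>"
      have "cvec.trace_on wB (\<lambda>w. N (bracket y w)) = 0"
      proof (cases "\<chi> = 0")
        case False
        show ?thesis
        proof (rule trace_on_shift_eq_0)
          show "N (bracket y w) \<in> GW (\<psi> + \<chi>)" if "\<psi> \<in> weights" "w \<in> GW \<psi>" for \<psi> w
            using that \<chi> bracket_gen_weight_space[OF \<chi>(2) that(2)] weights_supported
            by (intro N_st supported_on_add) (auto simp: add.commute)
        qed (use False \<chi> weights_supported in auto)
      next
        case True
        then have y: "y \<in> H" using \<chi> gen_weight_space_zero by simp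
        have "cvec.trace_on wB (\<lambda>w. N (bracket y w))
          = (\<Sum>\<psi>\<in>weights. cvec.trace_on (wbasis \<psi>) (\<lambda>w. N (bracket y w)))"
          using N_st bracket_H_gen_weight_space[OF y] weights_supported by (intro trace_on_blocks) auto
        also have "\<dots> = 0"
        proof (rule sum.neutral, rule ballI, rule trace_commuting_nilpotent[OF N.linear_axioms _
          linear_bracket])
          fix \<psi> assume "\<psi> \<in> weights"
          then have \<psi>: "\<psi> \<in> supported_on H" using weights_supported by blast
          show "N ` GW \<psi> \<subseteq> GW \<psi>" using N_st[OF \<psi>] by blast
          show "bracket y ` GW \<psi> \<subseteq> GW \<psi>" using bracket_H_gen_weight_space[OF y] by blast
          show "\<exists>n. (N ^^ n) w = 0" if "w \<in> GW \<psi>" for w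
            using N_pow[OF \<psi> that] shifted_gen_weight_space(2)[OF x that] by auto
          show "N (bracket y w) = bracket y (N w)" if "w \<in> GW \<psi>" for w
            using N_on[OF \<psi> that] N_on[OF \<psi> bracket_H_gen_weight_space[OF y that]] bracket_derivation[of x y
            w] H_abelian[OF x y]
            by (simp add: cvec.shifted_def bracket_right.diff bracket_right.scale bracket_left.zero)
        qed
        finally show ?thesis .
      qed
      then show "y \<in> {y. cvec.trace_on wB (\<lambda>w. N (bracket y w)) = 0}" by simp
    qed
    then show ?thesis by simp
  qed
  \<comment> \<open>As \<open>N\<close> is a derivation, ad (N z) is the commutator of
    \<open>N\<close> and ad z. Cyclicity turns the Killing form at (N z, v) into the trace of
    \<open>N\<close> composed with ad [z, v].\<close>
  have "killing (N z) v = 0" for v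
  proof -
    have "bracket (N z) (bracket v w) = N (bracket z (bracket v w)) - bracket z (N (bracket v w))" for w
      by (simp add: N_der)
    then have "killing (N z) v
      = cvec.trace_on wB (\<lambda>w. N (bracket z (bracket v w))) - cvec.trace_on wB (\<lambda>w. bracket z (N (bracket v
        w)))"
      by (simp add: killing_def trace_wB_diff)
    also have "cvec.trace_on wB (\<lambda>w. bracket z (N (bracket v w)))
      = cvec.trace_on wB (\<lambda>w. N (bracket v (bracket z w)))"
      using Vector_Spaces.linear_compose[OF linear_bracket N.linear_axioms, of v]
      by (intro trace_wB_commute linear_bracket) (simp add: o_def)
    also have "cvec.trace_on wB (\<lambda>w. N (bracket z (bracket v w))) - cvec.trace_on wB (\<lambda>w. N (bracket v
      (bracket z w))) =
        cvec.trace_on wB (\<lambda>w. N (bracket (bracket z v) w))"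
      by (simp add: bracket_bracket N.diff trace_wB_diff)
    finally show ?thesis using trN by simp
  qed
  then have "N z = 0" by (rule killing_nondegenerate)
  then show ?thesis using s_on[OF \<phi> z] by (simp add: N_def)
qed

section \<open>From generalized weights to roots\<close>

lemma gen_weight_space_eq: "\<phi> \<in> supported_on H \<Longrightarrow> GW \<phi> = W \<phi>"
proof
  assume \<phi>: "\<phi> \<in> supported_on H"
  then show "GW \<phi> \<subseteq> W \<phi>"
    using bracket_H_diagonal by (auto simp: weight_space_def)
  show "W \<phi> \<subseteq> GW \<phi>"
    by (auto simp: weight_space_def gen_weight_space_def cvec.shifted_def intro!: gen_eigenspaceI[of 1])
qed

lemma weight_in_dual: "\<phi> \<in> weights \<Longrightarrow> \<phi> \<in> dual H"
  using weights_supported weight_add weight_scale by (auto simp: dual_def supported_on_def)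

lemma dual_supported: "dual H \<subseteq> supported_on H"
  by (auto simp: dual_def supported_on_def)

lemma roots_eq: "roots H = weights - {0}"
  unfolding roots_def using weight_in_dual dual_supported gen_weight_space_eq by (auto simp: weights_def)

end

section \<open>Root spaces\<close>

lemma subspace_weight_space: "cvec.subspace (weight_space S \<phi>)"
  by (auto simp: cvec.subspace_def weight_space_def bracket_right.zero bracket_add_right
    bracket_scaleC_right
      cvec.scale_right_distrib cvec.scale_left_commute)

lemma bracket_weight_space:
  assumes "u \<in> weight_space S \<phi>" "v \<in> weight_space S \<psi>"
  shows "bracket u v \<in> weight_space S (\<phi> + \<psi>)"
  using assms
  by (simp add: weight_space_def bracket_derivation[of _ u v] bracket_scaleC_left bracket_scaleC_right
      cvec.scale_left_distrib)

context simple_cartan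
begin

lemma roots_finite: "finite (roots H)"
  using finite_weights by (simp add: roots_eq)

lemma root_supported: "\<phi> \<in> roots H \<Longrightarrow> \<phi> \<in> supported_on H"
  using weights_supported by (auto simp: roots_eq)

lemma root_nonzero: "\<phi> \<in> roots H \<Longrightarrow> \<phi> \<noteq> 0"
  by (auto simp: roots_eq)

lemma root_weight: "\<phi> \<in> roots H \<Longrightarrow> \<phi> \<in> weights"
  by (auto simp: roots_eq)

lemma weight_space_zero: "W 0 = H"
  using gen_weight_space_eq[OF zero_supported] gen_weight_space_zero by simp

lemma rootI:
  assumes "\<phi> \<in> supported_on H" "\<phi> \<noteq> 0" "z \<in> W \<phi>" "z \<noteq> 0"
  shows "\<phi> \<in> roots H"
  using assms gen_weight_space_eq[OF assms(1)] by (auto simp: roots_eq weights_def)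

lemma weight_space_nonroot:
  assumes "\<phi> \<in> supported_on H" "\<phi> \<noteq> 0" "\<phi> \<notin> roots H"
  shows "W \<phi> = {0}"
  using rootI[OF assms(1,2)] assms(3) cvec.subspace_0[OF subspace_weight_space] by blast

section \<open>Opposite root spaces and the vectors dual to roots\<close>

lemma killing_H_bracket:
  assumes "u \<in> W \<alpha>" "h \<in> H"
  shows "killing h (bracket u v) = \<alpha> h * killing u v"
proof -
  have "killing h (bracket u v) = killing (bracket h u) v" by (simp add: killing_invariant)
  then show ?thesis using assms by (simp add: weight_space_def killing_scale_left)
qed

lemma weight_space_pairing:
  assumes "\<alpha> \<in> roots H" "e \<in> W \<alpha>" "e \<noteq> 0"
  shows "\<exists>f \<in> W (- \<alpha>). killing e f = 1"
proof -
  have sup: "\<alpha> \<in> supported_on H" using assms root_supported by blast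
  then obtain f where f: "f \<in> W (- \<alpha>)" "killing e f \<noteq> 0"
    using killing_nondegenerate_weight[of e \<alpha>] assms gen_weight_space_eq[OF sup]
      gen_weight_space_eq[OF supported_on_minus[OF sup]] by auto
  then show ?thesis
    by (intro bexI[of _ "(1 / killing e f) *\<^sub>C f"])
      (auto simp: killing_scale_right intro: cvec.subspace_scale[OF subspace_weight_space])
qed

lemma root_vector_ex: "\<alpha> \<in> roots H \<Longrightarrow> \<exists>e \<in> W \<alpha>. e \<noteq> 0"
  unfolding roots_def using cvec.subspace_0[OF subspace_weight_space] by blast

definition root_vec :: "('g \<Rightarrow> complex) \<Rightarrow> 'g" where
  "root_vec \<alpha> = (SOME e. e \<in> W \<alpha> \<and> e \<noteq> 0)"

lemma root_vec: assumes "\<alpha> \<in> roots H" shows "root_vec \<alpha> \<in> W \<alpha>" "root_vec \<alpha> \<noteq> 0"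
  using someI_ex[of "\<lambda>e. e \<in> W \<alpha> \<and> e \<noteq> 0"] root_vector_ex[OF assms] unfolding root_vec_def by blast+

lemma root_uminus: assumes "\<alpha> \<in> roots H" shows "- \<alpha> \<in> roots H"
proof -
  obtain f where f: "f \<in> W (- \<alpha>)" "killing (root_vec \<alpha>) f = 1"
    using weight_space_pairing[OF assms] root_vec[OF assms] by blast
  then have "f \<noteq> 0" using killing_zero_right by auto
  then show ?thesis using f assms
    by (intro rootI supported_on_minus) (auto simp: root_supported root_nonzero)
qed

text \<open>The vector usually written t with index \<alpha>, representing \<alpha> through the
  Killing form. It exists because, by invariance, [e, f] has this property whenever e and f are
  opposite root vectors paired to 1.\<close>

definition tv :: "('g \<Rightarrow> complex) \<Rightarrow> 'g" where
  "tv \<alpha> = (SOME t. t \<in> H \<and> (\<forall>h\<in>H. killing h t = \<alpha> h))"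

lemma tv:
  assumes "\<alpha> \<in> roots H" shows tv_in: "tv \<alpha> \<in> H" and killing_tv: "h \<in> H \<Longrightarrow> killing h (tv \<alpha>) = \<alpha> h"
proof -
  obtain f where f: "f \<in> W (- \<alpha>)" "killing (root_vec \<alpha>) f = 1"
    using weight_space_pairing[OF assms] root_vec[OF assms] by blast
  have "bracket (root_vec \<alpha>) f \<in> H"
    using bracket_weight_space[OF root_vec(1)[OF assms] f(1)] weight_space_zero by simp
  moreover have "\<forall>h\<in>H. killing h (bracket (root_vec \<alpha>) f) = \<alpha> h"
    using killing_H_bracket[OF root_vec(1)[OF assms]] f(2) by simp
  ultimately have "tv \<alpha> \<in> H \<and> (\<forall>h\<in>H. killing h (tv \<alpha>) = \<alpha> h)" unfolding tv_def by (intro someI) blast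
  then show "tv \<alpha> \<in> H" "h \<in> H \<Longrightarrow> killing h (tv \<alpha>) = \<alpha> h" by auto
qed

lemma eq_in_H: assumes "x \<in> H" "y \<in> H" "\<And>h. h \<in> H \<Longrightarrow> killing h x = killing h y" shows "x = y"
proof -
  have "killing (x - y) h = 0" if "h \<in> H" for h
  proof -
    have "killing h (x + (- 1) *\<^sub>C y) = 0" using assms(3)[OF that]
      by (simp only: killing_add_right killing_scale_right) simp
    then show ?thesis using killing_sym by simp
  qed
  then have "x - y = 0" using assms cvec.subspace_diff[OF subspace_H]
    by (intro killing_nondegenerate_H) auto
  then show ?thesis by simp
qed

lemma bracket_opposite:
  assumes "\<alpha> \<in> roots H" "e \<in> W \<alpha>" "f \<in> W (- \<alpha>)"
  shows "bracket e f = killing e f *\<^sub>C tv \<alpha>"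
proof (rule eq_in_H)
  show "bracket e f \<in> H" using bracket_weight_space[OF assms(2,3)] weight_space_zero by simp
  show "killing e f *\<^sub>C tv \<alpha> \<in> H" using tv_in[OF assms(1)] cvec.subspace_scale[OF subspace_H] by blast
qed (simp add: killing_H_bracket[OF assms(2)] killing_scale_right killing_tv[OF assms(1)])

lemma root_eqI: assumes "\<phi> \<in> roots H" "\<psi> \<in> roots H" "\<And>h. h \<in> H \<Longrightarrow> \<phi> h = \<psi> h" shows "\<phi> = \<psi>"
proof
  show "\<phi> x = \<psi> x" for x
    using assms(3) root_supported[OF assms(1)] root_supported[OF assms(2)]
    by (cases "x \<in> H") (auto simp: supported_on_def)
qed

lemma tv_sym: "\<alpha> \<in> roots H \<Longrightarrow> \<beta> \<in> roots H \<Longrightarrow> \<alpha> (tv \<beta>) = \<beta> (tv \<alpha>)"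
  using killing_tv tv_in killing_sym by metis

lemma weight_tv_real:
  assumes "\<alpha> \<in> roots H" "\<psi> \<in> weights"
  shows "\<exists>r :: real. \<psi> (tv \<alpha>) = of_real r * \<alpha> (tv \<alpha>)"
proof -
  obtain f where f: "f \<in> W (- \<alpha>)" "killing (root_vec \<alpha>) f = 1"
    using weight_space_pairing[OF assms(1)] root_vec[OF assms(1)] by blast
  then have "tv \<alpha> = bracket (root_vec \<alpha>) f" using bracket_opposite[OF assms(1) root_vec(1)[OF assms(1)]]
    by simp
  then show ?thesis
    using weight_on_bracket_real[OF root_supported root_nonzero _ _ assms(2), of \<alpha>
      "root_vec \<alpha>" f] assms(1) f root_vec(1)
      gen_weight_space_eq root_supported supported_on_minus by simp
qed

text \<open>Write each weight at t as r times \<alpha>(t). Then \<alpha>(t), the Killing form at (t,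
  t), equals S \<alpha>(t)^2 with S the sum of dimensions times r^2, so \<alpha>(t) = 1 / S. It is
  nonzero, since otherwise all weights vanish at t, forcing t = 0 and \<alpha> = 0.\<close>

lemma tv_self: assumes "\<alpha> \<in> roots H" shows "\<exists>a > 0. \<alpha> (tv \<alpha>) = complex_of_real a"
proof -
  let ?t = "tv \<alpha>"
  have "\<forall>\<psi>\<in>weights. \<exists>r :: real. \<psi> ?t = of_real r * \<alpha> ?t" using weight_tv_real[OF assms] by blast
  from bchoice[OF this] obtain r :: "_ \<Rightarrow> real" where r: "\<And>\<psi>. \<psi> \<in> weights \<Longrightarrow> \<psi> ?t = of_real (r \<psi>) * \<alpha> ?t"
    by blast
  have ne: "\<alpha> ?t \<noteq> 0"
  proof
    assume "\<alpha> ?t = 0"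
    then have "\<psi> ?t = 0" if "\<psi> \<in> weights" for \<psi> using r that by simp
    then have "killing ?t h = 0" if "h \<in> H" for h unfolding killing_on_H[OF tv_in[OF assms] that]
      using \<open>\<And>\<psi>. \<psi> \<in> weights \<Longrightarrow> \<psi> ?t = 0\<close> by (intro sum.neutral) simp
    then have "?t = 0" using killing_nondegenerate_H tv_in[OF assms] by blast
    then have "\<alpha> h = 0" if "h \<in> H" for h using killing_tv[OF assms that] killing_zero_right by simp
    then have "\<alpha> = 0" using root_supported[OF assms] by (auto simp: supported_on_def fun_eq_iff)
    then show False using root_nonzero assms by blast
  qed
  define S where "S = (\<Sum>\<psi>\<in>weights. real (dimw \<psi>) * (r \<psi>)\<^sup>2)"
  have "\<alpha> ?t = killing ?t ?t" using killing_tv[OF assms tv_in[OF assms]] by simp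
  also have "\<dots> = (\<Sum>\<psi>\<in>weights. of_real (real (dimw \<psi>) * (r \<psi>)\<^sup>2) * (\<alpha> ?t)\<^sup>2)"
    unfolding killing_self[OF tv_in[OF assms]] by (intro sum.cong refl) (simp add: r power2_eq_square)
  also have "\<dots> = of_real S * (\<alpha> ?t)\<^sup>2" by (simp add: sum_distrib_right S_def)
  finally have S1: "of_real S * \<alpha> ?t = 1" using ne by (simp add: power2_eq_square)
  then have "S \<noteq> 0" by auto
  then have "\<alpha> ?t = of_real (1 / S)" using S1 by (simp add: field_simps)
  moreover have "S \<ge> 0" unfolding S_def by (intro sum_nonneg) simp
  ultimately show ?thesis using \<open>S \<noteq> 0\<close> by (intro exI[of _ "1 / S"]) simp
qed

text \<open>On roots, the form induced by the Killing form. \<open>Re\<close> only changes the type: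
  weights take real values at the vectors \<open>tv \<alpha>\<close>.\<close>

definition rip :: "('g \<Rightarrow> complex) \<Rightarrow> ('g \<Rightarrow> complex) \<Rightarrow> real" where
  "rip \<phi> \<alpha> = Re (\<phi> (tv \<alpha>))"

lemma root_tv: "\<alpha> \<in> roots H \<Longrightarrow> \<phi> \<in> weights \<Longrightarrow> \<phi> (tv \<alpha>) = of_real (rip \<phi> \<alpha>)"
  using weight_tv_real[of \<alpha> \<phi>] tv_self[of \<alpha>] by (auto simp: rip_def)

lemma rip_self: "\<alpha> \<in> roots H \<Longrightarrow> rip \<alpha> \<alpha> > 0"
  using tv_self[of \<alpha>] by (auto simp: rip_def)

lemma rip_sym: "\<alpha> \<in> roots H \<Longrightarrow> \<beta> \<in> roots H \<Longrightarrow> rip \<alpha> \<beta> = rip \<beta> \<alpha>"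
  using tv_sym by (simp add: rip_def)

text \<open>The hypothesis says that the squared length of \<phi> - \<psi> is at most 0, expanded
  because the difference may fail to be a root. That length is a sum of dimensions times squares of
  the real values of the weights at \<open>tv \<phi> - tv \<psi>\<close>, so this vector
  vanishes.\<close>

lemma rip_definite:
  assumes \<phi>: "\<phi> \<in> roots H" and \<psi>: "\<psi> \<in> roots H" and le: "rip \<phi> \<phi> - rip \<phi> \<psi> - rip \<psi> \<phi> + rip \<psi> \<psi> \<le> 0"
  shows "\<phi> = \<psi>"
proof -
  let ?v = "tv \<phi> + (- 1) *\<^sub>C tv \<psi>"
  have v: "?v \<in> H"
    using tv_in[OF \<phi>] tv_in[OF \<psi>] subspace_H by (intro cvec.subspace_add cvec.subspace_scale)
  have \<chi>v: "\<chi> ?v = of_real (rip \<chi> \<phi> - rip \<chi> \<psi>)" if "\<chi> \<in> weights" for \<chi>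
    using that tv_in[OF \<phi>] tv_in[OF \<psi>] cvec.subspace_scale[OF subspace_H tv_in[OF \<psi>], of "-1"]
    by (simp only: weight_add weight_scale root_tv[OF \<phi>] root_tv[OF \<psi>]) simp
  have "killing ?v ?v = killing ?v (tv \<phi>) + (- 1) * killing ?v (tv \<psi>)"
    by (simp only: killing_add_right killing_scale_right)
  also have "\<dots> = of_real (rip \<phi> \<phi> - rip \<phi> \<psi> - rip \<psi> \<phi> + rip \<psi> \<psi>)"
    using \<chi>v[OF root_weight[OF \<phi>]] \<chi>v[OF root_weight[OF \<psi>]] killing_tv[OF \<phi> v] killing_tv[OF \<psi> v] by simp
  finally have "killing ?v ?v = of_real (rip \<phi> \<phi> - rip \<phi> \<psi> - rip \<psi> \<phi> + rip \<psi> \<psi>)" .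
  moreover have "killing ?v ?v = of_real (\<Sum>\<chi>\<in>weights. real (dimw \<chi>) * (rip \<chi> \<phi> - rip \<chi> \<psi>)\<^sup>2)"
    unfolding killing_self[OF v] of_real_sum
  proof (rule sum.cong)
    fix \<chi> assume \<chi>: "\<chi> \<in> weights"
    show "of_nat (dimw \<chi>) * \<chi> ?v * \<chi> ?v = of_real (real (dimw \<chi>) * (rip \<chi> \<phi> - rip \<chi> \<psi>)\<^sup>2)"
      unfolding \<chi>v[OF \<chi>] by (simp add: power2_eq_square)
  qed simp
  ultimately have "(\<Sum>\<chi>\<in>weights. real (dimw \<chi>) * (rip \<chi> \<phi> - rip \<chi> \<psi>)\<^sup>2) \<le> 0"
    using le by (simp only: of_real_eq_iff)
  then have "(\<Sum>\<chi>\<in>weights. real (dimw \<chi>) * (rip \<chi> \<phi> - rip \<chi> \<psi>)\<^sup>2) = 0"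
    by (intro antisym sum_nonneg) auto
  then have "\<forall>\<chi>\<in>weights. real (dimw \<chi>) * (rip \<chi> \<phi> - rip \<chi> \<psi>)\<^sup>2 = 0"
    by (subst (asm) sum_nonneg_eq_0_iff[OF finite_weights]) auto
  then have z: "\<chi> ?v = 0" if "\<chi> \<in> weights" for \<chi>
    using that dimw_pos[OF that] \<chi>v[OF that] by auto
  have "killing ?v h = 0" if "h \<in> H" for h unfolding killing_on_H[OF v that] using z
    by (intro sum.neutral) simp
  then have "?v = 0" using v by (rule killing_nondegenerate_H[rotated])
  then have "tv \<phi> = tv \<psi>" by simp
  then show ?thesis using killing_tv[OF \<phi>] killing_tv[OF \<psi>] by (intro root_eqI \<phi> \<psi>) metis
qed

text \<open>If \<open>w\<close> were nonzero, then \<open>f e\<^sup>n\<^sup>+\<^sup>1 w\<close> would be a nonzero multiple of \<open>e\<^sup>n w\<close> for all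
  \<open>n\<close>, which yields infinitely many weights.\<close>

lemma sl2_vanishing:
  assumes e: "e \<in> W \<alpha>" and f: "f \<in> W (- \<alpha>)"
    and \<alpha>: "\<alpha> \<in> supported_on H" "\<alpha> (bracket e f) = of_real a" "a > 0"
    and w: "w \<in> W \<psi>" "\<psi> \<in> supported_on H" "\<psi> (bracket e f) = of_real l" "l > 0"
    and efw: "bracket e (bracket f w) = 0"
  shows "w = 0"
proof (rule ccontr)
  assume "w \<noteq> 0"
  \<comment> \<open>The summand l + i a is the eigenvalue of [e, f] on the i-th iterate of
    \<open>w\<close> under \<open>e\<close>; \<open>c n\<close> accumulates them when
    \<open>f\<close> is moved past all n copies of \<open>e\<close>.\<close>
  define c where "c n = (\<Sum>i<n. l + real i * a)" for n
  define E where "E n = (bracket e ^^ n) w" for n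
  have E0: "E 0 = w" and ES: "E (Suc n) = bracket e (E n)" for n by (auto simp: E_def)
  have h: "bracket e f \<in> H" using bracket_weight_space[OF e f] weight_space_zero by simp
  have EW: "E n \<in> W (\<lambda>x. \<psi> x + of_nat n * \<alpha> x)" for n
  proof (induction n)
    case (Suc n)
    have "\<alpha> + (\<lambda>x. \<psi> x + of_nat n * \<alpha> x) = (\<lambda>x. \<psi> x + of_nat (Suc n) * \<alpha> x)"
      by (auto simp: algebra_simps)
    then show ?case using bracket_weight_space[OF e Suc.IH] by (simp add: ES)
  qed (use w E0 in simp)
  have hE: "bracket (bracket e f) (E n) = of_real (l + real n * a) *\<^sub>C E n" for n
    using EW[of n] h \<alpha>(2) w(3) by (simp add: weight_space_def)
  have fE: "bracket f (E (Suc n)) = - (of_real (c (Suc n)) *\<^sub>C E n)"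
    if "bracket e (bracket f (E n)) = - (of_real (c n) *\<^sub>C E n)" for n
  proof -
    have "bracket f (E (Suc n)) = bracket e (bracket f (E n)) - bracket (bracket e f) (E n)"
      by (simp add: ES bracket_bracket)
    then show ?thesis unfolding that hE by (simp add: c_def cvec.scale_left_distrib)
  qed
  have efE: "bracket e (bracket f (E n)) = - (of_real (c n) *\<^sub>C E n)" for n
  proof (induction n)
    case 0 then show ?case using efw by (simp add: E0 c_def)
  next
    case (Suc n)
    show ?case unfolding fE[OF Suc.IH] by (simp add: bracket_right.neg bracket_right.scale ES)
  qed
  have nz: "E n \<noteq> 0" for n
  proof (induction n)
    case 0 then show ?case using \<open>w \<noteq> 0\<close> E0 by simp
  next
    case (Suc n)
    have "c (Suc n) > 0" unfolding c_def using \<alpha>(3) w(4)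
      by (intro sum_pos) (auto intro: add_pos_nonneg)
    then have "bracket f (E (Suc n)) \<noteq> 0" using fE[OF efE] Suc.IH by simp
    then show ?case using bracket_right.zero by auto
  qed
  let ?S = "\<lambda>n x. \<psi> x + of_nat n * \<alpha> x"
  have sup: "?S n \<in> supported_on H" for n using \<alpha>(1) w(2) by (simp add: supported_on_def)
  have "?S n \<in> weights" for n
    using EW[of n] nz[of n] gen_weight_space_eq[OF sup] sup by (auto simp: weights_def)
  moreover have "inj ?S"
  proof (rule injI)
    fix m n assume "?S m = ?S n"
    from fun_cong[OF this, of "bracket e f"] show "m = n" using \<alpha>(2,3) by simp
  qed
  ultimately show False using finite_weights
    by (meson finite_subset image_subsetI infinite_iff_countable_subset)
qed

section \<open>Consequences of sl2 for root spaces\<close>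

lemma sl2_triple:
  assumes "\<alpha> \<in> roots H" "e \<in> W \<alpha>" "e \<noteq> 0"
  obtains f where "f \<in> W (- \<alpha>)" "bracket e f = tv \<alpha>"
  using weight_space_pairing[OF assms] bracket_opposite[OF assms(1,2)] by force

text \<open>With e and f scaled so that [e, f] is \<open>tv \<alpha>\<close>, the eigenvalues in the
  vanishing lemma are the inner products with \<alpha>. The companion for negative inner product
  exchanges e and f and replaces \<alpha> by its negative.\<close>

lemma sl2_ef_injective:
  assumes "\<alpha> \<in> roots H" "e \<in> W \<alpha>" "f \<in> W (- \<alpha>)" "bracket e f = tv \<alpha>"
    and "\<psi> \<in> weights" "w \<in> W \<psi>" "rip \<psi> \<alpha> > 0" "bracket e (bracket f w) = 0"
  shows "w = 0"
  using assms weights_supported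
  by (intro sl2_vanishing[of e \<alpha> f "rip \<alpha> \<alpha>" w \<psi>
    "rip \<psi> \<alpha>"]) (auto simp: root_tv rip_self root_supported root_weight)

lemma sl2_fe_injective:
  assumes "\<alpha> \<in> roots H" "e \<in> W \<alpha>" "f \<in> W (- \<alpha>)" "bracket e f = tv \<alpha>"
    and "\<psi> \<in> weights" "w \<in> W \<psi>" "rip \<psi> \<alpha> < 0" "bracket f (bracket e w) = 0"
  shows "w = 0"
proof (rule sl2_vanishing[of f "- \<alpha>" e "rip \<alpha> \<alpha>" w \<psi> "- rip \<psi> \<alpha>"])
  have *: "bracket f e = (- 1) *\<^sub>C tv \<alpha>" using bracket_antisym[of f e] assms(4) by simp
  show "(- \<alpha>) (bracket f e) = of_real (rip \<alpha> \<alpha>)" "\<psi> (bracket f e) = of_real (- rip \<psi> \<alpha>)"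
    using assms tv_in[OF assms(1)] unfolding * fun_Compl_def
    by (simp_all only: weight_scale root_weight root_tv) simp_all
qed (use assms weights_supported in \<open>auto simp: rip_self root_supported supported_on_minus\<close>)

text \<open>The map z \<mapsto> [e, [f, z]] is injective on the root space because the inner product
  of \<alpha> with itself is positive, hence also onto. But [f, z] lies in \<open>H\<close>, so the
  image lies in the line through \<open>e\<close>.\<close>

lemma root_space_one_dim:
  assumes \<alpha>: "\<alpha> \<in> roots H" and e: "e \<in> W \<alpha>" "e \<noteq> 0" and z: "z \<in> W \<alpha>"
  shows "\<exists>c. z = c *\<^sub>C e"
proof -
  obtain f where f: "f \<in> W (- \<alpha>)" "bracket e f = tv \<alpha>" using sl2_triple[OF \<alpha> e] by blast
  let ?F = "\<lambda>z. bracket e (bracket f z)" and ?W = "W \<alpha>"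
  interpret F: Vector_Spaces.linear scaleC scaleC ?F by (rule linear_bracket_comp[OF linear_bracket])
  interpret pair: finite_dimensional_vector_space_pair_1 scaleC Bas scaleC by unfold_locales
  have fz: "bracket f z \<in> H" if "z \<in> ?W" for z using bracket_weight_space[OF f(1) that] weight_space_zero
    by simp
  have Fz: "?F z = (- \<alpha> (bracket f z)) *\<^sub>C e" if "z \<in> ?W" for z
    using e(1) fz[OF that] bracket_antisym[of e "bracket f z"] by (simp add: weight_space_def)
  have inj: "inj_on ?F (cvec.span ?W)"
    using sl2_ef_injective[OF \<alpha> e(1) f root_weight[OF \<alpha>] _ rip_self[OF \<alpha>]] subspace_weight_space[of H \<alpha>]
    by (subst F.inj_on_iff_eq_0) (auto simp: cvec.span_eq_iff[THEN iffD2])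
  have "?F w \<in> ?W" if "w \<in> ?W" for w
    unfolding Fz[OF that] by (rule cvec.subspace_scale[OF subspace_weight_space e(1)])
  then have "?F ` ?W \<subseteq> ?W" by blast
  moreover have "cvec.dim (?F ` ?W) = cvec.dim ?W" using pair.dim_image_eq[OF F.linear_axioms inj] by simp
  ultimately have "?F ` ?W = ?W"
    using F.subspace_image[OF subspace_weight_space] subspace_weight_space
      by (intro fd.subspace_dim_equal) auto
  then obtain z' where "z' \<in> ?W" "z = ?F z'" using z by blast
  then show ?thesis using Fz by blast
qed

text \<open>Suppose x and y commute. If the inner product of \<psi> and \<phi> is negative,
  injectivity of fe fails at y. Otherwise that of \<phi> + \<psi> and \<phi> is positive, f carries
  a root vector of \<phi> + \<psi> to a multiple of y, and injectivity of ef fails there.\<close>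

lemma root_spaces_bracket_nonzero:
  assumes \<phi>: "\<phi> \<in> roots H" and \<psi>: "\<psi> \<in> roots H" and sum: "\<phi> + \<psi> \<in> roots H"
    and x: "x \<in> W \<phi>" "x \<noteq> 0" and y: "y \<in> W \<psi>" "y \<noteq> 0"
  shows "bracket x y \<noteq> 0"
proof
  assume xy: "bracket x y = 0"
  obtain f where f: "f \<in> W (- \<phi>)" "bracket x f = tv \<phi>" using sl2_triple[OF \<phi> x] by blast
  show False
  proof (cases "rip \<psi> \<phi> < 0")
    case True
    then show False using sl2_fe_injective[OF \<phi> x(1) f root_weight[OF \<psi>] y(1)] y(2) xy
      by (simp add: bracket_right.zero)
  next
    case False
    then have pos: "rip (\<phi> + \<psi>) \<phi> > 0" using rip_self[OF \<phi>] by (simp add: rip_def)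
    let ?w = "root_vec (\<phi> + \<psi>)"
    have "bracket f ?w \<in> W \<psi>" using bracket_weight_space[OF f(1) root_vec(1)[OF sum]] by simp
    then obtain c where "bracket f ?w = c *\<^sub>C y" using root_space_one_dim[OF \<psi> y] by blast
    then have "bracket x (bracket f ?w) = 0" using xy by (simp add: bracket_right.scale)
    then show False using sl2_ef_injective[OF \<phi> x(1) f root_weight[OF sum] root_vec(1)[OF sum] pos]
      root_vec(2)[OF sum] by simp
  qed
qed

text \<open>A positive inner product prevents f from killing the root vector of \<phi>, so the root
  space of \<phi> - \<alpha> is nonzero. For \<open>root_add\<close> the same holds with e and the
  opposite sign.\<close>

lemma root_diff:
  assumes \<phi>: "\<phi> \<in> roots H" and \<alpha>: "\<alpha> \<in> roots H" and "rip \<phi> \<alpha> > 0" "\<phi> \<noteq> \<alpha>"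
  shows "\<phi> - \<alpha> \<in> roots H"
proof -
  obtain f where f: "f \<in> W (- \<alpha>)" "bracket (root_vec \<alpha>) f = tv \<alpha>" using sl2_triple[OF \<alpha> root_vec[OF \<alpha>]]
    by blast
  have "bracket f (root_vec \<phi>) \<noteq> 0"
    using sl2_ef_injective[OF \<alpha> root_vec(1)[OF \<alpha>] f root_weight[OF \<phi>] root_vec(1)[OF \<phi>] assms(3)]
      root_vec(2)[OF \<phi>] bracket_right.zero by auto
  moreover have "bracket f (root_vec \<phi>) \<in> W (\<phi> - \<alpha>)" using bracket_weight_space[OF f(1) root_vec(1)[OF \<phi>]]
    by simp
  moreover have "\<phi> - \<alpha> \<in> supported_on H" using root_supported[OF \<phi>] root_supported[OF \<alpha>]
    by (simp add: supported_on_def)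
  ultimately show ?thesis using assms(4) by (intro rootI) auto
qed

lemma root_add:
  assumes \<phi>: "\<phi> \<in> roots H" and \<alpha>: "\<alpha> \<in> roots H" and "rip \<phi> \<alpha> < 0" "\<phi> \<noteq> - \<alpha>"
  shows "\<phi> + \<alpha> \<in> roots H"
proof -
  obtain f where f: "f \<in> W (- \<alpha>)" "bracket (root_vec \<alpha>) f = tv \<alpha>" using sl2_triple[OF \<alpha> root_vec[OF \<alpha>]]
    by blast
  have "bracket (root_vec \<alpha>) (root_vec \<phi>) \<noteq> 0"
    using sl2_fe_injective[OF \<alpha> root_vec(1)[OF \<alpha>] f root_weight[OF \<phi>] root_vec(1)[OF \<phi>] assms(3)]
      root_vec(2)[OF \<phi>] bracket_right.zero by auto
  moreover have "bracket (root_vec \<alpha>) (root_vec \<phi>) \<in> W (\<phi> + \<alpha>)"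
    using bracket_weight_space[OF root_vec(1)[OF \<alpha>] root_vec(1)[OF \<phi>]] by (simp add: add.commute)
  moreover have "\<phi> + \<alpha> \<noteq> 0" using assms(4) by (simp add: eq_neg_iff_add_eq_0)
  ultimately show ?thesis using supported_on_add[OF root_supported[OF \<phi>] root_supported[OF \<alpha>]]
    by (intro rootI) auto
qed

lemma weight_space_subset_if_mem:
  assumes "\<phi> \<in> roots H" "cvec.subspace V" "z \<in> W \<phi>" "z \<noteq> 0" "z \<in> V"
  shows "W \<phi> \<subseteq> V"
  using root_space_one_dim[OF assms(1,3,4)] cvec.subspace_scale[OF assms(2,5)] by blast

lemma weight_space_add_subset:
  assumes "\<phi> \<in> roots H" "\<psi> \<in> roots H" "\<phi> + \<psi> \<in> roots H" "cvec.subspace V"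
    and "\<And>x y. x \<in> W \<phi> \<Longrightarrow> y \<in> W \<psi> \<Longrightarrow> bracket x y \<in> V"
  shows "W (\<phi> + \<psi>) \<subseteq> V"
  using weight_space_subset_if_mem[OF assms(3,4) bracket_weight_space[OF root_vec(1)[OF assms(1)]
    root_vec(1)[OF assms(2)]]]
    root_spaces_bracket_nonzero[OF assms(1-3) root_vec[OF assms(1)] root_vec[OF assms(2)]] assms(5)
      root_vec(1)[OF assms(1)] root_vec(1)[OF assms(2)] by blast

section \<open>Root components of stable subspaces\<close>

lemma comp_in_stable_subspace:
  assumes "cvec.subspace V" "\<And>x z. x \<in> H \<Longrightarrow> z \<in> V \<Longrightarrow> bracket x z \<in> V" "z \<in> V" "\<phi> \<in> weights"
  shows "comp \<phi> z \<in> V"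
  using component_in_stable_subspace[OF assms(1,2) finite_weights weights_supported, of
    "\<lambda>\<phi>. comp \<phi> z" \<phi>] assms comp_in
  by (simp add: sum_comp)

lemma comp_in_weight_space: "\<phi> \<in> roots H \<Longrightarrow> comp \<phi> z \<in> W \<phi>"
  using comp_in gen_weight_space_eq root_supported by blast

text \<open>Stability under \<open>H\<close> puts the component in \<open>V\<close>; since root
  spaces are lines, one nonzero component brings the whole root space along.\<close>

lemma weight_space_in_stable_subspace:
  assumes "cvec.subspace V" "\<And>x z. x \<in> H \<Longrightarrow> z \<in> V \<Longrightarrow> bracket x z \<in> V" "z \<in> V" "\<phi> \<in> roots H" "comp \<phi> z \<noteq> 0"
  shows "W \<phi> \<subseteq> V"
  using weight_space_subset_if_mem[OF assms(4,1) comp_in_weight_space[OF assms(4)] assms(5)]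
    comp_in_stable_subspace[OF assms(1-3) root_weight[OF assms(4)]] by blast

lemma mem_subspace_if_comps:
  assumes "cvec.subspace V" "\<And>\<phi>. \<phi> \<in> roots H \<Longrightarrow> comp \<phi> z \<in> V" "comp 0 z \<in> V"
  shows "z \<in> V"
proof -
  have "(\<Sum>\<phi>\<in>weights. comp \<phi> z) \<in> V"
    using assms roots_eq by (intro cvec.subspace_sum) auto
  then show ?thesis by (simp add: sum_comp)
qed

lemma comp_root_same: "\<phi> \<in> roots H \<Longrightarrow> z \<in> W \<phi> \<Longrightarrow> comp \<phi> z = z"
  using comp_same[OF root_supported] gen_weight_space_eq[OF root_supported] by blast

lemma comp_root_other: "\<phi> \<in> roots H \<Longrightarrow> z \<in> W \<phi> \<Longrightarrow> \<psi> \<in> supported_on H \<Longrightarrow> \<psi> \<noteq> \<phi> \<Longrightarrow> comp \<psi> z = 0"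
  using comp_other[OF root_supported] gen_weight_space_eq[OF root_supported] by blast

end

section \<open>Simple roots\<close>

locale simple_cartan_base = simple_cartan H for H :: "'g::complex_lie_algebra set" +
  fixes P :: "('g \<Rightarrow> complex) set"
  assumes base: "simple_roots H P"
begin

lemma base_root: "\<alpha> \<in> P \<Longrightarrow> \<alpha> \<in> roots H"
  and finite_base: "finite P"
  and independent_base: "cfun.independent P"
  using base unfolding simple_roots_def by auto

lemma int_combination_unique:
  assumes "int_combination P m \<phi>" "int_combination P n \<phi>"
  shows "m = n"
proof
  fix \<alpha>
  show "m \<alpha> = n \<alpha>"
  proof (cases "\<alpha> \<in> P")
    case False then show ?thesis using assms by (simp add: int_combination_def)
  next
    case True
    let ?u = "\<lambda>\<alpha>. of_int (m \<alpha>) - of_int (n \<alpha>) :: complex"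
    have "(\<Sum>\<alpha>\<in>P. (\<lambda>x. ?u \<alpha> * \<alpha> x)) = 0"
    proof
      fix x
      have "(\<Sum>\<alpha>\<in>P. of_int (m \<alpha>) * \<alpha> x) = (\<Sum>\<alpha>\<in>P. of_int (n \<alpha>) * \<alpha> x)"
        using assms unfolding int_combination_def by metis
      moreover have "(\<Sum>\<alpha>\<in>A. (\<lambda>x. ?u \<alpha> * \<alpha> x)) x = (\<Sum>\<alpha>\<in>A. ?u \<alpha> * \<alpha> x)" for A
        by (induction A rule: infinite_finite_induct) simp_all
      ultimately show "(\<Sum>\<alpha>\<in>P. (\<lambda>x. ?u \<alpha> * \<alpha> x)) x = 0 x"
        by (simp add: left_diff_distrib sum_subtractf)
    qed
    from cfun.independentD[OF independent_base finite_base subset_refl this True] show ?thesis by simp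
  qed
qed

abbreviation c :: "('g \<Rightarrow> complex) \<Rightarrow> ('g \<Rightarrow> complex) \<Rightarrow> int" where
  "c \<equiv> root_coeff P"

lemma root_coeff_eq: "int_combination P n \<phi> \<Longrightarrow> c \<alpha> \<phi> = n \<alpha>"
  unfolding root_coeff_def using int_combination_unique by (metis (mono_tags, lifting) the_equality)

lemma root_expansion:
  assumes "\<phi> \<in> roots H"
  shows int_combination_root: "int_combination P (\<lambda>\<alpha>. c \<alpha> \<phi>) \<phi>"
    and root_sign: "(\<forall>\<alpha>\<in>P. c \<alpha> \<phi> \<ge> 0) \<or> (\<forall>\<alpha>\<in>P. c \<alpha> \<phi> \<le> 0)"
proof -
  obtain n where n: "int_combination P n \<phi>" "(\<forall>\<alpha>\<in>P. n \<alpha> \<ge> 0) \<or> (\<forall>\<alpha>\<in>P. n \<alpha> \<le> 0)"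
    using base assms unfolding simple_roots_def by blast
  have "(\<lambda>\<alpha>. c \<alpha> \<phi>) = n" using root_coeff_eq[OF n(1)] by auto
  then show "int_combination P (\<lambda>\<alpha>. c \<alpha> \<phi>) \<phi>" "(\<forall>\<alpha>\<in>P. c \<alpha> \<phi> \<ge> 0) \<or> (\<forall>\<alpha>\<in>P. c \<alpha> \<phi> \<le> 0)"
    using n root_coeff_eq[OF n(1)] by auto
qed

lemma root_sum: "\<phi> \<in> roots H \<Longrightarrow> \<phi> x = (\<Sum>\<alpha>\<in>P. of_int (c \<alpha> \<phi>) * \<alpha> x)"
  using int_combination_root by (simp add: int_combination_def)

lemma coeff_add:
  assumes "\<phi> \<in> roots H" "\<psi> \<in> roots H"
  shows "c \<alpha> (\<phi> + \<psi>) = c \<alpha> \<phi> + c \<alpha> \<psi>"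
  using int_combination_root[OF assms(1)] int_combination_root[OF assms(2)]
  by (intro root_coeff_eq[of "\<lambda>\<alpha>. c \<alpha> \<phi> + c \<alpha> \<psi>"]) (simp add: int_combination_def ring_distribs sum.distrib)

lemma coeff_diff:
  assumes "\<phi> \<in> roots H" "\<psi> \<in> roots H"
  shows "c \<alpha> (\<phi> - \<psi>) = c \<alpha> \<phi> - c \<alpha> \<psi>"
  using int_combination_root[OF assms(1)] int_combination_root[OF assms(2)]
  by (intro root_coeff_eq[of
    "\<lambda>\<alpha>. c \<alpha> \<phi> - c \<alpha> \<psi>"]) (simp add: int_combination_def left_diff_distrib sum_subtractf)

lemma coeff_minus:
  assumes "\<phi> \<in> roots H" shows "c \<alpha> (- \<phi>) = - c \<alpha> \<phi>"
  using int_combination_root[OF assms]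
  by (intro root_coeff_eq[of "\<lambda>\<alpha>. - c \<alpha> \<phi>"]) (simp add: int_combination_def sum_negf)

lemma coeff_base: "\<beta> \<in> P \<Longrightarrow> c \<alpha> \<beta> = (if \<alpha> = \<beta> then 1 else 0)"
proof (rule root_coeff_eq)
  assume \<beta>: "\<beta> \<in> P"
  have "of_int (if \<alpha> = \<beta> then 1 else 0) * \<alpha> x = (if \<alpha> = \<beta> then \<beta> x else 0)" for \<alpha> :: "'g \<Rightarrow> complex" and x
    by simp
  then have "(\<Sum>\<alpha>\<in>P. of_int (if \<alpha> = \<beta> then 1 else 0) * \<alpha> x) = \<beta> x" for x
    using \<beta> finite_base by (simp only: sum.delta if_True)
  then show "int_combination P (\<lambda>\<alpha>. if \<alpha> = \<beta> then 1 else 0) \<beta>" using \<beta> by (auto simp: int_combination_def)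
qed

lemma root_coeff_eqI:
  assumes "\<phi> \<in> roots H" "\<psi> \<in> roots H" "\<And>\<alpha>. \<alpha> \<in> P \<Longrightarrow> c \<alpha> \<phi> = c \<alpha> \<psi>" shows "\<phi> = \<psi>"
  using root_sum[OF assms(1)] root_sum[OF assms(2)] assms(3)
    by (intro ext) (metis (no_types, lifting) sum.cong)

lemma rip_sum: "\<phi> \<in> roots H \<Longrightarrow> \<psi> \<in> roots H \<Longrightarrow> rip \<phi> \<psi> = (\<Sum>\<alpha>\<in>P. of_int (c \<alpha> \<phi>) * rip \<psi> \<alpha>)"
proof -
  assume \<phi>: "\<phi> \<in> roots H" and \<psi>: "\<psi> \<in> roots H"
  have "rip \<phi> \<psi> = (\<Sum>\<alpha>\<in>P. of_int (c \<alpha> \<phi>) * rip \<alpha> \<psi>)"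
    unfolding rip_def root_sum[OF \<phi>, of "tv \<psi>"] by simp
  also have "\<dots> = (\<Sum>\<alpha>\<in>P. of_int (c \<alpha> \<phi>) * rip \<psi> \<alpha>)"
    by (intro sum.cong refl) (simp add: rip_sym[OF base_root \<psi>])
  finally show ?thesis .
qed

section \<open>Positive roots, heights and steps along simple roots\<close>

definition positive :: "('g \<Rightarrow> complex) \<Rightarrow> bool" where
  "positive \<phi> \<longleftrightarrow> \<phi> \<in> roots H \<and> (\<forall>\<alpha>\<in>P. c \<alpha> \<phi> \<ge> 0)"

definition ht :: "('g \<Rightarrow> complex) \<Rightarrow> int" where
  "ht \<phi> = (\<Sum>\<alpha>\<in>P. c \<alpha> \<phi>)"

lemma positive_roots_eq: "positive_roots H P = {\<phi>. positive \<phi>}"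
  by (auto simp: positive_roots_def positive_def)

lemma positive_root: "positive \<phi> \<Longrightarrow> \<phi> \<in> roots H"
  by (simp add: positive_def)

lemma root_coeff_nonzero: "\<phi> \<in> roots H \<Longrightarrow> \<exists>\<alpha>\<in>P. c \<alpha> \<phi> \<noteq> 0"
  using root_sum[of \<phi>] root_nonzero by (fastforce simp: fun_eq_iff)

lemma positive_if_coeff_pos: "\<phi> \<in> roots H \<Longrightarrow> \<alpha> \<in> P \<Longrightarrow> c \<alpha> \<phi> > 0 \<Longrightarrow> positive \<phi>"
  using root_sign[of \<phi>] by (force simp: positive_def)

lemma positive_or_uminus_positive: "\<phi> \<in> roots H \<Longrightarrow> positive \<phi> \<or> positive (- \<phi>)"
  using root_sign[of \<phi>] by (auto simp: positive_def root_uminus coeff_minus)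

lemma base_positive: "\<alpha> \<in> P \<Longrightarrow> positive \<alpha>"
  by (simp add: positive_def base_root coeff_base)

lemma positive_ht: "positive \<phi> \<Longrightarrow> ht \<phi> > 0"
  unfolding ht_def using root_coeff_nonzero[of \<phi>] finite_base
  by (force simp: positive_def order_le_less intro!: sum_pos2)

lemma ht_diff_base: "\<phi> \<in> roots H \<Longrightarrow> \<alpha> \<in> P \<Longrightarrow> ht (\<phi> - \<alpha>) = ht \<phi> - 1"
  unfolding ht_def using finite_base by (simp add: coeff_diff base_root coeff_base sum_subtractf)

lemma ht_add_base: "\<phi> \<in> roots H \<Longrightarrow> \<alpha> \<in> P \<Longrightarrow> ht (\<phi> + \<alpha>) = ht \<phi> + 1"
  unfolding ht_def using finite_base by (simp add: coeff_add base_root coeff_base sum.distrib)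

text \<open>The positive squared length of \<phi> is the sum of its inner products with the simple
  roots, weighted by nonnegative coefficients, so one term is positive.\<close>

lemma positive_pairing:
  assumes "positive \<phi>" shows "\<exists>\<alpha>\<in>P. c \<alpha> \<phi> > 0 \<and> rip \<phi> \<alpha> > 0"
proof (rule ccontr)
  assume no: "\<not> ?thesis"
  have "rip \<phi> \<phi> = (\<Sum>\<alpha>\<in>P. of_int (c \<alpha> \<phi>) * rip \<phi> \<alpha>)" using assms positive_root by (intro rip_sum)
  also have "\<dots> \<le> 0"
  proof (intro sum_nonpos)
    fix \<alpha> assume "\<alpha> \<in> P"
    then show "of_int (c \<alpha> \<phi>) * rip \<phi> \<alpha> \<le> 0"
      using no assms by (cases "c \<alpha> \<phi> = 0") (force simp: positive_def intro: mult_nonneg_nonpos)+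
  qed
  finally show False using rip_self[OF positive_root[OF assms]] by simp
qed

text \<open>If the difference were negative, \<phi> could have no coefficient beyond a single 1 at
  \<alpha>, so \<phi> = \<alpha> and the difference would be 0.\<close>

lemma positive_diff_base:
  assumes "positive \<phi>" "\<alpha> \<in> P" "\<phi> - \<alpha> \<in> roots H" shows "positive (\<phi> - \<alpha>)"
proof (rule ccontr)
  assume no: "\<not> positive (\<phi> - \<alpha>)"
  have \<phi>: "\<phi> \<in> roots H" and \<alpha>: "\<alpha> \<in> roots H" using assms positive_root base_root by auto
  have "c \<beta> (\<phi> - \<alpha>) \<le> 0" if "\<beta> \<in> P" for \<beta>
    using no positive_if_coeff_pos[OF assms(3) that] by force
  then have le: "c \<beta> \<phi> \<le> (if \<beta> = \<alpha> then 1 else 0)" if "\<beta> \<in> P" for \<beta>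
    using that coeff_diff[OF \<phi> \<alpha>, of \<beta>] coeff_base[OF assms(2), of \<beta>] by force
  have "c \<alpha> \<phi> \<noteq> 0"
  proof
    assume "c \<alpha> \<phi> = 0"
    then have "c \<beta> \<phi> = 0" if "\<beta> \<in> P" for \<beta> using le[OF that] assms(1) that
      by (cases "\<beta> = \<alpha>") (auto simp: positive_def)
    then show False using root_coeff_nonzero[OF \<phi>] by blast
  qed
  then have "c \<beta> \<phi> = c \<beta> \<alpha>" if "\<beta> \<in> P" for \<beta>
    using le[OF that] assms(1,2) that coeff_base[OF assms(2), of \<beta>]
      by (cases "\<beta> = \<alpha>") (force simp: positive_def)+
  then have "\<phi> = \<alpha>" by (intro root_coeff_eqI \<phi> \<alpha>)
  then show False using root_nonzero[OF assms(3)] by simp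
qed

lemma positive_decompose:
  assumes "positive \<phi>"
  shows "\<phi> \<in> P \<or> (\<exists>\<alpha>\<in>P. c \<alpha> \<phi> > 0 \<and> positive (\<phi> - \<alpha>))"
  using positive_pairing[OF assms] root_diff[OF positive_root[OF assms] base_root] positive_diff_base[OF
    assms] by blast

text \<open>Descent on the height: a positive root that is not simple remains positive after
  subtraction of a suitable simple root.\<close>

lemma positive_induct [consumes 1, case_names base step]:
  assumes "positive \<phi>" and base: "\<And>\<alpha>. \<alpha> \<in> P \<Longrightarrow> R \<alpha>"
    and step: "\<And>\<phi> \<alpha>. positive \<phi> \<Longrightarrow> \<alpha> \<in> P \<Longrightarrow> positive (\<phi> + \<alpha>) \<Longrightarrow> R \<phi> \<Longrightarrow> R (\<phi> + \<alpha>)"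
  shows "R \<phi>"
  using assms(1)
proof (induction "nat (ht \<phi>)" arbitrary: \<phi> rule: less_induct)
  case less
  show ?case
  proof (cases "\<phi> \<in> P")
    case False
    then obtain \<alpha> where \<alpha>: "\<alpha> \<in> P" "positive (\<phi> - \<alpha>)" using positive_decompose[OF less.prems] by blast
    have "nat (ht (\<phi> - \<alpha>)) < nat (ht \<phi>)"
      using ht_diff_base[OF positive_root[OF less.prems] \<alpha>(1)] positive_ht[OF less.prems] by simp
    then have "R (\<phi> - \<alpha>)" using less.hyps \<alpha> by blast
    then show ?thesis using step[OF \<alpha>(2,1)] less.prems by simp
  qed (rule base)
qed

text \<open>Two roots with the same nonzero coefficients outside \<open>A\<close> are joined by steps \<open>\<plusminus>\<alpha>\<close>, \<open>\<alpha> \<in> A\<close>: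
  if no step brings them closer together, then \<open>(\<phi> - \<psi>, \<phi> - \<psi>) \<le> 0\<close>.\<close>

lemma closed_under_steps:
  assumes A: "A \<subseteq> P" and "\<phi> \<in> roots H" "\<psi> \<in> roots H"
    and eq: "\<And>\<beta>. \<beta> \<in> P - A \<Longrightarrow> c \<beta> \<phi> = c \<beta> \<psi>" and ne: "\<gamma> \<in> P - A" "c \<gamma> \<phi> \<noteq> 0"
    and step: "\<And>\<chi> \<alpha>. \<chi> \<in> roots H \<Longrightarrow> \<alpha> \<in> A \<Longrightarrow> \<chi> + \<alpha> \<in> roots H \<Longrightarrow>
        (\<And>\<beta>. \<beta> \<in> P - A \<Longrightarrow> c \<beta> \<chi> = c \<beta> \<phi>) \<Longrightarrow> R \<chi> \<longleftrightarrow> R (\<chi> + \<alpha>)"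
  shows "R \<phi> \<longleftrightarrow> R \<psi>"
proof -
  define C where "C = {\<chi> \<in> roots H. \<forall>\<beta>\<in>P - A. c \<beta> \<chi> = c \<beta> \<phi>}"
  have Cr: "\<chi> \<in> roots H" if "\<chi> \<in> C" for \<chi> using that by (simp add: C_def)
  have A_root: "\<alpha> \<in> roots H" "\<alpha> \<in> P" if "\<alpha> \<in> A" for \<alpha> using that A base_root by auto
  have cA: "c \<beta> \<alpha> = 0" if "\<beta> \<in> P - A" "\<alpha> \<in> A" for \<alpha> \<beta>
    using that A coeff_base[of \<alpha> \<beta>] by auto
  \<comment> \<open>The nonzero coefficient at \<gamma> outside \<open>A\<close> is shared by all of
    \<open>C\<close>. It keeps sums and differences with roots from \<open>A\<close> away from 0, so
    the inner product criteria apply.\<close>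
  have notA: "\<chi> \<noteq> \<alpha>" "\<chi> \<noteq> - \<alpha>" if "\<chi> \<in> C" "\<alpha> \<in> A" for \<chi> \<alpha>
    using that ne cA[OF ne(1) that(2)] coeff_minus[OF A_root(1)[OF that(2)], of \<gamma>] by (auto simp: C_def)
  have down: "\<chi> - \<alpha> \<in> C \<and> (R \<chi> \<longleftrightarrow> R (\<chi> - \<alpha>))" if "\<chi> \<in> C" "\<alpha> \<in> A" "rip \<chi> \<alpha> > 0" for \<chi> \<alpha>
  proof -
    have r: "\<chi> - \<alpha> \<in> roots H" using that notA A_root Cr by (intro root_diff) auto
    then have C: "\<chi> - \<alpha> \<in> C"
      using that(1) coeff_diff[OF Cr[OF that(1)] A_root(1)[OF that(2)]] cA[OF _ that(2)]
      by (auto simp: C_def)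
    then have "R (\<chi> - \<alpha>) \<longleftrightarrow> R (\<chi> - \<alpha> + \<alpha>)"
      using that Cr[OF that(1)] by (intro step) (auto simp: C_def)
    then show ?thesis using C by simp
  qed
  have up: "\<chi> + \<alpha> \<in> C \<and> (R \<chi> \<longleftrightarrow> R (\<chi> + \<alpha>))" if "\<chi> \<in> C" "\<alpha> \<in> A" "rip \<chi> \<alpha> < 0" for \<chi> \<alpha>
  proof -
    have r: "\<chi> + \<alpha> \<in> roots H" using that notA A_root Cr by (intro root_add) auto
    then have C: "\<chi> + \<alpha> \<in> C"
      using that(1) coeff_add[OF Cr[OF that(1)] A_root(1)[OF that(2)]] cA[OF _ that(2)]
      by (auto simp: C_def)
    then show ?thesis using that step[of \<chi> \<alpha>] r by (auto simp: C_def)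
  qed
  have finA: "finite A" using A finite_base finite_subset by blast
  \<comment> \<open>The l1 distance of the coefficients on \<open>A\<close>, the measure of the
    descent.\<close>
  define D where "D \<chi> \<eta> = (\<Sum>\<alpha>\<in>A. \<bar>c \<alpha> \<chi> - c \<alpha> \<eta>\<bar>)" for \<chi> \<eta>
  have Ddown: "D (\<chi> - \<alpha>) \<eta> < D \<chi> \<eta>" if "\<chi> \<in> roots H" "\<alpha> \<in> A" "c \<alpha> \<chi> > c \<alpha> \<eta>" for \<chi> \<alpha> \<eta>
    unfolding D_def using finA that A_root[OF that(2)]
    by (intro sum_strict_mono_ex1) (auto simp: coeff_diff coeff_base)
  have Dup: "D (\<chi> + \<alpha>) \<eta> < D \<chi> \<eta>" if "\<chi> \<in> roots H" "\<alpha> \<in> A" "c \<alpha> \<chi> < c \<alpha> \<eta>" for \<chi> \<alpha> \<eta>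
    unfolding D_def using finA that A_root[OF that(2)]
    by (intro sum_strict_mono_ex1) (auto simp: coeff_add coeff_base)
  have Dsym: "D \<chi> \<eta> = D \<eta> \<chi>" for \<chi> \<eta> unfolding D_def by (intro sum.cong) auto
  have Dnn: "D \<chi> \<eta> \<ge> 0" for \<chi> \<eta> unfolding D_def by (intro sum_nonneg) auto
  have "R \<chi> \<longleftrightarrow> R \<eta>" if "\<chi> \<in> C" "\<eta> \<in> C" for \<chi> \<eta>
    using that
  proof (induction "nat (D \<chi> \<eta>)" arbitrary: \<chi> \<eta> rule: less_induct)
    case less
    note C = less.prems
    have IH: "R \<chi>' \<longleftrightarrow> R \<eta>'" if "\<chi>' \<in> C" "\<eta>' \<in> C" "D \<chi>' \<eta>' < D \<chi> \<eta>" for \<chi>' \<eta>'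
      using that Dnn[of \<chi>' \<eta>'] by (intro less.hyps) auto
    have move: "\<exists>\<chi>'\<in>C. (R \<chi> \<longleftrightarrow> R \<chi>') \<and> D \<chi>' \<eta> < D \<chi> \<eta>"
      if "\<chi> \<in> C" "\<alpha> \<in> A" "of_int (c \<alpha> \<chi> - c \<alpha> \<eta>) * rip \<chi> \<alpha> > 0" for \<chi> \<alpha> \<eta>
    proof (cases "rip \<chi> \<alpha> > 0")
      case True
      then have "c \<alpha> \<chi> > c \<alpha> \<eta>" using that(3) by (simp add: zero_less_mult_iff)
      then show ?thesis using down[OF that(1,2) True] Ddown[OF Cr[OF that(1)] that(2)] by blast
    next
      case False
      then have "rip \<chi> \<alpha> < 0" "c \<alpha> \<chi> < c \<alpha> \<eta>" using that(3) by (simp_all add: zero_less_mult_iff)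
      then show ?thesis using up[OF that(1,2)] Dup[OF Cr[OF that(1)] that(2)] by blast
    qed
    show ?case
    proof (cases "\<exists>\<alpha>\<in>A. of_int (c \<alpha> \<chi> - c \<alpha> \<eta>) * rip \<chi> \<alpha> > 0 \<or> of_int (c \<alpha> \<eta> - c \<alpha> \<chi>) * rip \<eta> \<alpha> > 0")
      case True
      then obtain \<alpha> where \<alpha>: "\<alpha> \<in> A"
        "of_int (c \<alpha> \<chi> - c \<alpha> \<eta>) * rip \<chi> \<alpha> > 0 \<or> of_int (c \<alpha> \<eta> - c \<alpha> \<chi>) * rip \<eta> \<alpha> > 0" by blast
      from \<alpha>(2) show ?thesis
      proof
        assume "of_int (c \<alpha> \<chi> - c \<alpha> \<eta>) * rip \<chi> \<alpha> > 0"
        from move[OF C(1) \<alpha>(1) this] show ?thesis using IH[OF _ C(2)] by blast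
      next
        assume "of_int (c \<alpha> \<eta> - c \<alpha> \<chi>) * rip \<eta> \<alpha> > 0"
        from move[OF C(2) \<alpha>(1) this] obtain \<eta>' where "\<eta>' \<in> C" "R \<eta> \<longleftrightarrow> R \<eta>'" "D \<eta>' \<chi> < D \<eta> \<chi>" by blast
        then show ?thesis using IH[OF C(1), of \<eta>'] Dsym by simp
      qed
    next
      case False
      have r: "\<chi> \<in> roots H" "\<eta> \<in> roots H" using C Cr by auto
      have cC: "c \<beta> \<chi> = c \<beta> \<eta>" if "\<beta> \<in> P - A" for \<beta> using that C by (auto simp: C_def)
      have le: "(\<Sum>\<alpha>\<in>P. of_int (c \<alpha> \<zeta> - c \<alpha> \<xi>) * rip \<zeta> \<alpha>) \<le> 0"
        if "\<forall>\<alpha>\<in>A. \<not> of_int (c \<alpha> \<zeta> - c \<alpha> \<xi>) * rip \<zeta> \<alpha> > 0" "\<forall>\<beta>\<in>P - A. c \<beta> \<zeta> = c \<beta> \<xi>" for \<zeta> \<xi>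
      proof (intro sum_nonpos)
        fix \<alpha> assume "\<alpha> \<in> P"
        then show "of_int (c \<alpha> \<zeta> - c \<alpha> \<xi>) * rip \<zeta> \<alpha> \<le> 0" using that by (cases "\<alpha> \<in> A") (auto simp: not_less)
      qed
      \<comment> \<open>The two expansions add up to the squared length of \<chi> - \<eta>. Terms
        outside \<open>A\<close> vanish, and those in \<open>A\<close> are nonpositive because no
        step shortens the distance.\<close>
      have "rip \<chi> \<chi> - rip \<eta> \<chi> = (\<Sum>\<alpha>\<in>P. of_int (c \<alpha> \<chi> - c \<alpha> \<eta>) * rip \<chi> \<alpha>)"
        "rip \<eta> \<eta> - rip \<chi> \<eta> = (\<Sum>\<alpha>\<in>P. of_int (c \<alpha> \<eta> - c \<alpha> \<chi>) * rip \<eta> \<alpha>)"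
        unfolding rip_sum[OF r(1) r(1)] rip_sum[OF r(2) r(1)] rip_sum[OF r(2) r(2)] rip_sum[OF r(1) r(2)]
        by (simp_all add: left_diff_distrib sum_subtractf)
      then have "rip \<chi> \<chi> - rip \<eta> \<chi> \<le> 0" "rip \<eta> \<eta> - rip \<chi> \<eta> \<le> 0"
        using le[of \<chi> \<eta>] le[of \<eta> \<chi>] False cC by auto
      then have "\<chi> = \<eta>" by (intro rip_definite r) simp
      then show ?thesis by simp
    qed
  qed
  moreover have "\<phi> \<in> C" "\<psi> \<in> C" using assms by (auto simp: C_def)
  ultimately show ?thesis by blast
qed

text \<open>Induction on \<open>A\<close>: independence of the base supplies y in \<open>H\<close>
  killed by the old roots but not by the new one. Scaling y serves the new root, and subtracting
  multiples of y corrects the old dual vectors.\<close>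

lemma dual_vectors_exist:
  assumes "A \<subseteq> P" shows "\<forall>\<alpha>\<in>A. \<exists>x\<in>H. \<forall>\<beta>\<in>A. \<beta> x = (if \<beta> = \<alpha> then 1 else 0)"
proof -
  have "finite A" using assms finite_base finite_subset by blast
  then show ?thesis using assms
  proof (induction A rule: finite_induct)
    case (insert \<alpha> A)
    have add: "\<beta> (x + y) = \<beta> x + \<beta> y" and scale: "\<beta> (a *\<^sub>C x) = a * \<beta> x"
      if "\<beta> \<in> P" "x \<in> H" "y \<in> H" for \<beta> x y a
      using that root_weight[OF base_root] weight_add weight_scale by auto
    have "\<forall>\<beta>\<in>A. \<exists>x. x \<in> H \<and> (\<forall>\<gamma>\<in>A. \<gamma> x = (if \<gamma> = \<beta> then 1 else 0))"
      using insert by (simp add: Bex_def)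
    from bchoice[OF this] obtain X where X: "\<And>\<beta>. \<beta> \<in> A \<Longrightarrow> X \<beta> \<in> H"
      "\<And>\<beta> \<gamma>. \<beta> \<in> A \<Longrightarrow> \<gamma> \<in> A \<Longrightarrow> \<gamma> (X \<beta>) = (if \<gamma> = \<beta> then 1 else 0)" by metis
    have "\<exists>y\<in>H. (\<forall>\<beta>\<in>A. \<beta> y = 0) \<and> \<alpha> y \<noteq> 0"
    proof (rule ccontr)
      assume no: "\<not> ?thesis"
      have sumH: "(\<Sum>\<beta>\<in>B. a \<beta> *\<^sub>C X \<beta>) \<in> H \<and> (\<forall>\<gamma>\<in>insert \<alpha> A. \<gamma> (\<Sum>\<beta>\<in>B. a \<beta> *\<^sub>C X \<beta>) = (\<Sum>\<beta>\<in>B. a \<beta> * \<gamma> (X \<beta>)))"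
        if "finite B" "B \<subseteq> A" for a B
        using that
      proof (induction B rule: finite_induct)
        case empty
        then show ?case using cvec.subspace_0[OF subspace_H] weight_zero[OF root_weight[OF base_root]]
          insert.prems by auto
      next
        case (insert \<beta> B)
        then have XH: "X \<beta> \<in> H" "a \<beta> *\<^sub>C X \<beta> \<in> H" using X(1) cvec.subspace_scale[OF subspace_H] by auto
        show ?case using insert XH \<open>insert \<alpha> A \<subseteq> P\<close> cvec.subspace_add[OF subspace_H]
          by (auto simp: add scale subset_iff)
      qed
      have expansion: "\<alpha> h = (\<Sum>\<beta>\<in>A. \<alpha> (X \<beta>) * \<beta> h)" for h
      proof (cases "h \<in> H")
        case False
        then have "\<beta> h = 0" if "\<beta> \<in> P" for \<beta> using root_supported[OF base_root[OF that]]
          by (simp add: supported_on_def)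
        moreover from this have "(\<Sum>\<beta>\<in>A. \<alpha> (X \<beta>) * \<beta> h) = 0" using insert.prems by (intro sum.neutral) auto
        ultimately show ?thesis using insert.prems by simp
      next
        case True
        \<comment> \<open>Adding \<open>?s\<close> removes the coordinates of \<open>h\<close> at
          the roots in \<open>A\<close>. If \<alpha> vanished on all vectors killed by
          \<open>A\<close>, it would be a combination of the roots in \<open>A\<close>.\<close>
        let ?s = "\<Sum>\<beta>\<in>A. (- \<beta> h) *\<^sub>C X \<beta>"
        note s = sumH[OF insert.hyps(1) subset_refl, of "\<lambda>\<beta>. - \<beta> h"]
        have hs: "h + ?s \<in> H" using True s cvec.subspace_add[OF subspace_H] by blast
        have ev: "\<gamma> (h + ?s) = \<gamma> h + (\<Sum>\<beta>\<in>A. - \<beta> h * \<gamma> (X \<beta>))" if "\<gamma> \<in> insert \<alpha> A" for \<gamma>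
        proof -
          have "\<gamma> \<in> P" using that insert.prems by blast
          then have "\<gamma> (h + ?s) = \<gamma> h + \<gamma> ?s" by (rule add[OF _ True s[THEN conjunct1]])
          also have "\<gamma> ?s = (\<Sum>\<beta>\<in>A. - \<beta> h * \<gamma> (X \<beta>))" by (rule bspec[OF s[THEN conjunct2] that])
          finally show ?thesis .
        qed
        have "\<gamma> (h + ?s) = 0" if "\<gamma> \<in> A" for \<gamma>
        proof -
          have "(\<Sum>\<beta>\<in>A. - \<beta> h * \<gamma> (X \<beta>)) = (\<Sum>\<beta>\<in>A. if \<gamma> = \<beta> then - \<gamma> h else 0)"
          proof (rule sum.cong)
            fix \<beta> assume "\<beta> \<in> A"
            then show "- \<beta> h * \<gamma> (X \<beta>) = (if \<gamma> = \<beta> then - \<gamma> h else 0)"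
              unfolding X(2)[OF \<open>\<beta> \<in> A\<close> that] by simp
          qed simp
          then show ?thesis using ev[of \<gamma>] that insert.hyps(1) by simp
        qed
        then have "\<alpha> (h + ?s) = 0" using no hs by blast
        then show ?thesis using ev[of \<alpha>] by (simp add: sum_negf mult.commute)
      qed
      have sum_apply: "(\<Sum>\<beta>\<in>B. (\<lambda>x. a \<beta> * \<beta> x)) x = (\<Sum>\<beta>\<in>B. a \<beta> * \<beta> x)" for a and B ::
        "('g \<Rightarrow> complex) set" and x
        by (induction B rule: infinite_finite_induct) simp_all
      have "\<alpha> = (\<Sum>\<beta>\<in>A. (\<lambda>x. \<alpha> (X \<beta>) * \<beta> x))"
        by (rule ext, rule trans[OF expansion sum_apply[symmetric]])
      moreover have "(\<Sum>\<beta>\<in>A. (\<lambda>x. \<alpha> (X \<beta>) * \<beta> x)) \<in> cfun.span A"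
        by (intro cfun.span_sum cfun.span_scale cfun.span_base)
      ultimately have "\<alpha> \<in> cfun.span (insert \<alpha> A - {\<alpha>})" using insert.hyps(2) by simp
      then have "cfun.dependent (insert \<alpha> A)" unfolding cfun.dependent_def by blast
      then show False using cfun.independent_mono[OF independent_base insert.prems] by blast
    qed
    then obtain y where y: "y \<in> H" "\<And>\<beta>. \<beta> \<in> A \<Longrightarrow> \<beta> y = 0" "\<alpha> y \<noteq> 0" by blast
    show ?case
    proof
      fix \<beta> assume \<beta>: "\<beta> \<in> insert \<alpha> A"
      show "\<exists>x\<in>H. \<forall>\<gamma>\<in>insert \<alpha> A. \<gamma> x = (if \<gamma> = \<beta> then 1 else 0)"
      proof (cases "\<beta> = \<alpha>")
        case True
        then show ?thesis using y insert.prems insert.hyps(2) cvec.subspace_scale[OF subspace_H y(1), of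
          "1 / \<alpha> y"]
          by (intro bexI[of _ "(1 / \<alpha> y) *\<^sub>C y"]) (auto simp: scale)
      next
        case False
        \<comment> \<open>The multiple of \<open>y\<close> is chosen so that \<alpha> vanishes;
          values at the roots in \<open>A\<close> do not change.\<close>
        let ?x = "X \<beta> + (- \<alpha> (X \<beta>) / \<alpha> y) *\<^sub>C y"
        have \<beta>A: "\<beta> \<in> A" using False \<beta> by simp
        have yH: "(- \<alpha> (X \<beta>) / \<alpha> y) *\<^sub>C y \<in> H" using cvec.subspace_scale[OF subspace_H y(1)] .
        have "\<gamma> ?x = \<gamma> (X \<beta>) + (- \<alpha> (X \<beta>) / \<alpha> y) * \<gamma> y" if "\<gamma> \<in> insert \<alpha> A" for \<gamma>
        proof -
          have "\<gamma> \<in> P" using that insert.prems by blast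
          then have "\<gamma> ?x = \<gamma> (X \<beta>) + \<gamma> ((- \<alpha> (X \<beta>) / \<alpha> y) *\<^sub>C y)" by (rule add[OF _ X(1)[OF \<beta>A] yH])
          also have "\<gamma> ((- \<alpha> (X \<beta>) / \<alpha> y) *\<^sub>C y) = (- \<alpha> (X \<beta>) / \<alpha> y) * \<gamma> y"
            by (rule scale[OF \<open>\<gamma> \<in> P\<close> y(1) y(1)])
          finally show ?thesis .
        qed
        note ev = this
        have "\<gamma> ?x = (if \<gamma> = \<beta> then 1 else 0)" if "\<gamma> \<in> insert \<alpha> A" for \<gamma>
        proof (cases "\<gamma> = \<alpha>")
          case True
          then show ?thesis using ev[OF that] y(3) False by simp
        next
          case False
          then have "\<gamma> \<in> A" using that by simp
          then show ?thesis using ev[OF that] X(2)[OF \<beta>A] y(2) by simp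
        qed
        then show ?thesis using cvec.subspace_add[OF subspace_H X(1)[OF \<beta>A] yH] by blast
      qed
    qed
  qed simp
qed

end

section \<open>Parabolic subalgebras\<close>

lemma bracket_span_mem:
  assumes "cvec.subspace V" "\<And>x y. x \<in> A \<Longrightarrow> y \<in> B \<Longrightarrow> bracket x y \<in> V" "x \<in> cvec.span A" "y \<in> cvec.span B"
  shows "bracket x y \<in> V"
proof -
  have 1: "bracket x y \<in> V" if "x \<in> A" "y \<in> cvec.span B" for x y
  proof -
    have "cvec.subspace {y. bracket x y \<in> V}" by (rule bracket_right.subspace_linear_preimage[OF assms(1)])
    then have "cvec.span B \<subseteq> {y. bracket x y \<in> V}" using assms(2) that by (intro cvec.span_minimal) auto
    then show ?thesis using that by blast
  qed
  have "cvec.subspace {x. bracket x y \<in> V}" by (rule bracket_left.subspace_linear_preimage[OF assms(1)])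
  then have "cvec.span A \<subseteq> {x. bracket x y \<in> V}" using 1 assms(4) by (intro cvec.span_minimal) auto
  then show ?thesis using assms by blast
qed

lemma lie_prod_subset:
  assumes "cvec.subspace V" "\<And>x y. x \<in> A \<Longrightarrow> y \<in> B \<Longrightarrow> bracket x y \<in> V"
  shows "lie_prod A B \<subseteq> V"
  unfolding lie_prod_def using assms by (intro cvec.span_minimal) auto

lemma bracket_in_lie_prod: "x \<in> A \<Longrightarrow> y \<in> B \<Longrightarrow> bracket x y \<in> lie_prod A B"
  unfolding lie_prod_def by (intro cvec.span_base) blast

lemma subspace_lie_prod: "cvec.subspace (lie_prod A B)"
  by (simp add: lie_prod_def)

lemma lie_prod_mono: "A \<subseteq> A' \<Longrightarrow> B \<subseteq> B' \<Longrightarrow> lie_prod A B \<subseteq> lie_prod A' B'"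
  by (intro lie_prod_subset subspace_lie_prod bracket_in_lie_prod) auto

locale parabolic = simple_cartan_base H P for H :: "'g::complex_lie_algebra set" and P +
  fixes Q N M :: "'g set"
  assumes parabolic: "standard_parabolic H P Q"
    and nilradical: "is_nilradical Q N"
    and levi: "levi_factor Q N M"
    and H_subset_M: "H \<subseteq> M"
begin

section \<open>Which root spaces lie in the parabolic subalgebra\<close>

lemma subspace_Q: "cvec.subspace Q" and bracket_Q: "x \<in> Q \<Longrightarrow> y \<in> Q \<Longrightarrow> bracket x y \<in> Q"
  using parabolic by (auto simp: standard_parabolic_def lie_subalgebra_def)

lemma borel_generators: "H \<union> (\<Union>\<phi>\<in>positive_roots H P. W \<phi>) \<subseteq> Q"
proof -
  have "cvec.span (H \<union> (\<Union>\<phi>\<in>positive_roots H P. W \<phi>)) \<subseteq> Q"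
    using parabolic by (simp add: standard_parabolic_def borel_def)
  then show ?thesis by (rule order_trans[OF cvec.span_superset])
qed

lemma H_subset_Q: "H \<subseteq> Q" and positive_subset_Q: "positive \<phi> \<Longrightarrow> W \<phi> \<subseteq> Q"
  using borel_generators by (auto simp: positive_roots_eq)

definition inQ :: "('g \<Rightarrow> complex) \<Rightarrow> bool" where "inQ \<phi> \<longleftrightarrow> W \<phi> \<subseteq> Q"

lemma inQ_add: "\<phi> \<in> roots H \<Longrightarrow> \<psi> \<in> roots H \<Longrightarrow> \<phi> + \<psi> \<in> roots H \<Longrightarrow> inQ \<phi> \<Longrightarrow> inQ \<psi> \<Longrightarrow> inQ (\<phi> + \<psi>)"
  unfolding inQ_def by (rule weight_space_add_subset[OF _ _ _ subspace_Q]) (use bracket_Q in blast)+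

text \<open>Stated through \<open>Q\<close> alone. These turn out to be the simple roots of the Levi
  factor once the root spaces inside \<open>M\<close> are known.\<close>

definition Pm :: "('g \<Rightarrow> complex) set" where "Pm = {\<alpha> \<in> P. inQ (- \<alpha>)}"

definition Pc :: "('g \<Rightarrow> complex) set" where "Pc = P - Pm"

text \<open>The order of a t-root, lifted to all roots of the algebra: it depends only on the
  restriction to the center of the Levi factor, is 0 on roots of that factor, and changes sign with
  the root.\<close>

definition ord :: "('g \<Rightarrow> complex) \<Rightarrow> int" where "ord \<phi> = (\<Sum>\<alpha>\<in>Pc. c \<alpha> \<phi>)"

lemma Pm_subset: "Pm \<subseteq> P" and Pc_subset: "Pc \<subseteq> P" and finite_Pc: "finite Pc"
  using finite_base by (auto simp: Pm_def Pc_def)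

lemma inQ_uminus_base: assumes "\<alpha> \<in> P" shows "inQ (- \<alpha>) \<longleftrightarrow> (\<forall>\<beta>\<in>Pc. c \<beta> \<alpha> = 0)"
proof -
  have "inQ (- \<alpha>) \<longleftrightarrow> \<alpha> \<notin> Pc" using assms unfolding Pc_def Pm_def by blast
  also have "\<dots> \<longleftrightarrow> (\<forall>\<beta>\<in>Pc. c \<beta> \<alpha> = 0)" using coeff_base[OF assms] by auto
  finally show ?thesis .
qed

text \<open>Since \<phi> and \<alpha> belong to \<open>Q\<close>, adding either one to -(\<phi> +
  \<alpha>) shows that \<open>Q\<close> contains this root exactly if it contains both -\<phi> and
  -\<alpha>. Coefficients of positive roots cannot cancel, so the condition passes to the
  sum.\<close>

lemma inQ_uminus_positive: "positive \<phi> \<Longrightarrow> inQ (- \<phi>) \<longleftrightarrow> (\<forall>\<beta>\<in>Pc. c \<beta> \<phi> = 0)"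
proof (induction rule: positive_induct)
  case (base \<alpha>)
  then show ?case by (rule inQ_uminus_base)
next
  case (step \<phi> \<alpha>)
  have r: "\<phi> \<in> roots H" "\<alpha> \<in> roots H" "\<phi> + \<alpha> \<in> roots H" using step positive_root base_root by auto
  note r' = r[THEN root_uminus]
  have eqs: "- (\<phi> + \<alpha>) + \<alpha> = - \<phi>" "- (\<phi> + \<alpha>) + \<phi> = - \<alpha>" "- \<phi> + - \<alpha> = - (\<phi> + \<alpha>)" by simp_all
  have pos: "inQ \<phi>" "inQ \<alpha>" using positive_subset_Q step base_positive by (auto simp: inQ_def)
  have "inQ (- (\<phi> + \<alpha>)) \<longleftrightarrow> inQ (- \<phi>) \<and> inQ (- \<alpha>)"
    using inQ_add[OF r'(3) r(2), unfolded eqs] inQ_add[OF r'(3) r(1), unfolded eqs]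
      inQ_add[OF r'(1) r'(2), unfolded eqs] r' pos by blast
  also have "inQ (- \<alpha>) \<longleftrightarrow> (\<forall>\<beta>\<in>Pc. c \<beta> \<alpha> = 0)" using step(2) by (rule inQ_uminus_base)
  finally have *: "inQ (- (\<phi> + \<alpha>)) \<longleftrightarrow> (\<forall>\<beta>\<in>Pc. c \<beta> \<phi> = 0) \<and> (\<forall>\<beta>\<in>Pc. c \<beta> \<alpha> = 0)"
    by (simp only: step.IH)
  have "c \<beta> \<phi> \<ge> 0 \<and> c \<beta> \<alpha> \<ge> 0" if "\<beta> \<in> Pc" for \<beta>
    using that step(1) base_positive[OF step(2)] Pc_subset by (auto simp: positive_def)
  then show ?case unfolding * coeff_add[OF r(1,2)] by (metis add_nonneg_eq_0_iff)
qed

lemma ord_add: "\<phi> \<in> roots H \<Longrightarrow> \<psi> \<in> roots H \<Longrightarrow> ord (\<phi> + \<psi>) = ord \<phi> + ord \<psi>"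
  by (simp add: ord_def coeff_add sum.distrib)

lemma ord_diff: "\<phi> \<in> roots H \<Longrightarrow> \<psi> \<in> roots H \<Longrightarrow> ord (\<phi> - \<psi>) = ord \<phi> - ord \<psi>"
  by (simp add: ord_def coeff_diff sum_subtractf)

lemma ord_uminus: "\<phi> \<in> roots H \<Longrightarrow> ord (- \<phi>) = - ord \<phi>"
  by (simp add: ord_def coeff_minus sum_negf)

lemma ord_base: "\<alpha> \<in> P \<Longrightarrow> ord \<alpha> = (if \<alpha> \<in> Pc then 1 else 0)"
  using finite_Pc by (simp add: ord_def coeff_base)

lemma ord_positive: "positive \<phi> \<Longrightarrow> ord \<phi> \<ge> 0"
  unfolding ord_def using Pc_subset by (intro sum_nonneg) (auto simp: positive_def)

lemma ord_pos_positive: "\<phi> \<in> roots H \<Longrightarrow> ord \<phi> > 0 \<Longrightarrow> positive \<phi>"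
  using positive_or_uminus_positive[of \<phi>] ord_positive[of "- \<phi>"] by (auto simp: ord_uminus)

lemma ord_eq_0_iff: assumes "\<phi> \<in> roots H" shows "ord \<phi> = 0 \<longleftrightarrow> (\<forall>\<beta>\<in>Pc. c \<beta> \<phi> = 0)"
proof -
  have *: "ord \<phi> = 0 \<longleftrightarrow> (\<forall>\<beta>\<in>Pc. c \<beta> \<phi> = 0)" if "positive \<phi>" for \<phi>
    unfolding ord_def using that Pc_subset finite_Pc
      by (intro sum_nonneg_eq_0_iff) (auto simp: positive_def)
  show ?thesis
    using positive_or_uminus_positive[OF assms]
  proof
    assume "positive (- \<phi>)"
    then show ?thesis using *[of "- \<phi>"] by (simp add: ord_uminus coeff_minus assms)
  qed (rule *)
qed

lemma inQ_iff: assumes "\<phi> \<in> roots H" shows "inQ \<phi> \<longleftrightarrow> ord \<phi> \<ge> 0"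
proof (cases "positive \<phi>")
  case True
  then show ?thesis using positive_subset_Q ord_positive by (simp add: inQ_def)
next
  case False
  then have "positive (- \<phi>)" using positive_or_uminus_positive assms by blast
  then show ?thesis
    using inQ_uminus_positive[of "- \<phi>"] ord_eq_0_iff[OF root_uminus[OF assms]] ord_positive[of "- \<phi>"]
    by (auto simp: ord_uminus assms)
qed

text \<open>The decreasing filtration by order, whose terms from 1 on become the terms of both
  central series; \<open>G\<close> is its homogeneous piece. Neither contains a part of
  \<open>H\<close>.\<close>

definition F :: "int \<Rightarrow> 'g set" where
  "F i = root_span {\<phi> \<in> roots H. ord \<phi> \<ge> i}"

definition G :: "int \<Rightarrow> 'g set" where
  "G i = root_span {\<phi> \<in> roots H. ord \<phi> = i}"

lemma span_root_spaces_comp: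
  assumes "z \<in> root_span A" "A \<subseteq> roots H" "\<psi> \<in> supported_on H" "comp \<psi> z \<noteq> 0"
  shows "\<psi> \<in> A"
proof (rule ccontr)
  assume no: "\<psi> \<notin> A"
  have "cvec.subspace {z. comp \<psi> z = 0}" by (rule comp.subspace_kernel)
  then have "root_span A \<subseteq> {z. comp \<psi> z = 0}"
    using comp_root_other assms(2,3) no by (intro cvec.span_minimal) fastforce+
  then show False using assms by blast
qed

lemma in_span_root_spacesI:
  assumes "\<And>\<psi>. \<psi> \<in> weights \<Longrightarrow> comp \<psi> z \<noteq> 0 \<Longrightarrow> \<psi> \<in> A" "A \<subseteq> roots H"
  shows "z \<in> root_span A"
proof -
  have "(\<Sum>\<psi>\<in>weights. comp \<psi> z) \<in> root_span A"
  proof (rule cvec.span_sum)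
    fix \<psi> assume "\<psi> \<in> weights"
    then show "comp \<psi> z \<in> root_span A"
      using assms comp_in_weight_space[of \<psi> z]
        by (cases "comp \<psi> z = 0") (auto intro: cvec.span_zero cvec.span_base)
  qed
  then show ?thesis by (simp add: sum_comp)
qed

lemma subspace_F: "cvec.subspace (F i)" and subspace_G: "cvec.subspace (G i)"
  by (simp_all add: F_def G_def)

lemma weight_space_subset_root_span:
  assumes \<phi>: "\<phi> \<in> roots H" and A: "A \<subseteq> roots H" shows "W \<phi> \<subseteq> root_span A \<longleftrightarrow> \<phi> \<in> A"
proof
  show "\<phi> \<in> A" if "W \<phi> \<subseteq> root_span A"
    using that root_vec[OF \<phi>] comp_root_same[OF \<phi> root_vec(1)[OF \<phi>]] span_root_spaces_comp[OF _ A
      root_supported[OF \<phi>], of "root_vec \<phi>"]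
    by auto
  show "W \<phi> \<subseteq> root_span A" if "\<phi> \<in> A"
    using that by (auto intro: cvec.span_base)
qed

lemma weight_space_subset_F: "\<phi> \<in> roots H \<Longrightarrow> W \<phi> \<subseteq> F i \<longleftrightarrow> ord \<phi> \<ge> i"
  and weight_space_subset_G: "\<phi> \<in> roots H \<Longrightarrow> W \<phi> \<subseteq> G i \<longleftrightarrow> ord \<phi> = i"
  unfolding F_def G_def by (subst weight_space_subset_root_span; auto)+

lemma F_antimono: "i \<le> j \<Longrightarrow> F j \<subseteq> F i"
  unfolding F_def by (intro cvec.span_mono) auto

lemma G_subset_F: "i \<le> j \<Longrightarrow> G j \<subseteq> F i"
  unfolding F_def G_def by (intro cvec.span_mono) auto

text \<open>The condition on orders excludes opposite roots, whose bracket would fall into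
  \<open>H\<close> and thus leave the root spans.\<close>

lemma bracket_root_spaces:
  assumes "\<phi> \<in> roots H" "\<psi> \<in> roots H" "x \<in> W \<phi>" "y \<in> W \<psi>" "ord \<phi> + ord \<psi> \<noteq> 0"
  shows "bracket x y = 0 \<or> (\<phi> + \<psi> \<in> roots H \<and> bracket x y \<in> W (\<phi> + \<psi>))"
proof -
  have xy: "bracket x y \<in> W (\<phi> + \<psi>)" using bracket_weight_space assms by blast
  have "\<phi> + \<psi> \<noteq> 0"
  proof
    assume "\<phi> + \<psi> = 0"
    then have "\<psi> = - \<phi>" by (simp add: eq_neg_iff_add_eq_0 add.commute)
    then show False using assms(1,5) ord_uminus by simp
  qed
  then show ?thesis
    using xy weight_space_nonroot[OF supported_on_add[OF root_supported[OF assms(1)] root_supported[OF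
      assms(2)]]] by blast
qed

lemma bracket_root_span:
  assumes "\<And>\<phi> \<psi>. \<phi> \<in> A \<Longrightarrow> \<psi> \<in> B \<Longrightarrow> ord \<phi> + ord \<psi> \<noteq> 0 \<and> (\<phi> + \<psi> \<in> roots H \<longrightarrow> \<phi> + \<psi> \<in> C)"
    and "A \<subseteq> roots H" "B \<subseteq> roots H" and x: "x \<in> root_span A" and y: "y \<in> root_span B"
  shows "bracket x y \<in> root_span C"
proof (rule bracket_span_mem[OF _ _ x y])
  fix u v assume "u \<in> (\<Union>\<phi>\<in>A. W \<phi>)" "v \<in> (\<Union>\<phi>\<in>B. W \<phi>)"
  then obtain \<phi> \<psi> where *: "\<phi> \<in> A" "u \<in> W \<phi>" "\<psi> \<in> B" "v \<in> W \<psi>" by blast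
  then have "bracket u v = 0 \<or> (\<phi> + \<psi> \<in> roots H \<and> bracket u v \<in> W (\<phi> + \<psi>))"
    using assms(1)[of \<phi> \<psi>] assms(2,3) by (intro bracket_root_spaces) auto
  then show "bracket u v \<in> root_span C"
    using assms(1)[of \<phi> \<psi>] * by (auto intro: cvec.span_zero cvec.span_base)
qed simp

lemma bracket_F: "i + j \<ge> 1 \<Longrightarrow> x \<in> F i \<Longrightarrow> y \<in> F j \<Longrightarrow> bracket x y \<in> F (i + j)"
  unfolding F_def
  by (rule bracket_root_span[where A = "{\<phi> \<in> roots H. ord \<phi> \<ge> i}" and B =
    "{\<phi> \<in> roots H. ord \<phi> \<ge> j}"]) (auto simp: ord_add)

lemma bracket_G: "i + j \<noteq> 0 \<Longrightarrow> x \<in> G i \<Longrightarrow> y \<in> G j \<Longrightarrow> bracket x y \<in> G (i + j)"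
  unfolding G_def
  by (rule bracket_root_span[where A = "{\<phi> \<in> roots H. ord \<phi> = i}" and B = "{\<phi> \<in> roots H. ord \<phi>
    = j}"]) (auto simp: ord_add)

lemma bracket_H_root_spaces_span:
  assumes x: "x \<in> H" and z: "z \<in> root_span A"
  shows "bracket x z \<in> root_span A"
proof (rule bracket_span_mem[OF _ _ cvec.span_base[of x "{x}"] z])
  fix u y assume "u \<in> {x}" "y \<in> (\<Union>\<phi>\<in>A. W \<phi>)"
  then obtain \<phi> where "\<phi> \<in> A" "y \<in> W \<phi>" "u = x" by blast
  then show "bracket u y \<in> root_span A"
    using x by (auto simp: weight_space_def intro!: cvec.span_scale intro: cvec.span_base)
qed simp_all

lemma bracket_H_F: "x \<in> H \<Longrightarrow> z \<in> F i \<Longrightarrow> bracket x z \<in> F i"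
  using bracket_H_root_spaces_span by (simp add: F_def)

lemma F_subset_Q: "i \<ge> 0 \<Longrightarrow> F i \<subseteq> Q"
  unfolding F_def using inQ_iff by (intro cvec.span_minimal subspace_Q) (force simp: inQ_def)

lemma Q_subset: "Q \<subseteq> {x + y | x y. x \<in> H \<and> y \<in> F 0}"
proof
  fix z assume z: "z \<in> Q"
  have stQ: "bracket x z \<in> Q" if "x \<in> H" "z \<in> Q" for x z using that H_subset_Q bracket_Q by blast
  have c0: "comp 0 z \<in> H" using comp_in[of 0 z] gen_weight_space_zero by simp
  have cc: "comp 0 (comp 0 z) = comp 0 z" using comp_same[OF zero_supported comp_in] .
  have "z - comp 0 z \<in> F 0"
    unfolding F_def
  proof (rule in_span_root_spacesI)
    fix \<psi> assume \<psi>: "\<psi> \<in> weights" "comp \<psi> (z - comp 0 z) \<noteq> 0"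
    then have "\<psi> \<noteq> 0" using cc by (auto simp: comp.diff)
    then have r: "\<psi> \<in> roots H" using \<psi> by (simp add: roots_eq)
    have "comp \<psi> (comp 0 z) = 0" using comp_other[OF zero_supported comp_in root_supported[OF r] \<open>\<psi> \<noteq> 0\<close>] .
    then have "comp \<psi> z \<noteq> 0" using \<psi> by (simp add: comp.diff)
    then have "inQ \<psi>" unfolding inQ_def using weight_space_in_stable_subspace[OF subspace_Q stQ z r]
      by blast
    then show "\<psi> \<in> {\<phi> \<in> roots H. ord \<phi> \<ge> 0}" using inQ_iff[OF r] r by simp
  qed auto
  moreover have "z = comp 0 z + (z - comp 0 z)" by simp
  ultimately show "z \<in> {x + y | x y. x \<in> H \<and> y \<in> F 0}" using c0 by blast
qed

lemma F_eventually_zero: "\<exists>m. \<forall>i\<ge>m. F i = {0}"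
proof -
  have "ord \<phi> < Max (insert 0 (ord ` roots H)) + 1" if "\<phi> \<in> roots H" for \<phi>
    using Max_ge[of "insert 0 (ord ` roots H)" "ord \<phi>"] roots_finite that by simp
  then have "{\<phi> \<in> roots H. ord \<phi> \<ge> i} = {}" if "i \<ge> Max (insert 0 (ord ` roots H)) + 1" for i
    using that by force
  then have "F i = {0}" if "i \<ge> Max (insert 0 (ord ` roots H)) + 1" for i
    using that unfolding F_def by (simp only: UN_empty cvec.span_empty)
  then show ?thesis by blast
qed

lemma F1_ideal: "lie_ideal Q (F 1)"
  unfolding lie_ideal_def
proof (intro conjI ballI subspace_F)
  show "F 1 \<subseteq> Q" using F_subset_Q by simp
  fix z y assume "z \<in> Q" and y: "y \<in> F 1"
  then obtain x w where xw: "z = x + w" "x \<in> H" "w \<in> F 0" using Q_subset by blast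
  then show "bracket z y \<in> F 1"
    using bracket_H_F[OF xw(2) y] bracket_F[of 0 1 w y] y cvec.subspace_add[OF subspace_F]
      by (simp add: bracket_add_left)
qed

lemma F1_nilpotent: "nilpotent (F 1)"
proof -
  have "(lie_prod (F 1) ^^ j) (F 1) \<subseteq> F (int j + 1)" for j
  proof (induction j)
    case (Suc j)
    have "bracket x y \<in> F (int (Suc j) + 1)" if "x \<in> F 1" "y \<in> F (int j + 1)" for x y
      using bracket_F[OF _ that] by (simp add: add.commute)
    then have "lie_prod (F 1) (F (int j + 1)) \<subseteq> F (int (Suc j) + 1)" by (intro lie_prod_subset subspace_F)
    then show ?case using lie_prod_mono[OF subset_refl Suc.IH, of "F 1"] by simp
  qed simp
  moreover obtain m where "\<forall>i\<ge>m. F i = {0}" using F_eventually_zero by blast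
  then have "F (int (nat m) + 1) = {0}" by simp
  ultimately have "(lie_prod (F 1) ^^ nat m) (F 1) \<subseteq> {0}" by metis
  moreover have "cvec.subspace ((lie_prod (F 1) ^^ j) (F 1))" for j
    by (cases j) (simp_all add: subspace_F subspace_lie_prod)
  ultimately have "(lie_prod (F 1) ^^ nat m) (F 1) = {0}" using cvec.subspace_0 by blast
  then have "lower_central (F 1) (nat m + 1) = {0}" by (simp add: lower_central_def)
  then show ?thesis unfolding nilpotent_def by blast
qed

section \<open>The nilradical is the part of positive order\<close>

lemma N_ideal: "cvec.subspace N" "N \<subseteq> Q" "x \<in> Q \<Longrightarrow> y \<in> N \<Longrightarrow> bracket x y \<in> N"
  using nilradical by (auto simp: is_nilradical_def lie_ideal_def)

text \<open>An eigenvector in the nilradical of an element of the nilradical, with nonzero eigenvalue, survives in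
  the whole lower central series.\<close>

lemma N_no_eigenvector:
  assumes "x \<in> N" "e \<in> N" "bracket x e = a *\<^sub>C e" "a \<noteq> 0" shows "e = 0"
proof -
  have mem: "e \<in> (lie_prod N ^^ j) N" for j
  proof (induction j)
    case (Suc j)
    have "bracket x e \<in> lie_prod N ((lie_prod N ^^ j) N)" using assms(1) Suc by (rule bracket_in_lie_prod)
    then have "(1 / a) *\<^sub>C a *\<^sub>C e \<in> lie_prod N ((lie_prod N ^^ j) N)"
      unfolding assms(3) by (rule cvec.subspace_scale[OF subspace_lie_prod])
    then show ?case using assms(4) by simp
  qed (use assms in simp)
  obtain k where "lower_central N k = {0}" using nilradical by (auto simp: is_nilradical_def nilpotent_def)
  then show ?thesis using mem[of "k - 1"] by (simp add: lower_central_def)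
qed

text \<open>If the order were at most 0, -\<phi> would belong to \<open>Q\<close>, so
  \<open>tv \<phi>\<close> would be a bracket inside the ideal \<open>N\<close>. It acts on the root
  vector of \<phi> by a nonzero scalar, which nilpotency forbids.\<close>

lemma root_space_in_N: assumes \<phi>: "\<phi> \<in> roots H" and N: "W \<phi> \<subseteq> N" shows "ord \<phi> \<ge> 1"
proof (rule ccontr)
  assume no: "\<not> ord \<phi> \<ge> 1"
  then have "inQ (- \<phi>)" using inQ_iff[OF root_uminus[OF \<phi>]] ord_uminus[OF \<phi>] by simp
  obtain f where f: "f \<in> W (- \<phi>)" "bracket (root_vec \<phi>) f = tv \<phi>" using sl2_triple[OF \<phi> root_vec[OF \<phi>]]
    by blast
  have "f \<in> Q" using f \<open>inQ (- \<phi>)\<close> by (auto simp: inQ_def)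
  have e: "root_vec \<phi> \<in> N" using N root_vec[OF \<phi>] by blast
  have "tv \<phi> = - bracket f (root_vec \<phi>)" using f bracket_antisym[of "root_vec \<phi>" f] by simp
  then have "tv \<phi> \<in> N" using N_ideal(3)[OF \<open>f \<in> Q\<close> e] cvec.subspace_neg[OF N_ideal(1)] by simp
  moreover have "bracket (tv \<phi>) (root_vec \<phi>) = \<phi> (tv \<phi>) *\<^sub>C root_vec \<phi>"
    using root_vec(1)[OF \<phi>] tv_in[OF \<phi>] by (simp add: weight_space_def)
  moreover have "\<phi> (tv \<phi>) \<noteq> 0" using tv_self[OF \<phi>] by auto
  ultimately show False using N_no_eigenvector[OF _ e] root_vec(2)[OF \<phi>] by blast
qed

text \<open>A nonzero x in \<open>H\<close> has a nonzero value at some positive root. The root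
  vector belongs to \<open>Q\<close>, so the ideal \<open>N\<close> would contain it together with
  x, again an eigenvector with nonzero eigenvalue.\<close>

lemma N_int_H: assumes "x \<in> N" "x \<in> H" shows "x = 0"
proof (rule ccontr)
  assume "x \<noteq> 0"
  then obtain \<phi> where \<phi>: "\<phi> \<in> weights" "\<phi> x \<noteq> 0"
    using killing_nondegenerate_H[OF assms(2)] killing_on_H[OF assms(2)]
      by (metis (no_types, lifting) mult_zero_left mult_zero_right sum.neutral)
  then have r: "\<phi> \<in> roots H" by (auto simp: roots_eq)
  obtain \<psi> where \<psi>: "positive \<psi>" "\<psi> x \<noteq> 0"
    using positive_or_uminus_positive[OF r] \<phi>(2) by (metis fun_Compl_def neg_equal_0_iff_equal)
  note r = positive_root[OF \<psi>(1)]
  have e: "root_vec \<psi> \<in> Q" using positive_subset_Q[OF \<psi>(1)] root_vec(1)[OF r] by blast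
  have xe: "bracket x (root_vec \<psi>) = \<psi> x *\<^sub>C root_vec \<psi>" using root_vec(1)[OF r] assms(2)
    by (simp add: weight_space_def)
  have "bracket x (root_vec \<psi>) \<in> N"
    using N_ideal(3)[OF e assms(1)] bracket_antisym[of x "root_vec \<psi>"] cvec.subspace_neg[OF N_ideal(1)]
      by simp
  then have "(1 / \<psi> x) *\<^sub>C \<psi> x *\<^sub>C root_vec \<psi> \<in> N" unfolding xe by (rule cvec.subspace_scale[OF N_ideal(1)])
  then have "root_vec \<psi> \<in> N" using \<psi>(2) by simp
  then show False using N_no_eigenvector[OF assms(1) _ xe \<psi>(2)] root_vec(2)[OF r] by blast
qed

text \<open>\<open>F 1\<close> is a nilpotent ideal, hence contained in \<open>N\<close>. Conversely
  \<open>N\<close> is stable under \<open>H\<close>, so it contains the components of its elements: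
  the one in \<open>H\<close> vanishes, the others have order at least 1.\<close>

lemma N_eq: "N = F 1"
proof
  show "F 1 \<subseteq> N" using nilradical F1_ideal F1_nilpotent by (simp add: is_nilradical_def)
  show "N \<subseteq> F 1"
  proof
    fix z assume z: "z \<in> N"
    have st: "bracket x z \<in> N" if "x \<in> H" "z \<in> N" for x z using that H_subset_Q N_ideal(3) by blast
    show "z \<in> F 1" unfolding F_def
    proof (rule in_span_root_spacesI)
      fix \<psi> assume \<psi>: "\<psi> \<in> weights" "comp \<psi> z \<noteq> 0"
      have "\<psi> \<noteq> 0"
      proof
        assume "\<psi> = 0"
        then have "comp 0 z \<in> N" "comp 0 z \<in> H"
          using comp_in_stable_subspace[OF N_ideal(1) st z] \<psi> comp_in[of 0 z] gen_weight_space_zero by auto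
        then show False using N_int_H \<psi> \<open>\<psi> = 0\<close> by blast
      qed
      then have r: "\<psi> \<in> roots H" using \<psi> by (simp add: roots_eq)
      then have "W \<psi> \<subseteq> N" using weight_space_in_stable_subspace[OF N_ideal(1) st z r \<psi>(2)] by blast
      then show "\<psi> \<in> {\<phi> \<in> roots H. ord \<phi> \<ge> 1}" using root_space_in_N r by blast
    qed auto
  qed
qed

section \<open>The Levi factor and its center\<close>

lemma M_facts: "cvec.subspace M" "x \<in> M \<Longrightarrow> y \<in> M \<Longrightarrow> bracket x y \<in> M" "M \<inter> N = {0}" "Q = {x + y | x y. x \<in> M
  \<and> y \<in> N}"
  using levi by (auto simp: levi_factor_def reductive_def lie_subalgebra_def)

lemma M_subset_Q: "M \<subseteq> Q"
  using M_facts(4) cvec.subspace_0[OF N_ideal(1)] by force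

text \<open>A root vector of order 0 splits along Q = M + N; its summand in \<open>N\<close> has no
  \<phi>-component, so the summand in \<open>M\<close> does, and stability under \<open>H\<close>
  gives the root space. Conversely \<open>M\<close> lies in \<open>Q\<close> and meets
  \<open>N\<close> trivially.\<close>

lemma root_space_in_M_iff: assumes \<phi>: "\<phi> \<in> roots H" shows "W \<phi> \<subseteq> M \<longleftrightarrow> ord \<phi> = 0"
proof -
  have st: "bracket x z \<in> M" if "x \<in> H" "z \<in> M" for x z using that H_subset_M M_facts(2) by blast
  have notboth: "\<not> (W \<phi> \<subseteq> M \<and> W \<phi> \<subseteq> N)"
    using root_vec[OF \<phi>] M_facts(3) by blast
  have Niff: "W \<phi> \<subseteq> N \<longleftrightarrow> ord \<phi> \<ge> 1" using weight_space_subset_F[OF \<phi>] by (simp add: N_eq)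
  show ?thesis
  proof
    assume M: "W \<phi> \<subseteq> M"
    then have "ord \<phi> \<ge> 0" using M_subset_Q inQ_iff[OF \<phi>] by (auto simp: inQ_def)
    then show "ord \<phi> = 0" using notboth M Niff by auto
  next
    assume 0: "ord \<phi> = 0"
    then have "root_vec \<phi> \<in> Q" using inQ_iff[OF \<phi>] root_vec(1)[OF \<phi>] by (auto simp: inQ_def)
    then obtain x y where xy: "root_vec \<phi> = x + y" "x \<in> M" "y \<in> N" using M_facts(4) by blast
    have "comp \<phi> y = 0"
      using span_root_spaces_comp[of y "{\<phi> \<in> roots H. ord \<phi> \<ge> 1}" \<phi>] xy(3) 0 root_supported[OF \<phi>]
        by (auto simp: N_eq F_def)
    then have "comp \<phi> x \<noteq> 0" using comp_root_same[OF \<phi> root_vec(1)[OF \<phi>]] root_vec(2)[OF \<phi>]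
      by (simp add: xy(1) comp.add)
    then show "W \<phi> \<subseteq> M" using weight_space_in_stable_subspace[OF M_facts(1) st xy(2) \<phi>] by blast
  qed
qed

lemma Pc_eq: "P - roots_of_subalgebra H M = Pc"
proof -
  have "\<alpha> \<in> roots_of_subalgebra H M \<longleftrightarrow> \<alpha> \<notin> Pc" if "\<alpha> \<in> P" for \<alpha>
    using root_space_in_M_iff[OF base_root[OF that]] ord_base[OF that] base_root[OF that]
      by (simp add: roots_of_subalgebra_def)
  then show ?thesis using Pc_subset by blast
qed

definition T :: "'g set" where "T = lie_center M"

abbreviation WT :: "('g \<Rightarrow> complex) \<Rightarrow> 'g set" where "WT \<equiv> weight_space T"

text \<open>A central element commutes with \<open>H\<close>, hence lies in the zero weight space
  \<open>H\<close>, and acts on the root spaces of \<open>Pm\<close> by the root values. Conversely,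
  roots of order 0 are combinations of \<open>Pm\<close>.\<close>

lemma T_eq: "T = {x \<in> H. \<forall>\<alpha>\<in>Pm. \<alpha> x = 0}"
proof
  show "T \<subseteq> {x \<in> H. \<forall>\<alpha>\<in>Pm. \<alpha> x = 0}"
  proof
    fix x assume x: "x \<in> T"
    then have com: "bracket x y = 0" if "y \<in> M" for y using that by (auto simp: T_def lie_center_def)
    then have "bracket y x = 0" if "y \<in> H" for y using that H_subset_M bracket_antisym[of y x] by auto
    then have xH: "x \<in> H" using weight_space_zero by (auto simp: weight_space_def)
    moreover have "\<alpha> x = 0" if "\<alpha> \<in> Pm" for \<alpha>
    proof -
      have r: "\<alpha> \<in> roots H" using that Pm_subset base_root by blast
      have "ord \<alpha> = 0" using that Pm_subset ord_base[of \<alpha>] by (auto simp: Pc_def)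
      then have "root_vec \<alpha> \<in> M" using root_space_in_M_iff[OF r] root_vec(1)[OF r] by blast
      then have "\<alpha> x *\<^sub>C root_vec \<alpha> = 0" using com root_vec(1)[OF r] xH by (auto simp: weight_space_def)
      then show ?thesis using root_vec(2)[OF r] by simp
    qed
    ultimately show "x \<in> {x \<in> H. \<forall>\<alpha>\<in>Pm. \<alpha> x = 0}" by simp
  qed
  show "{x \<in> H. \<forall>\<alpha>\<in>Pm. \<alpha> x = 0} \<subseteq> T"
  proof
    fix x assume "x \<in> {x \<in> H. \<forall>\<alpha>\<in>Pm. \<alpha> x = 0}"
    then have x: "x \<in> H" "\<And>\<alpha>. \<alpha> \<in> Pm \<Longrightarrow> \<alpha> x = 0" by auto
    have van: "\<phi> x = 0" if r: "\<phi> \<in> roots H" and 0: "ord \<phi> = 0" for \<phi>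
    proof -
      have "of_int (c \<alpha> \<phi>) * \<alpha> x = 0" if "\<alpha> \<in> P" for \<alpha>
        using that x(2) 0 ord_eq_0_iff[OF r] by (cases "\<alpha> \<in> Pc") (auto simp: Pc_def)
      then show ?thesis unfolding root_sum[OF r, of x] by (intro sum.neutral) blast
    qed
    have "bracket x y = 0" if y: "y \<in> M" for y
    proof -
      have st: "bracket x z \<in> M" if "x \<in> H" "z \<in> M" for x z using that H_subset_M M_facts(2) by blast
      show ?thesis
      proof (rule mem_subspace_if_comps[of "{y. bracket x y = 0}", simplified])
        show "cvec.subspace {y. bracket x y = 0}" by (rule bracket_right.subspace_kernel)
        show "bracket x (comp 0 y) = 0" using H_abelian[OF x(1)] comp_in[of 0 y] gen_weight_space_zero
          by simp
        fix \<phi> assume r: "\<phi> \<in> roots H"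
        have "\<phi> x = 0" if "comp \<phi> y \<noteq> 0"
          using van[OF r] root_space_in_M_iff[OF r] weight_space_in_stable_subspace[OF M_facts(1) st y r
            that] by blast
        then show "bracket x (comp \<phi> y) = 0"
          using comp_in_weight_space[OF r, of y] x(1)
            by (cases "comp \<phi> y = 0") (auto simp: weight_space_def bracket_right.zero)
      qed
    qed
    then show "x \<in> T" using x(1) H_subset_M by (auto simp: T_def lie_center_def)
  qed
qed

end

section \<open>Central series of the nilradical\<close>

context parabolic
begin

section \<open>Restriction of roots to the center of the Levi factor\<close>

lemma subspace_T: "cvec.subspace T"
  using M_facts(1) unfolding T_def lie_center_def cvec.subspace_def
  by (auto simp: bracket_left.zero bracket_add_left bracket_scaleC_left)

lemma T_subset_H: "T \<subseteq> H"
  by (auto simp: T_eq)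

text \<open>A dual vector taken with respect to the full base vanishes on \<open>Pm\<close> and so
  belongs to \<open>T\<close>.\<close>

lemma dual_vector_T: assumes "\<alpha> \<in> Pc" shows "\<exists>x\<in>T. \<forall>\<beta>\<in>Pc. \<beta> x = (if \<beta> = \<alpha> then 1 else 0)"
proof -
  have "\<alpha> \<in> P" using assms Pc_subset by blast
  then obtain x where x: "x \<in> H" "\<And>\<beta>. \<beta> \<in> P \<Longrightarrow> \<beta> x = (if \<beta> = \<alpha> then 1 else 0)"
    using dual_vectors_exist[OF subset_refl] by blast
  have "\<beta> x = 0" if "\<beta> \<in> Pm" for \<beta>
    using x(2)[of \<beta>] that assms by (auto simp: Pc_def Pm_def)
  then have "x \<in> T" using x(1) by (simp add: T_eq)
  moreover have "\<beta> x = (if \<beta> = \<alpha> then 1 else 0)" if "\<beta> \<in> Pc" for \<beta> using x(2)[of \<beta>] that Pc_subset by blast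
  ultimately show ?thesis by blast
qed

lemma root_on_T: assumes "\<phi> \<in> roots H" "x \<in> T" shows "\<phi> x = (\<Sum>\<alpha>\<in>Pc. of_int (c \<alpha> \<phi>) * \<alpha> x)"
  unfolding root_sum[OF assms(1), of x]
proof (rule sum.mono_neutral_right[OF finite_base Pc_subset], rule ballI)
  fix \<alpha> assume "\<alpha> \<in> P - Pc"
  then have "\<alpha> x = 0" using assms(2) by (auto simp: Pc_def T_eq)
  then show "of_int (c \<alpha> \<phi>) * \<alpha> x = 0" by simp
qed

text \<open>Roots in \<open>Pm\<close> vanish on \<open>T\<close>, and the dual vectors in
  \<open>T\<close> read off the coefficients at \<open>Pc\<close> one at a time.\<close>

lemma eq_on_T_iff:
  assumes \<phi>: "\<phi> \<in> roots H" and \<chi>: "\<chi> \<in> roots H"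
  shows "(\<forall>x\<in>T. \<phi> x = \<chi> x) \<longleftrightarrow> (\<forall>\<alpha>\<in>Pc. c \<alpha> \<phi> = c \<alpha> \<chi>)"
proof
  assume "\<forall>\<alpha>\<in>Pc. c \<alpha> \<phi> = c \<alpha> \<chi>"
  then have "(\<Sum>\<alpha>\<in>Pc. of_int (c \<alpha> \<phi>) * \<alpha> x) = (\<Sum>\<alpha>\<in>Pc. of_int (c \<alpha> \<chi>) * \<alpha> x)" for x by (intro sum.cong) auto
  then show "\<forall>x\<in>T. \<phi> x = \<chi> x" using root_on_T[OF \<phi>] root_on_T[OF \<chi>] by metis
next
  assume eq: "\<forall>x\<in>T. \<phi> x = \<chi> x"
  have val: "\<xi> x = of_int (c \<alpha> \<xi>)"
    if "\<xi> \<in> roots H" "x \<in> T" "\<alpha> \<in> Pc" "\<And>\<beta>. \<beta> \<in> Pc \<Longrightarrow> \<beta> x = (if \<beta> = \<alpha> then 1 else 0)" for \<xi> x \<alpha>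
  proof -
    have "\<xi> x = (\<Sum>\<beta>\<in>Pc. of_int (c \<beta> \<xi>) * \<beta> x)" by (rule root_on_T[OF that(1,2)])
    also have "\<dots> = (\<Sum>\<beta>\<in>Pc. if \<beta> = \<alpha> then of_int (c \<alpha> \<xi>) else 0)"
    proof (rule sum.cong)
      fix \<beta> assume "\<beta> \<in> Pc"
      then show "of_int (c \<beta> \<xi>) * \<beta> x = (if \<beta> = \<alpha> then of_int (c \<alpha> \<xi>) else 0)"
        unfolding that(4)[OF \<open>\<beta> \<in> Pc\<close>] by simp
    qed simp
    also have "\<dots> = of_int (c \<alpha> \<xi>)" using finite_Pc that(3) by simp
    finally show ?thesis .
  qed
  show "\<forall>\<alpha>\<in>Pc. c \<alpha> \<phi> = c \<alpha> \<chi>"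
  proof
    fix \<alpha> assume \<alpha>: "\<alpha> \<in> Pc"
    then obtain x where x: "x \<in> T" "\<And>\<beta>. \<beta> \<in> Pc \<Longrightarrow> \<beta> x = (if \<beta> = \<alpha> then 1 else 0)" using dual_vector_T
      by blast
    have "of_int (c \<alpha> \<phi>) = (of_int (c \<alpha> \<chi>) :: complex)"
      using val[OF \<phi> x(1) \<alpha> x(2)] val[OF \<chi> x(1) \<alpha> x(2)] eq x(1) by simp
    then show "c \<alpha> \<phi> = c \<alpha> \<chi>" by simp
  qed
qed

lemma restr_eq_iff:
  assumes "\<phi> \<in> roots H" "\<chi> \<in> roots H"
  shows "restr T \<phi> = restr T \<chi> \<longleftrightarrow> (\<forall>\<alpha>\<in>Pc. c \<alpha> \<phi> = c \<alpha> \<chi>)"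
proof -
  have "restr T \<phi> = restr T \<chi> \<longleftrightarrow> (\<forall>x\<in>T. \<phi> x = \<chi> x)" unfolding restr_def fun_eq_iff by auto
  then show ?thesis using eq_on_T_iff[OF assms] by simp
qed

lemma restr_eq_ord: "\<phi> \<in> roots H \<Longrightarrow> \<chi> \<in> roots H \<Longrightarrow> restr T \<phi> = restr T \<chi> \<Longrightarrow> ord \<phi> = ord \<chi>"
  using restr_eq_iff[of \<phi> \<chi>] by (simp add: ord_def)

text \<open>Vanishing on \<open>T\<close> is agreement there with the negative root, so the
  comparison of coefficients applies.\<close>

lemma restr_eq_0_iff_ord:
  assumes \<phi>: "\<phi> \<in> roots H" shows "restr T \<phi> = 0 \<longleftrightarrow> ord \<phi> = 0"
proof -
  have "restr T \<phi> = 0 \<longleftrightarrow> (\<forall>x\<in>T. \<phi> x = (- \<phi>) x)" by (auto simp: restr_def fun_eq_iff)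
  also have "\<dots> \<longleftrightarrow> (\<forall>\<alpha>\<in>Pc. c \<alpha> \<phi> = - c \<alpha> \<phi>)" using eq_on_T_iff[OF \<phi> root_uminus[OF \<phi>]] coeff_minus[OF \<phi>]
    by simp
  also have "\<dots> \<longleftrightarrow> ord \<phi> = 0" using ord_eq_0_iff[OF \<phi>] by simp
  finally show ?thesis .
qed

lemma weight_space_subset_restr: "W \<phi> \<subseteq> WT (restr T \<phi>)"
  using T_subset_H by (auto simp: weight_space_def restr_def)

lemma comp_bracket_H:
  assumes x: "x \<in> H" and \<phi>: "\<phi> \<in> supported_on H"
  shows "comp \<phi> (bracket x z) = \<phi> x *\<^sub>C comp \<phi> z"
proof -
  have "z \<in> {z. comp \<phi> (bracket x z) = \<phi> x *\<^sub>C comp \<phi> z}"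
  proof (rule weight_space_induct)
    show "cvec.subspace {z. comp \<phi> (bracket x z) = \<phi> x *\<^sub>C comp \<phi> z}"
      by (auto simp: cvec.subspace_def bracket_right.zero bracket_add_right bracket_scaleC_right comp.zero
        comp.add comp.scale
          cvec.scale_right_distrib mult.commute)
    fix \<chi> z assume \<chi>: "\<chi> \<in> weights" "z \<in> GW \<chi>"
    then have sup: "\<chi> \<in> supported_on H" using weights_supported by blast
    have "bracket x z = \<chi> x *\<^sub>C z" using bracket_H_diagonal[OF x sup \<chi>(2)] .
    then show "z \<in> {z. comp \<phi> (bracket x z) = \<phi> x *\<^sub>C comp \<phi> z}"
      using comp_other[OF sup \<chi>(2) \<phi>] by (cases "\<phi> = \<chi>") (auto simp: comp.scale)
  qed
  then show ?thesis by simp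
qed

lemma weight_space_T_comp:
  assumes "z \<in> WT \<nu>" "\<phi> \<in> supported_on H" "comp \<phi> z \<noteq> 0" "x \<in> T"
  shows "\<phi> x = \<nu> x"
proof -
  have "\<nu> x *\<^sub>C comp \<phi> z = comp \<phi> (bracket x z)" using assms(1,4) by (simp add: weight_space_def comp.scale)
  also have "\<dots> = \<phi> x *\<^sub>C comp \<phi> z" using comp_bracket_H assms(2,4) T_subset_H by blast
  finally show ?thesis using assms(3) by simp
qed

lemma weight_space_T_comp_root:
  assumes \<nu>: "\<nu> \<in> dual T" "\<nu> \<noteq> 0" and z: "z \<in> WT \<nu>" and \<phi>: "\<phi> \<in> weights" "comp \<phi> z \<noteq> 0"
  shows "\<phi> \<in> roots H" "restr T \<phi> = \<nu>"
proof -
  have sup: "\<phi> \<in> supported_on H" using \<phi> weights_supported by blast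
  show res: "restr T \<phi> = \<nu>"
    using weight_space_T_comp[OF z sup \<phi>(2)] \<nu>(1) by (auto simp: restr_def dual_def fun_eq_iff)
  have "restr T 0 = 0" by (auto simp: restr_def)
  then have "\<phi> \<noteq> 0" using res \<nu>(2) by auto
  then show "\<phi> \<in> roots H" using \<phi> by (simp add: roots_eq)
qed

text \<open>A nonzero vector of a t-root space has some nonzero weight component, and its weight
  agrees with the t-root on \<open>T\<close>; hence every t-root is the restriction of a root of
  nonzero order.\<close>

lemma roots_T: "roots T = restr T ` {\<phi> \<in> roots H. ord \<phi> \<noteq> 0}"
proof
  show "roots T \<subseteq> restr T ` {\<phi> \<in> roots H. ord \<phi> \<noteq> 0}"
  proof
    fix \<nu> assume "\<nu> \<in> roots T"
    then have \<nu>: "\<nu> \<in> dual T" "\<nu> \<noteq> 0" "WT \<nu> \<noteq> {0}" by (auto simp: roots_def)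
    then obtain z where z: "z \<in> WT \<nu>" "z \<noteq> 0" using cvec.subspace_0[OF subspace_weight_space] by blast
    have "\<exists>\<phi>\<in>weights. comp \<phi> z \<noteq> 0"
      using z(2) sum_comp[of z] by (metis sum.neutral)
    then obtain \<phi> where \<phi>: "\<phi> \<in> weights" "comp \<phi> z \<noteq> 0" by blast
    note r = weight_space_T_comp_root[OF \<nu>(1,2) z(1) \<phi>]
    then have "ord \<phi> \<noteq> 0" using restr_eq_0_iff_ord[OF r(1)] \<nu>(2) by simp
    then show "\<nu> \<in> restr T ` {\<phi> \<in> roots H. ord \<phi> \<noteq> 0}" using r by blast
  qed
  show "restr T ` {\<phi> \<in> roots H. ord \<phi> \<noteq> 0} \<subseteq> roots T"
  proof (rule image_subsetI)
    fix \<phi> assume "\<phi> \<in> {\<phi> \<in> roots H. ord \<phi> \<noteq> 0}"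
    then have \<phi>: "\<phi> \<in> roots H" "ord \<phi> \<noteq> 0" by auto
    have "restr T \<phi> \<in> dual T"
      using weight_add[OF root_weight[OF \<phi>(1)]] weight_scale[OF root_weight[OF \<phi>(1)]] T_subset_H
        cvec.subspace_add[OF subspace_T] cvec.subspace_scale[OF subspace_T]
      unfolding dual_def restr_def by (simp add: subset_iff)
    moreover have "restr T \<phi> \<noteq> 0" using restr_eq_0_iff_ord[OF \<phi>(1)] \<phi>(2) by simp
    moreover have "WT (restr T \<phi>) \<noteq> {0}"
      using weight_space_subset_restr[of \<phi>] root_vec[OF \<phi>(1)] by blast
    ultimately show "restr T \<phi> \<in> roots T" by (simp add: roots_def)
  qed
qed

lemma root_T_cases:
  assumes "\<nu> \<in> roots T" obtains \<phi> where "\<phi> \<in> roots H" "ord \<phi> \<noteq> 0" "\<nu> = restr T \<phi>"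
  using assms roots_T by auto

lemma weight_space_T_eq:
  assumes "\<nu> \<in> roots T"
  shows "WT \<nu> = root_span {\<phi> \<in> roots H. restr T \<phi> = \<nu>}"
proof
  have \<nu>: "\<nu> \<in> dual T" "\<nu> \<noteq> 0" using assms by (auto simp: roots_def)
  show "WT \<nu> \<subseteq> root_span {\<phi> \<in> roots H. restr T \<phi> = \<nu>}"
    using weight_space_T_comp_root[OF \<nu>] by (intro subsetI in_span_root_spacesI) blast+
  show "root_span {\<phi> \<in> roots H. restr T \<phi> = \<nu>} \<subseteq> WT \<nu>"
    using weight_space_subset_restr by (intro cvec.span_minimal subspace_weight_space) blast
qed

lemma weight_space_T_subset_G:
  assumes \<phi>: "\<phi> \<in> roots H" "ord \<phi> \<noteq> 0"
  shows "WT (restr T \<phi>) \<subseteq> G i \<longleftrightarrow> ord \<phi> = i"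
proof
  assume "WT (restr T \<phi>) \<subseteq> G i"
  then show "ord \<phi> = i" using weight_space_subset_restr[of \<phi>] weight_space_subset_G[OF \<phi>(1)] by blast
next
  assume i: "ord \<phi> = i"
  have "restr T \<phi> \<in> roots T" using roots_T \<phi> by blast
  from weight_space_T_eq[OF this] show "WT (restr T \<phi>) \<subseteq> G i"
    unfolding G_def using restr_eq_ord[OF _ \<phi>(1)] i by (simp only:) (intro cvec.span_mono, blast)
qed

lemma restr_add: "restr T (\<phi> + \<psi>) = restr T \<phi> + restr T \<psi>"
  by (auto simp: restr_def fun_eq_iff)

section \<open>Brackets of t-root spaces and the lower central series\<close>

lemma bracket_Levi_weight_space_T:
  assumes "\<delta> \<in> roots H" "ord \<delta> = 0" "e \<in> W \<delta>" "v \<in> WT \<nu>"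
  shows "bracket e v \<in> WT \<nu>"
proof -
  have "e \<in> WT 0"
    using weight_space_subset_restr[of \<delta>] assms(3) restr_eq_0_iff_ord[OF assms(1)] assms(2) by auto
  from bracket_weight_space[OF this assms(4)] show ?thesis by simp
qed

text \<open>Root vectors of the Levi factor preserve every t-root space, hence by the derivation
  rule also products of two. This is what carries a product from one root space to all others above
  the same t-root.\<close>

lemma bracket_Levi_lie_prod:
  assumes \<delta>: "\<delta> \<in> roots H" "ord \<delta> = 0" "e \<in> W \<delta>" and v: "v \<in> lie_prod (WT \<mu>) (WT \<nu>)"
  shows "bracket e v \<in> lie_prod (WT \<mu>) (WT \<nu>)"
proof (rule bracket_span_mem[OF subspace_lie_prod _ _ v[unfolded lie_prod_def]])
  show "e \<in> cvec.span {e}" by (simp add: cvec.span_base)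
  fix x y assume "x \<in> {e}" "y \<in> {bracket u w |u w. u \<in> WT \<mu> \<and> w \<in> WT \<nu>}"
  then obtain u w where uw: "x = e" "y = bracket u w" "u \<in> WT \<mu>" "w \<in> WT \<nu>" by blast
  have "bracket (bracket e u) w \<in> lie_prod (WT \<mu>) (WT \<nu>)"
    "bracket u (bracket e w) \<in> lie_prod (WT \<mu>) (WT \<nu>)"
    using uw bracket_Levi_weight_space_T[OF \<delta>] by (auto intro!: bracket_in_lie_prod)
  then show "bracket x y \<in> lie_prod (WT \<mu>) (WT \<nu>)"
    unfolding uw(1,2) bracket_derivation[of e u w] by (rule cvec.subspace_add[OF subspace_lie_prod])
qed

lemma Pm_root: assumes "\<alpha> \<in> Pm" shows "\<alpha> \<in> P" "\<alpha> \<in> roots H" "ord \<alpha> = 0" "- \<alpha> \<in> roots H" "ord (- \<alpha>) = 0"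
  using assms Pm_subset base_root ord_base[of \<alpha>] root_uminus[of \<alpha>] ord_uminus[of \<alpha>] by (auto simp: Pc_def)

text \<open>It suffices to let \<open>R\<close> be preserved by adding roots of the Levi factor, since the steps are
  reversible.\<close>

lemma restr_class_connected:
  assumes \<phi>: "\<phi> \<in> roots H" "ord \<phi> \<noteq> 0" and \<chi>: "\<chi> \<in> roots H" "restr T \<chi> = restr T \<phi>" and "R \<phi>"
    and step: "\<And>\<xi> \<delta>. \<xi> \<in> roots H \<Longrightarrow> \<delta> \<in> roots H \<Longrightarrow> ord \<delta> = 0 \<Longrightarrow> \<xi> + \<delta> \<in> roots H \<Longrightarrow> restr T \<xi> = restr T \<phi> \<Longrightarrow>
       R \<xi> \<Longrightarrow> R (\<xi> + \<delta>)"
  shows "R \<chi>"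
proof -
  obtain \<gamma> where \<gamma>: "\<gamma> \<in> Pc" "c \<gamma> \<phi> \<noteq> 0" using ord_eq_0_iff[OF \<phi>(1)] \<phi>(2) by blast
  have PcP: "P - Pm = Pc" by (simp add: Pc_def)
  have "R \<phi> \<longleftrightarrow> R \<chi>"
  proof (rule closed_under_steps[OF Pm_subset \<phi>(1) \<chi>(1), unfolded PcP])
    show "c \<beta> \<phi> = c \<beta> \<chi>" if "\<beta> \<in> Pc" for \<beta> using \<chi> \<phi> that restr_eq_iff by simp
    fix \<xi> \<alpha> assume \<xi>: "\<xi> \<in> roots H" "\<alpha> \<in> Pm" "\<xi> + \<alpha> \<in> roots H" "\<And>\<beta>. \<beta> \<in> Pc \<Longrightarrow> c \<beta> \<xi> = c \<beta> \<phi>"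
    note \<alpha> = Pm_root[OF \<xi>(2)]
    have r1: "restr T \<xi> = restr T \<phi>" using restr_eq_iff[OF \<xi>(1) \<phi>(1)] \<xi>(4) by blast
    have "restr T \<alpha> = 0" using restr_eq_0_iff_ord[OF \<alpha>(2)] \<alpha>(3) by simp
    then have r2: "restr T (\<xi> + \<alpha>) = restr T \<phi>" using r1 by (simp add: restr_add)
    show "R \<xi> \<longleftrightarrow> R (\<xi> + \<alpha>)"
    proof
      show "R \<xi> \<Longrightarrow> R (\<xi> + \<alpha>)" using step[OF \<xi>(1) \<alpha>(2,3) \<xi>(3) r1] .
      have "\<xi> + \<alpha> + - \<alpha> = \<xi>" by simp
      then show "R (\<xi> + \<alpha>) \<Longrightarrow> R \<xi>" using step[OF \<xi>(3) \<alpha>(4,5) _ r2] \<xi>(1) by metis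
    qed
  qed (use \<gamma> in auto)
  then show ?thesis using \<open>R \<phi>\<close> by simp
qed

lemma finite_restr_class_extremal:
  assumes "\<phi> \<in> roots H"
  shows "\<exists>\<chi>\<in>roots H. restr T \<chi> = restr T \<phi> \<and> (\<forall>\<xi>\<in>roots H. restr T \<xi> = restr T \<phi> \<longrightarrow> ht \<chi> \<le> ht \<xi>)"
    and "\<exists>\<chi>\<in>roots H. restr T \<chi> = restr T \<phi> \<and> (\<forall>\<xi>\<in>roots H. restr T \<xi> = restr T \<phi> \<longrightarrow> ht \<xi> \<le> ht \<chi>)"
proof -
  let ?C = "{\<xi> \<in> roots H. restr T \<xi> = restr T \<phi>}"
  have C: "finite (ht ` ?C)" "ht ` ?C \<noteq> {}" using roots_finite assms by auto
  from Min_in[OF C] obtain \<chi> where "Min (ht ` ?C) = ht \<chi>" "\<chi> \<in> ?C" by (rule imageE)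
  then show "\<exists>\<chi>\<in>roots H. restr T \<chi> = restr T \<phi> \<and> (\<forall>\<xi>\<in>roots H. restr T \<xi> = restr T \<phi> \<longrightarrow> ht \<chi> \<le> ht \<xi>)"
    using Min_le[OF C(1)] by (intro bexI[of _ \<chi>]) (auto simp del: Min_le_iff Max_ge_iff)
  from Max_in[OF C] obtain \<chi> where "Max (ht ` ?C) = ht \<chi>" "\<chi> \<in> ?C" by (rule imageE)
  then show "\<exists>\<chi>\<in>roots H. restr T \<chi> = restr T \<phi> \<and> (\<forall>\<xi>\<in>roots H. restr T \<xi> = restr T \<phi> \<longrightarrow> ht \<xi> \<le> ht \<chi>)"
    using Max_ge[OF C(1)] by (intro bexI[of _ \<chi>]) (auto simp del: Min_le_iff Max_ge_iff)
qed

lemma lie_prod_t_root_spaces: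
  assumes \<phi>: "\<phi> \<in> roots H" "ord \<phi> = i" "i \<ge> 2"
  shows "\<exists>\<alpha>\<in>Pc. \<exists>\<chi>\<in>roots H. ord \<chi> = i - 1 \<and>
    lie_prod (WT (restr T \<alpha>)) (WT (restr T \<chi>)) = WT (restr T \<phi>)"
proof -
  obtain \<xi> where \<xi>: "\<xi> \<in> roots H" "restr T \<xi> = restr T \<phi>"
    and min: "\<And>\<eta>. \<eta> \<in> roots H \<Longrightarrow> restr T \<eta> = restr T \<phi> \<Longrightarrow> ht \<xi> \<le> ht \<eta>"
    using finite_restr_class_extremal(1)[OF \<phi>(1)] by blast
  have o: "ord \<xi> = i" using restr_eq_ord[OF \<xi>(1) \<phi>(1) \<xi>(2)] \<phi>(2) by simp
  then have pos: "positive \<xi>" using ord_pos_positive[OF \<xi>(1)] \<phi>(3) by simp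
  then obtain \<alpha> where \<alpha>: "\<alpha> \<in> P" "rip \<xi> \<alpha> > 0" using positive_pairing by blast
  note r\<alpha> = base_root[OF \<alpha>(1)]
  \<comment> \<open>This is where order at least 2 matters: a simple root has order at most
    1.\<close>
  have "\<xi> \<noteq> \<alpha>" using o \<phi>(3) ord_base[OF \<alpha>(1)] by (auto split: if_splits)
  then have r: "\<xi> - \<alpha> \<in> roots H" using root_diff[OF \<xi>(1) r\<alpha> \<alpha>(2)] by blast
  have res: "restr T \<alpha> + restr T (\<xi> - \<alpha>) = restr T \<phi>" using \<xi>(2) restr_add[of \<alpha> "\<xi> - \<alpha>"] by simp
  have \<alpha>c: "\<alpha> \<in> Pc"
  proof (rule ccontr)
    assume "\<alpha> \<notin> Pc"
    then have "restr T \<alpha> = 0" using restr_eq_0_iff_ord[OF r\<alpha>] ord_base[OF \<alpha>(1)] by simp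
    then have "restr T (\<xi> - \<alpha>) = restr T \<phi>" using res by simp
    then show False using min[OF r] ht_diff_base[OF \<xi>(1) \<alpha>(1)] by simp
  qed
  have o': "ord (\<xi> - \<alpha>) = i - 1" using ord_diff[OF \<xi>(1) r\<alpha>] o ord_base[OF \<alpha>(1)] \<alpha>c by simp
  let ?L = "lie_prod (WT (restr T \<alpha>)) (WT (restr T (\<xi> - \<alpha>)))"
  have "?L \<subseteq> WT (restr T \<phi>)"
    using bracket_weight_space[of _ T "restr T \<alpha>" _ "restr T (\<xi> - \<alpha>)"]
    by (intro lie_prod_subset subspace_weight_space) (simp add: res)
  moreover have "WT (restr T \<phi>) \<subseteq> ?L"
  proof -
    have base: "W \<xi> \<subseteq> ?L"
    proof -
      have "W (\<alpha> + (\<xi> - \<alpha>)) \<subseteq> ?L"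
      proof (rule weight_space_add_subset[OF r\<alpha> r _ subspace_lie_prod])
        show "\<alpha> + (\<xi> - \<alpha>) \<in> roots H" using \<xi>(1) by simp
        show "bracket x y \<in> ?L" if "x \<in> W \<alpha>" "y \<in> W (\<xi> - \<alpha>)" for x y
          using that weight_space_subset_restr by (intro bracket_in_lie_prod) blast+
      qed
      then show ?thesis by simp
    qed
    \<comment> \<open>\<open>?L\<close> contains one root space of the class; being stable under
      Levi root vectors, it contains every root space reached from there.\<close>
    have "W \<eta> \<subseteq> ?L" if \<eta>: "\<eta> \<in> roots H" "restr T \<eta> = restr T \<phi>" for \<eta>
    proof (rule restr_class_connected[OF \<xi>(1) _ \<eta>(1), where R = "\<lambda>\<eta>. W \<eta> \<subseteq> ?L"])
      show "ord \<xi> \<noteq> 0" using o \<phi>(3) by simp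
      show "restr T \<eta> = restr T \<xi>" using \<eta> \<xi> by simp
      fix \<zeta> \<delta> assume *: "\<zeta> \<in> roots H" "\<delta> \<in> roots H" "ord \<delta> = 0" "\<zeta> + \<delta> \<in> roots H" "W \<zeta> \<subseteq> ?L"
      have "W (\<delta> + \<zeta>) \<subseteq> ?L"
      proof (rule weight_space_add_subset[OF *(2,1) _ subspace_lie_prod])
        show "\<delta> + \<zeta> \<in> roots H" using *(4) by (simp add: add.commute)
        show "bracket x y \<in> ?L" if "x \<in> W \<delta>" "y \<in> W \<zeta>" for x y
          using bracket_Levi_lie_prod[OF *(2,3) that(1)] that(2) *(5) by blast
      qed
      then show "W (\<zeta> + \<delta>) \<subseteq> ?L" by (simp add: add.commute)
    qed (rule base)
    moreover have "restr T \<phi> \<in> roots T" using roots_T \<phi> by auto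
    ultimately show ?thesis
      unfolding weight_space_T_eq[OF \<open>restr T \<phi> \<in> roots T\<close>]
        by (intro cvec.span_minimal subspace_lie_prod) blast
  qed
  ultimately show ?thesis using \<alpha>c r o' by blast
qed

lemma lie_prod_G:
  assumes "i \<ge> 2" shows "lie_prod (G 1) (G (i - 1)) = G i"
proof
  show "lie_prod (G 1) (G (i - 1)) \<subseteq> G i"
    using bracket_G[of 1 "i - 1"] assms by (intro lie_prod_subset subspace_G) auto
  have "W \<phi> \<subseteq> lie_prod (G 1) (G (i - 1))" if \<phi>: "\<phi> \<in> roots H" "ord \<phi> = i" for \<phi>
  proof -
    obtain \<alpha> \<chi> where *: "\<alpha> \<in> Pc" "\<chi> \<in> roots H" "ord \<chi> = i - 1"
      "lie_prod (WT (restr T \<alpha>)) (WT (restr T \<chi>)) = WT (restr T \<phi>)"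
      using lie_prod_t_root_spaces[OF \<phi> assms] by blast
    have "\<alpha> \<in> P" using *(1) Pc_subset by blast
    then have "\<alpha> \<in> roots H" "ord \<alpha> = 1" using base_root ord_base *(1) by auto
    then have "WT (restr T \<alpha>) \<subseteq> G 1" "WT (restr T \<chi>) \<subseteq> G (i - 1)"
      using weight_space_T_subset_G * assms by auto
    then show ?thesis using lie_prod_mono *(4) weight_space_subset_restr[of \<phi>] by blast
  qed
  then show "G i \<subseteq> lie_prod (G 1) (G (i - 1))"
    unfolding G_def[of i] by (intro cvec.span_minimal subspace_lie_prod) blast
qed

lemma lie_prod_F: assumes "i \<ge> 1" shows "lie_prod (F 1) (F i) = F (i + 1)"
proof
  show "lie_prod (F 1) (F i) \<subseteq> F (i + 1)"
    using bracket_F[of 1 i] assms by (intro lie_prod_subset subspace_F) (simp add: add.commute)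
  have "W \<phi> \<subseteq> lie_prod (F 1) (F i)" if \<phi>: "\<phi> \<in> roots H" "ord \<phi> \<ge> i + 1" for \<phi>
  proof -
    have "W \<phi> \<subseteq> G (ord \<phi>)" using weight_space_subset_G[OF \<phi>(1)] by simp
    also have "\<dots> = lie_prod (G 1) (G (ord \<phi> - 1))" using lie_prod_G[of "ord \<phi>"] \<phi> assms by simp
    also have "\<dots> \<subseteq> lie_prod (F 1) (F i)" using G_subset_F \<phi> by (intro lie_prod_mono) auto
    finally show ?thesis .
  qed
  then show "F (i + 1) \<subseteq> lie_prod (F 1) (F i)"
    unfolding F_def[of "i + 1"] by (intro cvec.span_minimal subspace_lie_prod) blast
qed

lemma lower_central_N: assumes "i \<ge> 1" shows "lower_central N i = F (int i)"
proof -
  have "(lie_prod N ^^ j) N = F (int j + 1)" for j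
    by (induction j) (simp_all add: N_eq lie_prod_F add.commute)
  then show ?thesis using assms by (simp add: lower_central_def of_nat_diff)
qed

section \<open>The highest root and the upper central series\<close>

lemma maximal_root_eq_highest:
  assumes \<psi>: "highest_root H P \<psi>" and \<phi>: "\<phi> \<in> roots H" and "positive \<phi>"
    and max: "\<And>\<alpha>. \<alpha> \<in> P \<Longrightarrow> \<phi> + \<alpha> \<notin> roots H"
  shows "\<phi> = \<psi>"
proof (rule ccontr)
  assume ne: "\<phi> \<noteq> \<psi>"
  have r\<psi>: "\<psi> \<in> roots H" and le: "\<And>\<alpha>. \<alpha> \<in> P \<Longrightarrow> c \<alpha> \<phi> \<le> c \<alpha> \<psi>" using \<psi> \<phi> by (auto simp: highest_root_def)
  have sum_nz: "\<phi> + \<delta> \<noteq> 0" if "positive \<delta>" for \<delta>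
  proof
    assume "\<phi> + \<delta> = 0"
    then have "\<delta> = - \<phi>" by (simp add: eq_neg_iff_add_eq_0 add.commute)
    then have "ht \<delta> = - ht \<phi>" using coeff_minus[OF \<phi>] by (simp add: ht_def sum_negf)
    then show False using positive_ht[OF that] positive_ht[OF \<open>positive \<phi>\<close>] by simp
  qed
  \<comment> \<open>Maximality makes \<phi> dominant. As \<psi> dominates \<phi> coefficientwise,
    the inner product of \<psi> and \<phi> is at least the squared length of \<phi>, so \<psi> -
    \<phi> is a positive root.\<close>
  have "rip \<phi> \<alpha> \<ge> 0" if "\<alpha> \<in> P" for \<alpha>
  proof (rule ccontr)
    assume "\<not> rip \<phi> \<alpha> \<ge> 0"
    moreover have "\<phi> \<noteq> - \<alpha>" using sum_nz[OF base_positive[OF that]] by (simp add: eq_neg_iff_add_eq_0)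
    ultimately show False using root_add[OF \<phi> base_root[OF that]] max[OF that] by simp
  qed
  then have "(\<Sum>\<alpha>\<in>P. of_int (c \<alpha> \<phi>) * rip \<phi> \<alpha>) \<le> (\<Sum>\<alpha>\<in>P. of_int (c \<alpha> \<psi>) * rip \<phi> \<alpha>)"
    using le by (intro sum_mono mult_right_mono) auto
  then have "rip \<psi> \<phi> > 0" using rip_sum[OF \<phi> \<phi>] rip_sum[OF r\<psi> \<phi>] rip_self[OF \<phi>] by simp
  then have r: "\<psi> - \<phi> \<in> roots H" using root_diff[OF r\<psi> \<phi>] ne by simp
  have "positive (\<psi> - \<phi>)" using r le by (simp add: positive_def coeff_diff[OF r\<psi> \<phi>])
  \<comment> \<open>No positive root can be added to \<phi>: in the step, the root vector of \<phi>
    commutes with those of \<delta> and \<alpha>, hence by the Jacobi identity with their nonzero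
    bracket, a root vector of \<delta> + \<alpha>.\<close>
  then have "\<phi> + (\<psi> - \<phi>) \<notin> roots H"
  proof (induction rule: positive_induct)
    case (base \<alpha>)
    then show ?case using max by blast
  next
    case (step \<delta> \<alpha>)
    have rs: "\<delta> \<in> roots H" "\<alpha> \<in> roots H" "\<delta> + \<alpha> \<in> roots H" using step positive_root base_root by auto
    have zero: "bracket x y = 0" if "x \<in> W \<phi>" "y \<in> W \<eta>" "positive \<eta>" "\<phi> + \<eta> \<notin> roots H" for x y \<eta>
      using bracket_weight_space[OF that(1,2)] sum_nz[OF that(3)] that(4)
        weight_space_nonroot[OF supported_on_add[OF root_supported[OF \<phi>] root_supported[OF positive_root[OF
          that(3)]]]] by blast
    have rsum: "\<alpha> + \<delta> \<in> roots H" using rs(3) by (simp add: add.commute)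
    let ?y = "bracket (root_vec \<alpha>) (root_vec \<delta>)"
    have y: "?y \<in> W (\<delta> + \<alpha>)" using bracket_weight_space[OF root_vec(1)[OF rs(2)] root_vec(1)[OF rs(1)]]
      by (simp add: add.commute)
    have y0: "?y \<noteq> 0" using root_spaces_bracket_nonzero[OF rs(2,1) rsum root_vec[OF rs(2)] root_vec[OF
      rs(1)]] .
    have "bracket (root_vec \<phi>) (root_vec \<alpha>) = 0"
      using zero[OF root_vec(1)[OF \<phi>] root_vec(1)[OF rs(2)] base_positive[OF step(2)] max[OF step(2)]] .
    moreover have "bracket (root_vec \<phi>) (root_vec \<delta>) = 0"
      using zero[OF root_vec(1)[OF \<phi>] root_vec(1)[OF rs(1)] step(1) step.IH] .
    ultimately have "bracket (root_vec \<phi>) ?y = 0"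
      unfolding bracket_derivation[of "root_vec \<phi>" "root_vec \<alpha>" "root_vec \<delta>"]
        by (simp add: bracket_left.zero bracket_right.zero)
    then show ?case using root_spaces_bracket_nonzero[OF \<phi> rs(3) _ root_vec[OF \<phi>] y y0] by blast
  qed
  then show False using r\<psi> by simp
qed

lemma exists_raising_root:
  assumes \<psi>: "highest_root H P \<psi>" and \<phi>: "\<phi> \<in> roots H" "ord \<phi> \<ge> 1" "ord \<phi> < ord \<psi>"
  shows "\<exists>\<gamma>\<in>roots H. ord \<gamma> = 1 \<and> \<phi> + \<gamma> \<in> roots H"
proof (rule ccontr)
  assume no: "\<not> ?thesis"
  define R where "R \<chi> \<longleftrightarrow> (\<forall>\<gamma>\<in>roots H. ord \<gamma> = 1 \<longrightarrow> \<chi> + \<gamma> \<notin> roots H)" for \<chi>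
  obtain \<chi> where \<chi>: "\<chi> \<in> roots H" "restr T \<chi> = restr T \<phi>"
    and max: "\<And>\<xi>. \<xi> \<in> roots H \<Longrightarrow> restr T \<xi> = restr T \<phi> \<Longrightarrow> ht \<xi> \<le> ht \<chi>"
    using finite_restr_class_extremal(2)[OF \<phi>(1)] by blast
  have o: "ord \<chi> = ord \<phi>" using restr_eq_ord[OF \<chi>(1) \<phi>(1) \<chi>(2)] .
  have "R \<chi>"
  proof (rule restr_class_connected[OF \<phi>(1) _ \<chi>])
    show "ord \<phi> \<noteq> 0" using \<phi> by simp
    show "R \<phi>" using no by (auto simp: R_def)
    fix \<xi> \<delta> assume *: "\<xi> \<in> roots H" "\<delta> \<in> roots H" "ord \<delta> = 0" "\<xi> + \<delta> \<in> roots H" "restr T \<xi> = restr T \<phi>"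
      "R \<xi>"
    have o\<xi>: "ord \<xi> = ord \<phi>" using restr_eq_ord[OF *(1) \<phi>(1) *(5)] .
    \<comment> \<open>By Jacobi the bracket of the vectors of \<xi> + \<delta> and \<gamma> comes
      from \<gamma> bracketed with \<delta> or with \<xi>. The second is 0 by
      \<open>R \<xi>\<close>; if the first were not, \<delta> + \<gamma> would be a root of order 1
      that can be added to \<xi>.\<close>
    show "R (\<xi> + \<delta>)" unfolding R_def
    proof (intro ballI impI notI)
      fix \<gamma> assume \<gamma>: "\<gamma> \<in> roots H" "ord \<gamma> = 1" "\<xi> + \<delta> + \<gamma> \<in> roots H"
      have "bracket (root_vec \<delta>) (root_vec \<gamma>) = 0"
      proof (rule ccontr)
        assume "bracket (root_vec \<delta>) (root_vec \<gamma>) \<noteq> 0"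
        then have "\<delta> + \<gamma> \<in> roots H"
          using bracket_root_spaces[OF *(2) \<gamma>(1) root_vec(1)[OF *(2)] root_vec(1)[OF \<gamma>(1)]] *(3) \<gamma>(2)
            by auto
        moreover have "ord (\<delta> + \<gamma>) = 1" using ord_add[OF *(2) \<gamma>(1)] *(3) \<gamma>(2) by simp
        ultimately show False using *(6) \<gamma>(3) by (auto simp: R_def add.assoc)
      qed
      moreover have "bracket (root_vec \<xi>) (root_vec \<gamma>) = 0"
        using bracket_root_spaces[OF *(1) \<gamma>(1) root_vec(1)[OF *(1)] root_vec(1)[OF \<gamma>(1)]] *(6) \<gamma>(1,2) o\<xi>
          \<phi>(2) by (auto simp: R_def)
      ultimately have "bracket (bracket (root_vec \<xi>) (root_vec \<delta>)) (root_vec \<gamma>) = 0"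
        by (simp add: bracket_bracket bracket_right.zero)
      moreover have "bracket (root_vec \<xi>) (root_vec \<delta>) \<noteq> 0"
        using root_spaces_bracket_nonzero[OF *(1,2,4) root_vec[OF *(1)] root_vec[OF *(2)]] .
      ultimately show False
        using root_spaces_bracket_nonzero[OF *(4) \<gamma>(1,3) bracket_weight_space[OF root_vec(1)[OF *(1)]
          root_vec(1)[OF *(2)]] _ root_vec[OF \<gamma>(1)]] by blast
    qed
  qed
  have "\<chi> + \<alpha> \<notin> roots H" if \<alpha>: "\<alpha> \<in> P" for \<alpha>
  proof
    assume r: "\<chi> + \<alpha> \<in> roots H"
    show False
    proof (cases "\<alpha> \<in> Pc")
      case True
      then show False using \<open>R \<chi>\<close> r base_root[OF \<alpha>] ord_base[OF \<alpha>] by (simp add: R_def)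
    next
      case False
      then have "restr T \<alpha> = 0" using restr_eq_0_iff_ord[OF base_root[OF \<alpha>]] ord_base[OF \<alpha>] by simp
      then have "restr T (\<chi> + \<alpha>) = restr T \<phi>" using \<chi>(2) by (simp add: restr_add)
      then show False using max[OF r] ht_add_base[OF \<chi>(1) \<alpha>] by simp
    qed
  qed
  then have "\<chi> = \<psi>"
    using maximal_root_eq_highest[OF \<psi> \<chi>(1) ord_pos_positive[OF \<chi>(1)]] o \<phi>(2) by simp
  then show False using o \<phi>(3) by simp
qed

lemma ord_le_highest:
  assumes \<psi>: "highest_root H P \<psi>" and "\<phi> \<in> roots H" shows "ord \<phi> \<le> ord \<psi>"
  unfolding ord_def using assms Pc_subset by (intro sum_mono) (auto simp: highest_root_def)

lemma F_above: assumes "highest_root H P \<psi>" "i > ord \<psi>" shows "F i = {0}"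
proof -
  have "{\<phi> \<in> roots H. ord \<phi> \<ge> i} = {}" using ord_le_highest[OF assms(1)] assms(2) by force
  then show ?thesis unfolding F_def by (simp only: UN_empty cvec.span_empty)
qed

lemma F_below: assumes "highest_root H P \<psi>" "i \<le> ord \<psi>" shows "F i \<noteq> {0}"
proof -
  have r: "\<psi> \<in> roots H" using assms(1) by (simp add: highest_root_def)
  then have "W \<psi> \<subseteq> F i" using weight_space_subset_F assms(2) by blast
  then show ?thesis using root_vec[OF r] by blast
qed

text \<open>The left side is stable under \<open>H\<close>, so it is decided on root spaces. A root
  of order below i can be raised by a root of order 1 to a root of order at most i, and the bracket
  of their vectors is nonzero outside \<open>F (i + 1)\<close>.\<close>

lemma centralizer_F:
  assumes \<psi>: "highest_root H P \<psi>" and i: "1 \<le> i" "i \<le> ord \<psi>"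
  shows "{x \<in> F 1. \<forall>y\<in>F 1. bracket x y \<in> F (i + 1)} = F i"
proof
  show "F i \<subseteq> {x \<in> F 1. \<forall>y\<in>F 1. bracket x y \<in> F (i + 1)}"
    using F_antimono[of 1 i] bracket_F[of i 1] i by auto
  let ?V = "{x \<in> F 1. \<forall>y\<in>F 1. bracket x y \<in> F (i + 1)}"
  have sub: "cvec.subspace ?V"
    using subspace_F[of 1] subspace_F[of "i + 1"]
    unfolding cvec.subspace_def by (auto simp: bracket_left.zero bracket_add_left bracket_scaleC_left)
  have st: "bracket h x \<in> ?V" if "h \<in> H" "x \<in> ?V" for h x
  proof -
    have "bracket (bracket h x) y \<in> F (i + 1)" if "y \<in> F 1" for y
      unfolding bracket_bracket using \<open>x \<in> ?V\<close> \<open>h \<in> H\<close> that bracket_H_F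
      by (intro cvec.subspace_diff[OF subspace_F]) auto
    then show ?thesis using that bracket_H_F by auto
  qed
  show "?V \<subseteq> F i"
  proof
    fix x assume x: "x \<in> ?V"
    show "x \<in> F i" unfolding F_def
    proof (rule in_span_root_spacesI)
      fix \<phi> assume \<phi>: "\<phi> \<in> weights" "comp \<phi> x \<noteq> 0"
      have "\<phi> \<in> {\<phi> \<in> roots H. ord \<phi> \<ge> 1}"
        using span_root_spaces_comp[of x "{\<phi> \<in> roots H. ord \<phi> \<ge> 1}" \<phi>] x \<phi> weights_supported
          by (auto simp: F_def)
      then have r: "\<phi> \<in> roots H" "ord \<phi> \<ge> 1" by auto
      have V: "W \<phi> \<subseteq> ?V" by (rule weight_space_in_stable_subspace[OF sub st x r(1) \<phi>(2)])
      have "ord \<phi> \<ge> i"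
      proof (rule ccontr)
        assume lt: "\<not> ord \<phi> \<ge> i"
        then obtain \<gamma> where \<gamma>: "\<gamma> \<in> roots H" "ord \<gamma> = 1" "\<phi> + \<gamma> \<in> roots H"
          using exists_raising_root[OF \<psi> r] i by auto
        have "root_vec \<gamma> \<in> F 1" using weight_space_subset_F[OF \<gamma>(1)] \<gamma>(2) root_vec(1)[OF \<gamma>(1)] by auto
        then have mem: "bracket (root_vec \<phi>) (root_vec \<gamma>) \<in> F (i + 1)" using V root_vec(1)[OF r(1)] by blast
        have w: "bracket (root_vec \<phi>) (root_vec \<gamma>) \<in> W (\<phi> + \<gamma>)"
          using bracket_weight_space root_vec(1)[OF r(1)] root_vec(1)[OF \<gamma>(1)] by blast
        have nz: "bracket (root_vec \<phi>) (root_vec \<gamma>) \<noteq> 0"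
          using root_spaces_bracket_nonzero[OF r(1) \<gamma>(1,3) root_vec[OF r(1)] root_vec[OF \<gamma>(1)]] .
        have "ord (\<phi> + \<gamma>) \<ge> i + 1"
          using weight_space_subset_if_mem[OF \<gamma>(3) subspace_F w nz mem] weight_space_subset_F[OF \<gamma>(3)]
            by blast
        then show False using lt ord_add[OF r(1) \<gamma>(1)] \<gamma>(2) by simp
      qed
      then show "\<phi> \<in> {\<phi> \<in> roots H. ord \<phi> \<ge> i}" using r by simp
    qed auto
  qed
qed

text \<open>The index runs downwards: \<open>s = 0\<close> must give \<open>{0}\<close>, and
  \<open>F\<close> is zero from \<open>ord \<psi> + 1\<close> on while still nonzero at
  \<open>ord \<psi>\<close>.\<close>

lemma upper_central_N:
  assumes \<psi>: "highest_root H P \<psi>" and "int s \<le> ord \<psi>"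
  shows "upper_central N s = F (ord \<psi> + 1 - int s)"
  using assms(2)
proof (induction s)
  case 0
  then show ?case using F_above[OF \<psi>, of "ord \<psi> + 1"] by simp
next
  case (Suc s)
  have "upper_central N s = F (ord \<psi> - int s + 1)" using Suc by (simp add: algebra_simps)
  then show ?case using centralizer_F[OF \<psi>, of "ord \<psi> - int s"] Suc.prems by (simp add: N_eq)
qed

text \<open>If the highest root had order at most 0, so would the negative of every root; then every
  root space, and \<open>H\<close> anyway, would lie in \<open>Q\<close>.\<close>

lemma ord_highest_pos:
  assumes \<psi>: "highest_root H P \<psi>" and "Q \<noteq> UNIV" shows "ord \<psi> \<ge> 1"
proof (rule ccontr)
  assume no: "\<not> ord \<psi> \<ge> 1"
  have "z \<in> Q" for z
  proof (rule mem_subspace_if_comps[OF subspace_Q])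
    show "comp 0 z \<in> Q" using comp_in[of 0 z] gen_weight_space_zero H_subset_Q by auto
    fix \<phi> assume \<phi>: "\<phi> \<in> roots H"
    have "ord (- \<phi>) \<le> 0" using ord_le_highest[OF \<psi> root_uminus[OF \<phi>]] no by simp
    then have "inQ \<phi>" using inQ_iff[OF \<phi>] ord_uminus[OF \<phi>] by simp
    then show "comp \<phi> z \<in> Q" using comp_in_weight_space[OF \<phi>] by (auto simp: inQ_def)
  qed
  then show False using assms(2) by blast
qed

end

section \<open>Translation to enumerated simple roots and graded parts\<close>

locale parabolic_enumerated = parabolic H P Q N M
  for H :: "'g::complex_lie_algebra set" and P Q N M +
  fixes a :: "nat \<Rightarrow> 'g \<Rightarrow> complex" and \<psi> :: "'g \<Rightarrow> complex"
  assumes enumeration: "bij_betw a {1..cvec.dim T} (P - roots_of_subalgebra H M)"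
    and highest: "highest_root H P \<psi>"
    and proper: "Q \<noteq> UNIV"
begin

lemma sum_enumeration: "(\<Sum>j = 1..cvec.dim T. root_coeff P (a j) \<phi>) = ord \<phi>"
  unfolding ord_def using sum.reindex_bij_betw[OF enumeration[unfolded Pc_eq], of "\<lambda>\<alpha>. c \<alpha> \<phi>"] .

lemma k_cent_eq: "int (k_cent P \<psi> T a) = ord \<psi>"
  using ord_highest_pos[OF highest proper] unfolding k_cent_def sum_enumeration by simp

lemma t_root_order_restr:
  assumes \<phi>: "\<phi> \<in> roots H" shows "t_root_order H P T a (restr T \<phi>) = ord \<phi>"
proof -
  let ?\<chi> = "SOME \<chi>. \<chi> \<in> roots H \<and> restr T \<chi> = restr T \<phi>"
  have "\<exists>\<chi>. \<chi> \<in> roots H \<and> restr T \<chi> = restr T \<phi>" using \<phi> by blast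
  from someI_ex[OF this] have "ord ?\<chi> = ord \<phi>" using restr_eq_ord \<phi> by blast
  then show ?thesis unfolding t_root_order_def t_root_coeff_def sum_enumeration .
qed

text \<open>The bound on \<open>i\<close> matters: \<open>G 0\<close> collects the root spaces of
  the Levi factor, while no t-root has order 0.\<close>

lemma graded_part_eq: assumes "i \<ge> 1" shows "graded_part H P T a i = G (int i)"
proof
  have "WT \<nu> \<subseteq> G (int i)" if \<nu>: "\<nu> \<in> roots T" "t_root_order H P T a \<nu> = int i" for \<nu>
    using \<nu> t_root_order_restr weight_space_T_subset_G by (elim root_T_cases) auto
  then show "graded_part H P T a i \<subseteq> G (int i)"
    unfolding graded_part_def by (intro cvec.span_minimal subspace_G) blast
  have "W \<phi> \<subseteq> graded_part H P T a i" if \<phi>: "\<phi> \<in> roots H" "ord \<phi> = int i" for \<phi>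
  proof -
    have "restr T \<phi> \<in> {\<nu> \<in> roots T. t_root_order H P T a \<nu> = int i}"
      using \<phi> assms roots_T t_root_order_restr[OF \<phi>(1)] by auto
    then have "W \<phi> \<subseteq> (\<Union>\<nu>\<in>{\<nu> \<in> roots T. t_root_order H P T a \<nu> = int i}. WT \<nu>)"
      using weight_space_subset_restr[of \<phi>] by blast
    then show ?thesis unfolding graded_part_def by (rule order_trans[OF _ cvec.span_superset])
  qed
  then show "G (int i) \<subseteq> graded_part H P T a i"
    unfolding G_def graded_part_def by (intro cvec.span_minimal) auto
qed

lemma span_graded_parts:
  assumes "i \<ge> 1"
  shows "cvec.span (\<Union>j\<in>{i..k_cent P \<psi> T a}. graded_part H P T a j) = F (int i)"
proof
  have "graded_part H P T a j \<subseteq> F (int i)" if "j \<ge> i" for j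
    using graded_part_eq[of j] G_subset_F[of "int i" "int j"] that assms by simp
  then show "cvec.span (\<Union>j\<in>{i..k_cent P \<psi> T a}. graded_part H P T a j) \<subseteq> F (int i)"
    by (intro cvec.span_minimal subspace_F UN_least) simp
  have "W \<phi> \<subseteq> cvec.span (\<Union>j\<in>{i..k_cent P \<psi> T a}. graded_part H P T a j)"
    if \<phi>: "\<phi> \<in> roots H" "ord \<phi> \<ge> int i" for \<phi>
  proof -
    define j where "j = nat (ord \<phi>)"
    have j: "int j = ord \<phi>" using \<phi>(2) by (simp add: j_def)
    then have "j \<in> {i..k_cent P \<psi> T a}" "j \<ge> 1"
      using \<phi> assms ord_le_highest[OF highest \<phi>(1)] k_cent_eq by auto
    moreover have "W \<phi> \<subseteq> graded_part H P T a j"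
      unfolding graded_part_eq[OF \<open>j \<ge> 1\<close>] j using weight_space_subset_G[OF \<phi>(1)] by blast
    ultimately have "W \<phi> \<subseteq> (\<Union>j\<in>{i..k_cent P \<psi> T a}. graded_part H P T a j)" by blast
    then show ?thesis by (rule order_trans[OF _ cvec.span_superset])
  qed
  then show "F (int i) \<subseteq> cvec.span (\<Union>j\<in>{i..k_cent P \<psi> T a}. graded_part H P T a j)"
    unfolding F_def by (intro cvec.span_minimal) auto
qed

lemma t_root_space_bracket:
  assumes i: "2 \<le> i" and \<nu>: "\<nu> \<in> roots T" "WT \<nu> \<subseteq> graded_part H P T a i"
  shows "\<exists>j\<in>{1..cvec.dim T}. \<exists>\<mu>\<in>roots T. WT \<mu> \<subseteq> graded_part H P T a (i - 1) \<and>
    lie_prod (WT (restr T (a j))) (WT \<mu>) = WT \<nu>"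
proof -
  obtain \<phi> where \<phi>: "\<phi> \<in> roots H" "ord \<phi> \<noteq> 0" "\<nu> = restr T \<phi>" using root_T_cases[OF \<nu>(1)] by blast
  have "ord \<phi> = int i"
    using \<nu>(2) weight_space_T_subset_G[OF \<phi>(1,2)] graded_part_eq[of i] i \<phi>(3) by simp
  then obtain \<alpha> \<chi> where *: "\<alpha> \<in> Pc" "\<chi> \<in> roots H" "ord \<chi> = int i - 1"
    "lie_prod (WT (restr T \<alpha>)) (WT (restr T \<chi>)) = WT \<nu>"
    using lie_prod_t_root_spaces[OF \<phi>(1), of "int i"] i \<phi>(3) by auto
  obtain j where j: "j \<in> {1..cvec.dim T}" "\<alpha> = a j"
    using *(1) bij_betw_imp_surj_on[OF enumeration[unfolded Pc_eq]] by blast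
  have "restr T \<chi> \<in> roots T" using *(2,3) i roots_T by auto
  moreover have "WT (restr T \<chi>) \<subseteq> graded_part H P T a (i - 1)"
    using weight_space_T_subset_G[OF *(2)] *(3) i graded_part_eq[of "i - 1"] by (simp add: of_nat_diff)
  ultimately show ?thesis using j *(4) by blast
qed

lemma lie_prod_graded_part:
  assumes "2 \<le> i"
  shows "lie_prod (graded_part H P T a 1) (graded_part H P T a (i - 1)) = graded_part H P T a i"
  using lie_prod_G[of "int i"] assms by (simp add: graded_part_eq of_nat_diff)

lemma lower_central_length_N: "lower_central_length N (k_cent P \<psi> T a)"
  unfolding lower_central_length_def
proof (intro conjI allI impI)
  let ?k = "k_cent P \<psi> T a"
  show k: "1 \<le> ?k" using k_cent_eq ord_highest_pos[OF highest proper] by simp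
  show "lower_central N ?k \<noteq> {0}" using lower_central_N[OF k] F_below[OF highest] k_cent_eq by simp
  show "j \<le> ?k" if "lower_central N j \<noteq> {0}" for j
  proof (rule ccontr)
    assume "\<not> j \<le> ?k"
    then have "lower_central N j = {0}"
      using lower_central_N[of j] F_above[OF highest, of "int j"] k_cent_eq by simp
    then show False using that by simp
  qed
qed

lemma upper_central_N_k_cent:
  assumes "s \<le> k_cent P \<psi> T a"
  shows "upper_central N s = F (int (k_cent P \<psi> T a + 1 - s))"
  using upper_central_N[OF highest, of s] assms k_cent_eq by (simp add: of_nat_diff add.commute)

text \<open>If two consecutive terms agreed, repeated bracketing with \<open>F 1\<close> would keep
  the filtration constant from \<open>i\<close> on, although it vanishes above the order of the
  highest root.\<close>

lemma F_strict:
  assumes "1 \<le> i" "i \<le> ord \<psi>" shows "F (i + 1) \<subset> F i"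
proof -
  have "F i \<noteq> F (i + 1)"
  proof
    assume eq: "F i = F (i + 1)"
    have "F (i + int n) = F i" for n
    proof (induction n)
      case (Suc n)
      have "F (i + int (Suc n)) = lie_prod (F 1) (F (i + int n))"
        using lie_prod_F[of "i + int n"] assms by (simp add: algebra_simps)
      also have "\<dots> = F i" using Suc eq lie_prod_F[of i] assms by simp
      finally show ?case .
    qed simp
    then have "F (i + int (nat (ord \<psi>))) = F i" by blast
    then show False using F_above[OF highest, of "i + int (nat (ord \<psi>))"] F_below[OF highest assms(2)] assms
      by simp
  qed
  then show ?thesis using F_antimono[of i "i + 1"] by auto
qed

lemma upper_central_length_N: "upper_central_length N (k_cent P \<psi> T a)"
  unfolding upper_central_length_def
proof (intro conjI ballI)
  let ?k = "k_cent P \<psi> T a"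
  show "1 \<le> ?k" using k_cent_eq ord_highest_pos[OF highest proper] by simp
  show "upper_central N ?k = N" using upper_central_N_k_cent[of ?k] by (simp add: N_eq)
  fix s assume s: "s \<in> {1..<?k}"
  then have eqs: "upper_central N s = F (int (?k - s) + 1)" "upper_central N (Suc s) = F (int (?k - s))"
    using upper_central_N_k_cent[of s] upper_central_N_k_cent[of "Suc s"] 
    by (simp_all add: of_nat_diff Suc_diff_le add.commute del: upper_central.simps)
  have "F (int (?k - s) + 1) \<subset> F (int (?k - s))" using s k_cent_eq by (intro F_strict) auto
  then show "upper_central N s \<subset> upper_central N (Suc s)" by (simp only: eqs)
qed

lemma lower_eq_upper:
  assumes "i \<in> {1..k_cent P \<psi> T a}"
  shows "lower_central N i = upper_central N (k_cent P \<psi> T a - i + 1)"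
proof -
  have *: "k_cent P \<psi> T a - i + 1 \<le> k_cent P \<psi> T a" "k_cent P \<psi> T a + 1 - (k_cent P \<psi> T a - i + 1) = i"
    "1 \<le> i"
    using assms by auto
  show ?thesis unfolding lower_central_N[OF *(3)] upper_central_N_k_cent[OF *(1)] *(2) ..
qed

end

theorem theorem2p12:
  fixes \<hh> \<qq> \<mm> \<nn> \<tt> :: "'g::complex_lie_algebra set"
    and \<Pi> R :: "('g \<Rightarrow> complex) set"
    and \<psi> :: "'g \<Rightarrow> complex"
    and \<alpha> \<beta> :: "nat \<Rightarrow> 'g \<Rightarrow> complex"
    and l k :: nat
    and \<gg> :: "('g \<Rightarrow> complex) \<Rightarrow> 'g set"
    and N :: "nat \<Rightarrow> 'g set"
  assumes "simple_lie_algebra (UNIV :: 'g set)"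
    and "cartan_subalgebra \<hh>"
    and "simple_roots \<hh> \<Pi>"
    and "highest_root \<hh> \<Pi> \<psi>"
    and "standard_parabolic \<hh> \<Pi> \<qq>"
    and "\<qq> \<noteq> UNIV"
    and "is_nilradical \<qq> \<nn>"
    and "levi_factor \<qq> \<nn> \<mm>"
    and "\<hh> \<subseteq> \<mm>"
  defines "\<tt> \<equiv> lie_center \<mm>"
  defines "l \<equiv> cvec.dim \<tt>"
  assumes "bij_betw \<alpha> {1..l} (\<Pi> - roots_of_subalgebra \<hh> \<mm>)"
  defines "\<beta> \<equiv> \<lambda>j. restr \<tt> (\<alpha> j)"
    and "R \<equiv> roots \<tt>"
    and "\<gg> \<equiv> weight_space \<tt>"
    and "N \<equiv> graded_part \<hh> \<Pi> \<tt> \<alpha>"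
    and "k \<equiv> k_cent \<Pi> \<psi> \<tt> \<alpha>"
  shows
    "(\<forall>i \<nu>. 2 \<le> i \<and> i \<le> k \<and> \<nu> \<in> R \<and> \<gg> \<nu> \<subseteq> N i \<longrightarrow>
        (\<exists>j\<in>{1..l}. \<exists>\<mu>\<in>R. \<gg> \<mu> \<subseteq> N (i - 1) \<and> lie_prod (\<gg> (\<beta> j)) (\<gg> \<mu>) = \<gg> \<nu>)) \<and>
     (\<forall>i. 2 \<le> i \<and> i \<le> k \<longrightarrow> lie_prod (N 1) (N (i - 1)) = N i) \<and>
     (\<forall>i\<ge>1. lower_central \<nn> i = cvec.span (\<Union>j\<in>{i..k}. N j)) \<and>
     lower_central_length \<nn> k \<and>
     upper_central_length \<nn> k \<and>
     (\<forall>i\<in>{1..k}. lower_central \<nn> i = upper_central \<nn> (k - i + 1))"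
proof -
  interpret parabolic \<hh> \<Pi> \<qq> \<nn> \<mm>
    using assms(1-3,5,7-9) by unfold_locales
  have T: "\<tt> = T" by (simp add: T_def \<tt>_def)
  interpret parabolic_enumerated \<hh> \<Pi> \<qq> \<nn> \<mm> \<alpha> \<psi>
    using assms(4,6) assms(12)[unfolded l_def T] by unfold_locales
  show ?thesis
    unfolding \<beta>_def R_def \<gg>_def N_def k_def l_def T
    using t_root_space_bracket lie_prod_graded_part lower_central_N span_graded_parts
      lower_central_length_N upper_central_length_N lower_eq_upper by auto
qed

end
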